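(* Let $a,b,c\in\mathbb R$ satisfy $a,b>-1$, $0<c-a-b-2<1$ and $1<c<\min\{a+2,b+2\}$. Then the following hold. (a) Suppose $0<2-c+b<1/2$. Then: (1) $T_{a,b,c}$ and $S_{a,b,c}$ map $L^p(\mathbb D)$ boundedly into $L^{q,\infty}(\mathbb D)$ if $1\le p,q\le\infty$, $\frac1q=\frac1p+c-a-b-2$, $\frac1p<b+1$ and $\frac1q>-a$, or if $0\le\frac1p<2-c+b$ and $q=-\frac1a$. Both $T_{a,b,c}$ and $S_{a,b,c}$ are unbounded from $L^p(\mathbb D)$ to $L^{q,\infty}(\mathbb D)$ if $p=\frac{1}{2-c+b}$ and $q=-\frac1a$, or if $p=\frac{1}{b+1}$ and $c-1-a\le\frac1q\le1$. (2) $T_{a,b,c}$ and $S_{a,b,c}$ map $L^{p,1}(\mathbb D)$ boundedly into $L^{q,\infty}(\mathbb D)$ if $p=\frac{1}{2-c+b}$ and $q=-\frac1a$, or if $p=\frac{1}{b+1}$ and $c-1-a\le\frac1q\le1$. (b) Suppose $1/2\le 2-c+b<1$. Then: (1) $T_{a,b,c}$ and $S_{a,b,c}$ map $L^p(\mathbb D)$ boundedly into $L^{q,\infty}(\mathbb D)$ if $1\le p,q\le\infty$, $\frac1q=\frac1p+c-a-b-2$, $\frac1p<b+1$ and $\frac1q>-a$, or if $0\le\frac1p<2-c+b$ and $q=-\frac1a$. Both $T_{a,b,c}$ and $S_{a,b,c}$ are unbounded from $L^p(\mathbb D)$ to $L^{q,\infty}(\mathbb D)$ if $p=\frac{1}{b+1}$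 and $c-1-a\le\frac1q\le1$. (2) $T_{a,b,c}$ maps $L^{\frac{1}{2-c+b}}(\mathbb D)$ boundedly into $L^{-\frac1a,\infty}(\mathbb D)$, while $S_{a,b,c}$ does not. (3) $T_{a,b,c}$ and $S_{a,b,c}$ map $L^{p,1}(\mathbb D)$ boundedly into $L^{q,\infty}(\mathbb D)$ if $p=\frac{1}{2-c+b}$ and $q=-\frac1a$, or if $p=\frac{1}{b+1}$ and $c-1-a\le\frac1q\le1$.
   Context: $\mathbb D$ is the open unit disc in $\mathbb C$, $dA$ is normalized area measure on $\mathbb D$, and $|E|$ is the $dA$-measure of $E\subseteq\mathbb D$. For $a,b,c\in\mathbb R$, $$T_{a,b,c}f(z):=(1-|z|^2)^a\int_{\mathbb D}\frac{(1-|w|^2)^b}{(1-z\overline w)^c}f(w)\,dA(w),\qquad S_{a,b,c}f(z):=(1-|z|^2)^a\int_{\mathbb D}\frac{(1-|w|^2)^b}{|1-z\overline w|^c}f(w)\,dA(w),$$ with the principal branch of the power. $L^p(\mathbb D)=L^p(\mathbb D,dA)$. For $1\le q<\infty$, $\|f\|_{L^{q,\infty}}=\sup_{\lambda>0}\lambda|\{|f|>\lambda\}|^{1/q}$, and $L^{\infty,\infty}=L^\infty$. For $1\le p<\infty$, $\|f\|_{L^{p,1}}=p\int_0^\infty|\{|f|>\lambda\}|^{1/p}\,d\lambda$. An operator $\mathcal T$ maps $X$ boundedly into $Y$ if for every $f\in X$ the defining integral converges absolutely for a.e. $z$ and $\|\mathcal Tf\|_Y\le C\|f\|_X$ with $C$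 independent of $f$; otherwise it is unbounded from $X$ to $Y$. *)

theory Defs
  imports "HOL-Analysis.Analysis" "HOL-Probability.Essential_Supremum"
begin

text \<open>Normalized area measure on the open unit disc.\<close>

definition dA :: "complex measure" where
  "dA = scale_measure (ennreal (1 / pi)) (lebesgue_on (ball 0 1))"

text \<open>
  Exponents in \<open>[1, \<infinity>]\<close> are extended reals, so that \<open>1 / \<infinity> = 0\<close>.
  The (quasi-)norms below are \<open>ennreal\<close>-valued; the corresponding space consists of the
  \<open>dA\<close>-measurable functions of finite (quasi-)norm.  Since \<open>dA\<close> is finite, using the
  real-valued \<open>measure\<close> in the distribution function loses nothing.
\<close>

definition dist_fun :: "(complex \<Rightarrow> complex) \<Rightarrow> real \<Rightarrow> real" where
  "dist_fun f t = measure dA {z \<in> space dA. t < norm (f z)}"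

definition Linf_norm :: "(complex \<Rightarrow> complex) \<Rightarrow> ennreal" where
  "Linf_norm f = esssup dA (\<lambda>z. ennreal (norm (f z)))"

definition Lp_norm :: "ereal \<Rightarrow> (complex \<Rightarrow> complex) \<Rightarrow> ennreal" where
  "Lp_norm p f =
     (if p = \<infinity> then Linf_norm f
      else let I = (\<integral>\<^sup>+ z. ennreal (norm (f z) powr real_of_ereal p) \<partial>dA)
           in if I = \<infinity> then \<infinity> else ennreal (enn2real I powr (1 / real_of_ereal p)))"

definition Lweak_norm :: "ereal \<Rightarrow> (complex \<Rightarrow> complex) \<Rightarrow> ennreal" where
  "Lweak_norm q f =
     (if q = \<infinity> then Linf_norm f
      else SUP t\<in>{0<..}. ennreal (t * dist_fun f t powr (1 / real_of_ereal q)))"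

definition Lp1_norm :: "real \<Rightarrow> (complex \<Rightarrow> complex) \<Rightarrow> ennreal" where
  "Lp1_norm p f =
     ennreal p * (\<integral>\<^sup>+ t\<in>{0<..}. ennreal (dist_fun f t powr (1 / p)) \<partial>lborel)"

text \<open>
  The complex power \<open>x powr y = exp (y * Ln x)\<close> is the principal branch;
  \<open>1 - z * cnj w\<close> has positive real part for \<open>z, w\<close> in the disc.
\<close>

definition T_kernel :: "real \<Rightarrow> real \<Rightarrow> complex \<Rightarrow> complex \<Rightarrow> complex" where
  "T_kernel b c z w =
     complex_of_real ((1 - (norm w)\<^sup>2) powr b) / (1 - z * cnj w) powr complex_of_real c"

definition S_kernel :: "real \<Rightarrow> real \<Rightarrow> complex \<Rightarrow> complex \<Rightarrow> complex" where
  "S_kernel b c z w =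
     complex_of_real ((1 - (norm w)\<^sup>2) powr b / norm (1 - z * cnj w) powr c)"

definition weighted_op ::
    "real \<Rightarrow> (complex \<Rightarrow> complex \<Rightarrow> complex) \<Rightarrow> (complex \<Rightarrow> complex) \<Rightarrow> complex \<Rightarrow> complex" where
  "weighted_op a K f z =
     complex_of_real ((1 - (norm z)\<^sup>2) powr a) * (LINT w|dA. K z w * f w)"

text \<open>
  \<open>weighted_op a (T_kernel b c)\<close> and \<open>weighted_op a (S_kernel b c)\<close> are the operators
  \<open>T\<close> and \<open>S\<close> with parameters \<open>a, b, c\<close>.  Bochner integrability of the integrand is
  absolute convergence of the defining integral; it has to be demanded explicitly because the
  Bochner integral of a non-integrable function is \<open>0\<close>.
\<close>

definition maps_boundedly ::
    "real \<Rightarrow> (complex \<Rightarrow> complex \<Rightarrow> complex) \<Rightarrow>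
     ((complex \<Rightarrow> complex) \<Rightarrow> ennreal) \<Rightarrow> ((complex \<Rightarrow> complex) \<Rightarrow> ennreal) \<Rightarrow> bool" where
  "maps_boundedly a K NX NY \<longleftrightarrow>
     (\<exists>C::real. \<forall>f \<in> borel_measurable dA. NX f < \<infinity> \<longrightarrow>
        (AE z in dA. integrable dA (\<lambda>w. K z w * f w)) \<and>
        weighted_op a K f \<in> borel_measurable dA \<and>
        NY (weighted_op a K f) \<le> ennreal C * NX f)"

definition T_bounded ::
    "real \<Rightarrow> real \<Rightarrow> real \<Rightarrow>
     ((complex \<Rightarrow> complex) \<Rightarrow> ennreal) \<Rightarrow> ((complex \<Rightarrow> complex) \<Rightarrow> ennreal) \<Rightarrow> bool" where
  "T_bounded a b c = maps_boundedly a (T_kernel b c)"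

definition S_bounded ::
    "real \<Rightarrow> real \<Rightarrow> real \<Rightarrow>
     ((complex \<Rightarrow> complex) \<Rightarrow> ennreal) \<Rightarrow> ((complex \<Rightarrow> complex) \<Rightarrow> ennreal) \<Rightarrow> bool" where
  "S_bounded a b c = maps_boundedly a (S_kernel b c)"

end

theory Submission
  imports Defs "HOL-Probability.Probability" "HOL-Real_Asymp.Real_Asymp"
begin

text \<open>
  Write \<open>rho w = 1 - |w|^2\<close>, \<open>d = 2 - c + b\<close> and \<open>s = c - a - b - 2\<close>, so that \<open>- a = d + s\<close>.
  Averaged over circles, \<open>|1 - z cnj w| powr (- c)\<close> is comparable to
  \<open>max (rho z) (rho w) powr (1 - c)\<close>, so every estimate with absolute values becomes one in a
  single real variable.  As \<open>s > 0\<close> forces \<open>q < p\<close>, it is enough to control the output on shells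
  \<open>rho z ~ r\<close>: the shells with \<open>r\<close> below a threshold are small, and the Chebyshev bounds on
  the others form a geometric series.

  Away from the endpoints this is Schur's test with a power of \<open>rho\<close>.  At the Lorentz
  endpoints one bounds the kernel integrated over \<open>G \<times> E\<close> by \<open>|E| powr d * |G| powr (1 + a)\<close>
  and integrates over the level sets of \<open>f\<close>; the endpoint \<open>p = 1 / (b + 1)\<close> is the adjoint of
  \<open>p = 1 / d\<close>.

  For \<open>T\<close> and \<open>p = 1 / d \<le> 2\<close>, absolute values lose a logarithm.  On a shell, however, \<open>T\<close> is
  bounded in \<open>L^1\<close> by positivity and in \<open>L^2\<close> by orthogonality of the monomials, for weights
  in which cutting \<open>f\<close> at height \<open>t * rho powr (- d)\<close> gives the weak type estimate for all
  \<open>1 < p \<le> 2\<close>.  The logarithm is real for \<open>S\<close>, as the truncations of \<open>rho powr (- d)\<close> show, and for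
  \<open>T\<close> if \<open>p > 2\<close>: placing \<open>w ^ 2 ^ k\<close> on the \<open>k\<close>-th dyadic shell produces a lacunary
  polynomial with \<open>N\<close> terms of size \<open>1\<close>, hence of size \<open>sqrt N\<close> on a fixed proportion of a thin
  shell at the boundary, against an input of norm \<open>N powr d\<close> with \<open>d < 1 / 2\<close>.  Finally, at
  \<open>p = 1 / (b + 1)\<close> the defining integral itself diverges for a suitable \<open>f\<close>.
\<close>

text \<open>The exponent \<open>d\<close> is critical because \<open>b - d + (1 - c) = - 1\<close>.
  For \<open>rho powr (- d)\<close> both the integral of the power \<open>1 / d\<close> and the
  circle-averaged kernel integral therefore collect the same amount from every dyadic shell. Over N
  shells the input has norm of order N^d, while N contributions of size 1 reach the output. If they
  add up in phase they give N, and \<open>S\<close> fails because \<open>d < 1\<close>.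
  Orthogonality leaves sqrt N for \<open>T\<close>, and comparing sqrt N with N^d puts the threshold
  at \<open>d = 1 / 2\<close>. At \<open>p = 1 / (b + 1)\<close> the obstruction is of another kind:
  \<open>rho powr b\<close> lies in the weak space of the conjugate exponent \<open>- 1 / b\<close>,
  but not in the strong one. So \<open>L^{p,1}\<close> can be paired with it and \<open>L^p\<close>
  cannot. The parameter \<open>s\<close> is symmetric in \<open>a\<close> and \<open>b\<close>:
  \<open>s > 0\<close> says \<open>- a > 2 - c + b\<close> and equally
  \<open>- b > 2 - c + a\<close>. This is why exchanging \<open>a\<close> and \<open>b\<close>
  carries one Lorentz endpoint to the other. The hypotheses on \<open>c\<close> force
  \<open>a\<close> and \<open>b\<close> into (-1, 0) and \<open>d\<close> into (0, 1).\<close>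

abbreviation disc_nn_integral :: "(complex \<Rightarrow> ennreal) \<Rightarrow> ennreal" (binder "\<integral>\<^sub>D " 10) where
  "disc_nn_integral f \<equiv> integral\<^sup>N dA f"

abbreviation abs_kernel :: "real \<Rightarrow> complex \<Rightarrow> complex \<Rightarrow> real" where
  "abs_kernel c z w \<equiv> norm (1 - z * cnj w) powr (- c)"

abbreviation Lp_integral :: "real \<Rightarrow> (complex \<Rightarrow> complex) \<Rightarrow> ennreal" where
  "Lp_integral p f \<equiv> \<integral>\<^sub>D w. ennreal (norm (f w) powr p)"

abbreviation T_integral :: "real \<Rightarrow> real \<Rightarrow> (complex \<Rightarrow> complex) \<Rightarrow> complex \<Rightarrow> complex" where
  "T_integral b c f z \<equiv> LINT w|dA. T_kernel b c z w * f w"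

section \<open>Area measure on the disc\<close>

text \<open>
  The image of Lebesgue measure is invariant under translations, hence a multiple of Lebesgue
  measure; the unit ball, which the isometry preserves, shows that the factor is \<open>1\<close>.
\<close>

lemma lborel_distr_linear_isometry:
  fixes R :: "'a::euclidean_space \<Rightarrow> 'a"
  assumes lin: "linear R" and iso: "\<And>x. norm (R x) = norm x"
  shows "distr lborel borel R = lborel"
proof (rule measure_eqI)
  define \<mu> where "\<mu> = distr lborel borel R"
  have [measurable]: "R \<in> borel_measurable borel"
    using lin by (intro borel_measurable_continuous_onI linear_continuous_on linear_conv_bounded_linear[THEN iffD1])
  have sets_mu [measurable_cong, simp]: "sets \<mu> = sets borel" and space_mu [simp]: "space \<mu> = UNIV"
    by (simp_all add: \<mu>_def)
  \<comment> \<open>Every translation by \<open>y\<close> is then the image of a translation by some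
    \<open>y'\<close> with \<open>R y' = y\<close>; this transfers invariance to the image
    measure.\<close>
  have surj: "surj R"
    using lin iso by (metis linear_injective_imp_surjective linear_injective_0 norm_eq_zero)
  have inv_mu: "(\<integral>\<^sup>+x. g (x + y) \<partial>\<mu>) = (\<integral>\<^sup>+x. g x \<partial>\<mu>)"
    if [measurable]: "g \<in> borel_measurable borel" for g and y :: 'a
  proof -
    obtain y' where y': "y = R y'" using surj by blast
    have "(\<integral>\<^sup>+x. g (x + y) \<partial>\<mu>) = (\<integral>\<^sup>+x. g (R x + R y') \<partial>lborel)"
      by (simp add: \<mu>_def nn_integral_distr y')
    also have "\<dots> = (\<integral>\<^sup>+x. g (R (y' + x)) \<partial>lborel)"
      by (simp add: linear_add[OF lin] add.commute)
    also have "\<dots> = (\<integral>\<^sup>+x. g (R x) \<partial>distr lborel borel ((+) y'))"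
      by (simp add: nn_integral_distr)
    also have "\<dots> = (\<integral>\<^sup>+x. g x \<partial>\<mu>)"
      by (simp add: lborel_distr_plus \<mu>_def nn_integral_distr)
    finally show ?thesis .
  qed
  have inv_l: "(\<integral>\<^sup>+x. g (x + y) \<partial>lborel) = (\<integral>\<^sup>+x. g x \<partial>lborel)"
    if [measurable]: "g \<in> borel_measurable borel" for g and y :: 'a
  proof -
    have "(\<integral>\<^sup>+x. g (x + y) \<partial>lborel) = (\<integral>\<^sup>+x. g x \<partial>distr lborel borel ((+) y))"
      by (simp add: nn_integral_distr add.commute)
    then show ?thesis by (simp add: lborel_distr_plus)
  qed
  fix A :: "'a set"
  assume "A \<in> sets (distr lborel borel R)"
  then have A [measurable]: "A \<in> sets borel" by simp
  let ?B = "ball 0 1 :: 'a set"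
  have [measurable]: "?B \<in> sets borel" by simp
  have Rball: "R -` ?B = ?B" by (auto simp: iso)
  have muB: "emeasure \<mu> ?B = emeasure lborel ?B"
    by (simp add: \<mu>_def emeasure_distr Rball)
  have sig: "sigma_finite_measure \<mu>"
  proof (rule sigma_finite_measure.intro, intro exI conjI)
    let ?C = "range (\<lambda>n::nat. ball (0::'a) n)"
    show "countable ?C" "?C \<subseteq> sets \<mu>" by auto
    show "\<Union>?C = space \<mu>" using reals_Archimedean2 by (auto simp: dist_norm)
    show "\<forall>a\<in>?C. emeasure \<mu> a \<noteq> \<infinity>"
    proof safe
      fix n :: nat
      assume "emeasure \<mu> (ball 0 (real n)) = \<infinity>"
      moreover have "R -` ball 0 (real n) = ball 0 (real n)" by (auto simp: iso)
      ultimately show False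
        by (simp add: \<mu>_def emeasure_distr)
           (metis emeasure_lborel_ball_finite infinity_ennreal_def order_less_irrefl)
    qed
  qed
  interpret \<mu>: sigma_finite_measure \<mu> by (rule sig)
  interpret pair_sigma_finite \<mu> "lborel :: 'a measure" ..
  \<comment> \<open>Uniqueness of Haar measure by Fubini: shift in \<open>y\<close> for fixed
    \<open>x\<close>, then in \<open>x\<close> for fixed \<open>y\<close>. This moves Lebesgue
    measure onto \<open>A\<close> and the image measure onto the ball, whose symmetry absorbs the
    sign of \<open>- x\<close>.\<close>
  have "emeasure \<mu> A * emeasure lborel ?B = (\<integral>\<^sup>+x. (\<integral>\<^sup>+y. indicator A x * indicator ?B y \<partial>lborel) \<partial>\<mu>)"
    by (simp add: nn_integral_cmult_indicator nn_integral_multc)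
  also have "\<dots> = (\<integral>\<^sup>+x. (\<integral>\<^sup>+y. indicator A x * indicator ?B (y + - x) \<partial>lborel) \<partial>\<mu>)"
    proof (rule nn_integral_cong)
    fix x
    show "(\<integral>\<^sup>+y. indicator A x * indicator ?B y \<partial>lborel) = (\<integral>\<^sup>+y. indicator A x * indicator ?B (y + - x) \<partial>lborel)"
      using inv_l[of "\<lambda>y. indicator A x * indicator ?B y" "- x"] by simp
  qed
  also have "\<dots> = (\<integral>\<^sup>+y. (\<integral>\<^sup>+x. indicator A x * indicator ?B (y - x) \<partial>\<mu>) \<partial>lborel)"
    by (subst Fubini') simp_all
  also have "\<dots> = (\<integral>\<^sup>+y. (\<integral>\<^sup>+x. indicator A (x + y) * indicator ?B (y - (x + y)) \<partial>\<mu>) \<partial>lborel)"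
    proof (rule nn_integral_cong)
    fix y
    show "(\<integral>\<^sup>+x. indicator A x * indicator ?B (y - x) \<partial>\<mu>) = (\<integral>\<^sup>+x. indicator A (x + y) * indicator ?B (y - (x + y)) \<partial>\<mu>)"
      using inv_mu[of "\<lambda>x. indicator A x * indicator ?B (y - x)" y] by simp
  qed
  also have "\<dots> = (\<integral>\<^sup>+x. (\<integral>\<^sup>+y. indicator A (x + y) * indicator ?B (- x) \<partial>lborel) \<partial>\<mu>)"
    by (subst Fubini') (simp_all add: algebra_simps)
  also have "\<dots> = (\<integral>\<^sup>+x. emeasure lborel A * indicator ?B x \<partial>\<mu>)"
  proof (rule nn_integral_cong)
    fix x
    have "(\<integral>\<^sup>+y. indicator A (x + y) \<partial>lborel) = emeasure lborel A"
      using inv_l[of "indicator A" x] by (simp add: add.commute)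
    then show "(\<integral>\<^sup>+y. indicator A (x + y) * indicator ?B (- x) \<partial>lborel) = emeasure lborel A * indicator ?B x"
      by (simp add: nn_integral_multc indicator_def)
  qed
  also have "\<dots> = emeasure lborel A * emeasure lborel ?B"
    by (simp add: nn_integral_cmult muB)
  finally have "emeasure \<mu> A * emeasure lborel ?B = emeasure lborel A * emeasure lborel ?B" .
  moreover have "emeasure lborel ?B \<noteq> 0" "emeasure lborel ?B \<noteq> top"
    using less_imp_neq[OF unit_ball_vol_pos[of "real DIM('a)", OF of_nat_0_le_iff]] by (auto simp: emeasure_ball)
  ultimately show "emeasure (distr lborel borel R) A = emeasure lborel A"
    unfolding \<mu>_def[symmetric]
    by (metis ennreal_mult_divide_eq)
qed simp

section \<open>Measurability, integration and rotation invariance for \<open>dA\<close>\<close>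

lemma space_dA [simp]: "space dA = ball 0 1"
  by (simp add: dA_def space_scale_measure)

lemma sets_dA: "sets dA = sets (lebesgue_on (ball 0 1))"
  by (simp add: dA_def)

text \<open>\<open>dA\<close> carries the Lebesgue sigma-algebra of the disc, so Borel facts enter
  through completion followed by restriction.\<close>

lemma borel_imp_dA_measurable: "f \<in> measurable borel M \<Longrightarrow> f \<in> measurable dA M"
proof -
  assume "f \<in> measurable borel M"
  then have "f \<in> measurable lebesgue M"
    by (simp add: measurable_completion)
  then have "f \<in> measurable (lebesgue_on (ball 0 1)) M"
    by (rule measurable_restrict_space1)
  then show ?thesis by (simp add: measurable_def sets_dA)
qed

lemma measurable_ident_dA: "(\<lambda>w. w) \<in> measurable dA borel"
  by (rule borel_imp_dA_measurable) simp

lemma nn_integral_dA: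
  assumes [measurable]: "f \<in> borel_measurable borel"
  shows "(\<integral>\<^sub>D w. f w) = ennreal (1 / pi) * (\<integral>\<^sup>+w. f w * indicator (ball 0 1) w \<partial>lborel)"
proof -
  have "f \<in> borel_measurable (lebesgue_on (ball 0 1))"
    by (intro measurable_restrict_space1 measurable_completion) simp
  then have "(\<integral>\<^sub>D w. f w) = ennreal (1 / pi) * (\<integral>\<^sup>+w. f w \<partial>lebesgue_on (ball 0 1))"
    unfolding dA_def by (rule nn_integral_scale_measure)
  also have "(\<integral>\<^sup>+w. f w \<partial>lebesgue_on (ball 0 1)) = (\<integral>\<^sup>+w. f w * indicator (ball 0 1) w \<partial>lebesgue)"
    by (rule nn_integral_restrict_space) simp
  finally show ?thesis by (simp add: nn_integral_completion)
qed

lemma nn_integral_dA_rotate: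
  assumes e: "norm e = 1" and [measurable]: "f \<in> borel_measurable borel"
  shows "(\<integral>\<^sub>D w. f (e * w)) = (\<integral>\<^sub>D w. f w)"
proof -
  have "linear ((*) e)" by (simp add: linear_times)
  moreover have "norm (e * x) = norm x" for x using e by (simp add: norm_mult)
  ultimately have D: "distr lborel borel ((*) e) = lborel"
    by (rule lborel_distr_linear_isometry)
  have "(\<integral>\<^sup>+w. f w * indicator (ball 0 1) w \<partial>lborel) =
        (\<integral>\<^sup>+w. f w * indicator (ball 0 1) w \<partial>distr lborel borel ((*) e))"
    by (simp add: D)
  also have "\<dots> = (\<integral>\<^sup>+w. f (e * w) * indicator (ball 0 1) (e * w) \<partial>lborel)"
    by (rule nn_integral_distr) (auto intro!: borel_measurable_times_ennreal borel_measurable_indicator)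
  also have "\<dots> = (\<integral>\<^sup>+w. f (e * w) * indicator (ball 0 1) w \<partial>lborel)"
    by (simp add: indicator_def norm_mult e)
  finally show ?thesis by (simp add: nn_integral_dA)
qed

text \<open>Both measures are images on the Borel sets, where \<open>nn_integral_dA_rotate\<close>
  applies to indicators; hence the identity map on the right-hand side.\<close>

lemma distr_dA_rotate:
  assumes "norm e = 1"
  shows "distr dA borel ((*) e) = distr dA borel (\<lambda>w. w)"
proof (rule measure_eqI)
  fix A assume "A \<in> sets (distr dA borel ((*) e))"
  then have [measurable]: "A \<in> sets borel" by simp
  have [measurable]: "(*) e \<in> measurable dA borel" by (rule borel_imp_dA_measurable) simp
  have "emeasure (distr dA borel ((*) e)) A = (\<integral>\<^sup>+w. indicator A w \<partial>(distr dA borel ((*) e)))"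
    by simp
  also have "\<dots> = (\<integral>\<^sub>D w. indicator A (e * w))"
    by (subst nn_integral_distr) simp_all
  also have "\<dots> = (\<integral>\<^sub>D w. indicator A w)"
    by (rule nn_integral_dA_rotate[OF assms]) simp
  also have "\<dots> = (\<integral>\<^sup>+w. indicator A w \<partial>(distr dA borel (\<lambda>w. w)))"
    by (subst nn_integral_distr) (simp_all add: measurable_ident_dA)
  finally show "emeasure (distr dA borel ((*) e)) A = emeasure (distr dA borel (\<lambda>w. w)) A"
    by simp
qed simp

lemma integral_dA_rotate:
  fixes f :: "complex \<Rightarrow> complex"
  assumes "norm e = 1" and [measurable]: "f \<in> borel_measurable borel"
  shows "(LINT w|dA. f (e * w)) = (LINT w|dA. f w)"
proof -
  have [measurable]: "(*) e \<in> measurable dA borel" by (rule borel_imp_dA_measurable) simp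
  have "(LINT w|dA. f (e * w)) = (LINT w|distr dA borel ((*) e). f w)"
    by (subst integral_distr) simp_all
  also have "\<dots> = (LINT w|distr dA borel (\<lambda>w. w). f w)"
    by (simp add: distr_dA_rotate assms)
  finally show ?thesis by (subst (asm) integral_distr) (simp_all add: measurable_ident_dA)
qed

lemma prob_space_dA: "prob_space dA"
proof
  have "emeasure dA (space dA) = (\<integral>\<^sub>D w. 1)" by simp
  also have "\<dots> = ennreal (1 / pi) * ennreal pi"
    by (subst nn_integral_dA) (simp_all add: emeasure_ball unit_ball_vol_numeral(1)[of num.One, simplified])
  also have "\<dots> = 1" by (simp flip: ennreal_mult)
  finally show "emeasure dA (space dA) = 1" .
qed

interpretation dA: prob_space dA by (rule prob_space_dA)

section \<open>The radial variable and its distribution\<close>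

definition rho :: "complex \<Rightarrow> real" where "rho w = 1 - (norm w)\<^sup>2"

lemma rho_measurable_borel [measurable]: "rho \<in> borel_measurable borel"
  unfolding rho_def[abs_def] by measurable

lemma rho_measurable [measurable]: "rho \<in> borel_measurable dA"
  by (rule borel_imp_dA_measurable) simp

lemma rho_rotate: "norm e = 1 \<Longrightarrow> rho (e * w) = rho w"
  by (simp add: rho_def norm_mult)

lemma rho_bounds: "w \<in> ball 0 1 \<Longrightarrow> 0 < rho w" "rho w \<le> 1"
  by (auto simp: rho_def power_less_one_iff abs_square_less_1)

text \<open>The disc of radius sqrt (1 - r) has normalized area 1 - r, so \<open>rho\<close> is
  uniformly distributed on (0, 1). Radial integrals thus become one-dimensional without any
  Jacobian.\<close>

lemma distr_dA_rho: "distr dA borel rho = density lborel (indicator {0<..<1::real})"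
proof (rule cdf_unique)
  show "real_distribution (distr dA borel rho)"
    by (rule dA.real_distribution_distr) simp
  show "real_distribution (density lborel (indicator {0<..<1::real}))"
    unfolding real_distribution_def real_distribution_axioms_def
    by (auto intro!: prob_spaceI simp: emeasure_density)
  show "cdf (distr dA borel rho) = cdf (density lborel (indicator {0<..<1::real}))"
  proof
    fix x :: real
    \<comment> \<open>Clamping \<open>x\<close> lets one computation serve the interval (0, 1) and
      both constant parts of the distribution function.\<close>
    define r where "r = min 1 (max 0 x)"
    have r: "0 \<le> r" "r \<le> 1" by (auto simp: r_def)
    have S: "{w. x < rho w} \<inter> ball 0 1 = (ball 0 (sqrt (1 - r)) :: complex set)"
    proof (intro set_eqI)
      fix w :: complex
      have "norm w < sqrt (1 - r) \<longleftrightarrow> (norm w)\<^sup>2 < 1 - r"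
        by (metis norm_ge_zero real_sqrt_abs real_sqrt_less_iff abs_norm_cancel)
      moreover have "norm w < 1 \<longleftrightarrow> (norm w)\<^sup>2 < 1"
        by (simp add: power_less_one_iff abs_square_less_1)
      ultimately show "w \<in> {w. x < rho w} \<inter> ball 0 1 \<longleftrightarrow> w \<in> ball 0 (sqrt (1 - r))"
        using zero_le_power2[of "norm w"] by (auto simp: rho_def r_def min_def max_def split: if_splits)
           (smt (verit) zero_le_power2)
    qed
    have "emeasure dA {w \<in> space dA. x < rho w} = (\<integral>\<^sub>D w. indicator {w. x < rho w} w)"
    proof -
      have "{w \<in> space dA. x < rho w} \<in> sets dA" by measurable
      then show ?thesis
        by (subst nn_integral_indicator[symmetric]) (simp, rule nn_integral_cong, simp add: indicator_def)
    qed
    also have "\<dots> = ennreal (1 / pi) * emeasure lborel ({w. x < rho w} \<inter> ball 0 1)"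
      by (subst nn_integral_dA) (simp_all flip: indicator_inter_arith)
    also have "\<dots> = ennreal (1 / pi) * ennreal (pi * (1 - r))"
      using r by (simp add: S emeasure_ball unit_ball_vol_numeral(1)[of num.One, simplified])
    also have "\<dots> = ennreal (1 - r)"
      using r by (simp flip: ennreal_mult)
    finally have "measure dA {w \<in> space dA. x < rho w} = 1 - r"
      using r by (simp add: measure_def)
    moreover have "{w \<in> space dA. rho w \<le> x} = space dA - {w \<in> space dA. x < rho w}" by auto
    ultimately have "measure dA {w \<in> space dA. rho w \<le> x} = r"
      using dA.prob_compl[of "{w \<in> space dA. x < rho w}"] by (simp del: space_dA)
    moreover have "cdf (distr dA borel rho) x = measure dA {w \<in> space dA. rho w \<le> x}"
      unfolding cdf_def by (subst measure_distr) (auto intro!: arg_cong[where f="measure dA"])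
    moreover have "cdf (density lborel (indicator {0<..<1::real})) x = r"
    proof -
      have "emeasure (density lborel (indicator {0<..<1::real})) {..x} = emeasure lborel ({..x} \<inter> {0<..<1})"
        by (simp add: emeasure_density nn_integral_indicator Int_commute flip: indicator_inter_arith)
      also have "\<dots> = ennreal r"
      proof (cases "x < 1")
        case True
        then have "{..x} \<inter> {0<..<1} = {0<..x}" by auto
        then show ?thesis using True by (cases "0 \<le> x") (auto simp: r_def)
      next
        case False
        then have "{..x} \<inter> {0<..<1} = {0<..<1}" by auto
        then show ?thesis using False by (auto simp: r_def)
      qed
      finally show ?thesis using r by (simp add: cdf_def measure_def)
    qed
    ultimately show "cdf (distr dA borel rho) x = cdf (density lborel (indicator {0<..<1::real})) x"
      by simp
  qed
qed

lemma nn_integral_dA_rho: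
  assumes [measurable]: "f \<in> borel_measurable borel"
  shows "(\<integral>\<^sub>D w. f (rho w)) = (\<integral>\<^sup>+t. f t * indicator {0<..<1} t \<partial>lborel)"
proof -
  have "(\<integral>\<^sub>D w. f (rho w)) = (\<integral>\<^sup>+t. f t \<partial>distr dA borel rho)"
    by (subst nn_integral_distr) simp_all
  also have "\<dots> = (\<integral>\<^sup>+t. indicator {0<..<1} t * f t \<partial>lborel)"
    unfolding distr_dA_rho by (subst nn_integral_density) simp_all
  finally show ?thesis by (simp add: mult.commute)
qed

section \<open>Binomial series and Parseval's identity\<close>

text \<open>The n-th Taylor coefficient of \<open>(1 - x) powr (- c)\<close>; in this form its
  positivity for \<open>c > 0\<close> is visible.\<close>

definition bcoeff :: "real \<Rightarrow> nat \<Rightarrow> real" where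
  "bcoeff c n = pochhammer c n / fact n"

lemma bcoeff_pos: "c > 0 \<Longrightarrow> bcoeff c n > 0"
  by (simp add: bcoeff_def pochhammer_pos)

lemma bcoeff_sums:
  fixes x :: complex
  assumes "norm x < 1"
  shows "(\<lambda>n. of_real (bcoeff c n) * x ^ n) sums ((1 - x) powr (- of_real c))"
proof -
  have "(\<lambda>n. ((- of_real c) gchoose n) * (- x) ^ n) sums (1 + (- x)) powr (- of_real c)"
    using assms by (intro gen_binomial_complex) simp
  moreover have "((- of_real c) gchoose n) * (- x) ^ n = of_real (bcoeff c n) * x ^ n" for n
  proof -
    have "(- 1) ^ n * (- x) ^ n = x ^ n" by (simp flip: power_mult_distrib)
    moreover have "((- of_real c) gchoose n) * (- x) ^ n = of_real (bcoeff c n) * ((- 1) ^ n * (- x) ^ n)"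
      by (simp add: gbinomial_pochhammer bcoeff_def pochhammer_of_real)
    ultimately show ?thesis by simp
  qed
  ultimately show ?thesis by simp
qed

lemma bcoeff_sums_real:
  fixes x :: real
  assumes "\<bar>x\<bar> < 1"
  shows "(\<lambda>n. bcoeff c n * x ^ n) sums ((1 - x) powr (- c))"
proof -
  have "(\<lambda>n. ((- c) gchoose n) * (- x) ^ n) sums (1 + (- x)) powr (- c)"
    using assms by (intro gen_binomial_real) simp
  moreover have "((- c) gchoose n) * (- x) ^ n = bcoeff c n * x ^ n" for n
  proof -
    have "(- 1) ^ n * (- x) ^ n = x ^ n" by (simp flip: power_mult_distrib)
    moreover have "((- c) gchoose n) * (- x) ^ n = bcoeff c n * ((- 1) ^ n * (- x) ^ n)"
      by (simp add: gbinomial_pochhammer bcoeff_def)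
    ultimately show ?thesis by simp
  qed
  ultimately show ?thesis by simp
qed

text \<open>Up to a factor tending to 1 the quotient is the reciprocal of a product formula for
  \<open>Gamma c\<close>. Comparing with \<open>Suc n\<close> keeps it defined and positive at
  \<open>n = 0\<close>, so that the limit yields two-sided bounds for all \<open>n\<close>.\<close>

lemma bcoeff_asymp:
  assumes c: "c > 0"
  shows "(\<lambda>n. bcoeff c n / real (Suc n) powr (c - 1)) \<longlonglongrightarrow> 1 / Gamma c"
proof -
  have "(\<lambda>n. 1 / Gamma_series' c n) \<longlonglongrightarrow> 1 / Gamma c"
    using c by (intro tendsto_divide tendsto_const Gamma_series'_LIMSEQ) (auto simp: Gamma_eq_zero_iff nonpos_Ints_def)
  moreover have "(\<lambda>n. (real n / real (Suc n)) powr (c - 1)) \<longlonglongrightarrow> 1"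
    by real_asymp
  ultimately have "(\<lambda>n. 1 / Gamma_series' c n * (real n / real (Suc n)) powr (c - 1)) \<longlonglongrightarrow> 1 / Gamma c * 1"
    by (rule tendsto_mult)
  moreover have "\<forall>\<^sub>F n in sequentially. 1 / Gamma_series' c n * (real n / real (Suc n)) powr (c - 1) =
      bcoeff c n / real (Suc n) powr (c - 1)"
    using eventually_gt_at_top[of 0]
  proof eventually_elim
    case (elim n)
    have "fact n = real n * fact (n - 1)" using elim by (cases n) auto
    moreover have "exp (c * ln (real n)) = real n powr (c - 1) * real n"
      using elim by (simp add: powr_def powr_diff field_simps exp_diff)
    ultimately show ?case using elim c pochhammer_pos[OF c, of n]
      by (simp add: Gamma_series'_def bcoeff_def powr_divide field_simps)
  qed
  ultimately show ?thesis by (simp add: tendsto_cong)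
qed

lemma pos_convergent_bounds:
  fixes f :: "nat \<Rightarrow> real"
  assumes pos: "\<And>n. f n > 0" and lim: "f \<longlonglongrightarrow> l" and l: "l > 0"
  obtains m M where "0 < m" "0 < M" "\<And>n. m \<le> f n" "\<And>n. f n \<le> M"
proof -
  have "Bseq f" using lim by (simp add: convergentI convergent_imp_Bseq)
  then obtain M where M: "M > 0" "\<And>n. norm (f n) \<le> M" by (auto simp: Bseq_def)
  have "(\<lambda>n. inverse (f n)) \<longlonglongrightarrow> inverse l" using lim l by (intro tendsto_inverse) auto
  then have "Bseq (\<lambda>n. inverse (f n))" by (simp add: convergentI convergent_imp_Bseq)
  then obtain K where K: "K > 0" "\<And>n. norm (inverse (f n)) \<le> K" by (auto simp: Bseq_def)
  have "inverse K \<le> f n" for n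
    using K(1) K(2)[of n] pos[of n] by (simp add: field_simps)
  moreover have "f n \<le> M" for n using M(2)[of n] by simp
  ultimately show ?thesis using that[of "inverse K" M] K(1) M(1) by auto
qed

lemma bcoeff_bounds:
  assumes "c > 0"
  obtains m M where "0 < m" "0 < M" "\<And>n. m * real (Suc n) powr (c - 1) \<le> bcoeff c n"
    "\<And>n. bcoeff c n \<le> M * real (Suc n) powr (c - 1)"
proof -
  have "bcoeff c n / real (Suc n) powr (c - 1) > 0" for n
    using bcoeff_pos[OF assms] by simp
  moreover have "1 / Gamma c > 0" using Gamma_real_pos[OF assms] by simp
  ultimately obtain m M where mM: "0 < m" "0 < M" "\<And>n. m \<le> bcoeff c n / real (Suc n) powr (c - 1)"
    "\<And>n. bcoeff c n / real (Suc n) powr (c - 1) \<le> M"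
    using pos_convergent_bounds[OF _ bcoeff_asymp[OF assms]] by blast
  show ?thesis
  proof (rule that[of m M])
    fix n
    show "m * real (Suc n) powr (c - 1) \<le> bcoeff c n"
      using mM(3)[of n] by (subst (asm) pos_le_divide_eq) simp_all
    show "bcoeff c n \<le> M * real (Suc n) powr (c - 1)"
      using mM(4)[of n] by (subst (asm) pos_divide_le_eq) simp_all
  qed (use mM in auto)
qed

lemma bcoeff_half_comparable:
  assumes "c > 1"
  obtains m M where "0 < m" "0 < M" "\<And>n. m * bcoeff (c - 1) n \<le> (bcoeff (c / 2) n)\<^sup>2"
    "\<And>n. (bcoeff (c / 2) n)\<^sup>2 \<le> M * bcoeff (c - 1) n"
proof -
  obtain m1 M1 where 1: "0 < m1" "0 < M1" "\<And>n. m1 * real (Suc n) powr (c / 2 - 1) \<le> bcoeff (c/2) n"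
    "\<And>n. bcoeff (c/2) n \<le> M1 * real (Suc n) powr (c / 2 - 1)"
    using bcoeff_bounds[of "c/2"] assms by (metis half_gt_zero less_trans zero_less_one)
  obtain m2 M2 where 2: "0 < m2" "0 < M2" "\<And>n. m2 * real (Suc n) powr (c - 1 - 1) \<le> bcoeff (c-1) n"
    "\<And>n. bcoeff (c-1) n \<le> M2 * real (Suc n) powr (c - 1 - 1)"
    using bcoeff_bounds[of "c-1"] assms by (metis diff_gt_0_iff_gt)
  have sq: "(real (Suc n) powr (c / 2 - 1))\<^sup>2 = real (Suc n) powr (c - 1 - 1)" for n
    by (simp add: power2_eq_square powr_add[symmetric] del: of_nat_Suc)
  show ?thesis
  proof (rule that[of "m1\<^sup>2 / M2" "M1\<^sup>2 / m2"])
    fix n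
    have "m1\<^sup>2 / M2 * bcoeff (c-1) n \<le> m1\<^sup>2 / M2 * (M2 * real (Suc n) powr (c - 1 - 1))"
      using 2 by (intro mult_left_mono) auto
    also have "\<dots> = (m1 * real (Suc n) powr (c / 2 - 1))\<^sup>2"
      using 2 by (simp add: power_mult_distrib sq del: of_nat_Suc)
    also have "\<dots> \<le> (bcoeff (c / 2) n)\<^sup>2"
      using 1 by (intro power_mono) auto
    finally show "m1\<^sup>2 / M2 * bcoeff (c-1) n \<le> (bcoeff (c / 2) n)\<^sup>2" .
    have "(bcoeff (c / 2) n)\<^sup>2 \<le> (M1 * real (Suc n) powr (c / 2 - 1))\<^sup>2"
      using 1 bcoeff_pos[of "c/2" n] assms by (intro power_mono) auto
    also have "\<dots> = M1\<^sup>2 / m2 * (m2 * real (Suc n) powr (c - 1 - 1))"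
      using 2 by (simp add: power_mult_distrib sq del: of_nat_Suc)
    also have "\<dots> \<le> M1\<^sup>2 / m2 * bcoeff (c-1) n"
      using 2 by (intro mult_left_mono) auto
    finally show "(bcoeff (c / 2) n)\<^sup>2 \<le> M1\<^sup>2 / m2 * bcoeff (c-1) n" .
  qed (use 1 2 in auto)
qed

section \<open>Orthogonality of the monomials and Parseval's identity with radial weights\<close>

lemma cnj_borel_measurable [measurable]: "cnj \<in> borel_measurable borel"
  by (intro borel_measurable_continuous_onI continuous_intros)

text \<open>Rotation by the angle pi / (n - m) changes the sign of the integrand but not the
  integral. Should the integrand fail to be integrable, both sides are the default value 0.\<close>

lemma integral_dA_monomials_orthogonal:
  fixes \<phi> :: "real \<Rightarrow> real"
  assumes [measurable]: "\<phi> \<in> borel_measurable borel" and "n \<noteq> m"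
  shows "(LINT w|dA. of_real (\<phi> (rho w)) * (w ^ n * cnj w ^ m)) = 0"
proof -
  define e where "e = cis (pi / (real n - real m))"
  have e: "norm e = 1" by (simp add: e_def)
  have "e ^ n * cnj e ^ m = cis (real n * (pi / (real n - real m)) + real m * - (pi / (real n - real m)))"
    by (simp only: e_def Complex.DeMoivre cis_cnj cis_mult)
  also have "real n * (pi / (real n - real m)) + real m * - (pi / (real n - real m)) = pi"
  proof -
    have "real n * (pi / (real n - real m)) + real m * - (pi / (real n - real m)) =
        (real n - real m) * (pi / (real n - real m))"
      by (simp add: left_diff_distrib diff_divide_distrib)
    also have "\<dots> = pi" using assms(2) by simp
    finally show ?thesis .
  qed
  finally have em: "e ^ n * cnj e ^ m = -1" by simp
  let ?f = "\<lambda>w. of_real (\<phi> (rho w)) * (w ^ n * cnj w ^ m)"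
  have "?f (e * w) = (e ^ n * cnj e ^ m) * ?f w" for w
    by (simp add: rho_rotate e power_mult_distrib)
  then have "?f (e * w) = - ?f w" for w unfolding em by simp
  then have "(LINT w|dA. ?f (e * w)) = - (LINT w|dA. ?f w)" by simp
  moreover have "(LINT w|dA. ?f (e * w)) = (LINT w|dA. ?f w)"
    by (rule integral_dA_rotate[OF e]) measurable
  ultimately show ?thesis by simp
qed

lemma dA_borel_functions_measurable [measurable]:
  "(\<lambda>w::complex. w ^ n) \<in> borel_measurable dA" "(\<lambda>w::complex. cnj w) \<in> borel_measurable dA"
  "(\<lambda>w::complex. norm w) \<in> borel_measurable dA"
  by (intro borel_imp_dA_measurable borel_measurable_continuous_onI continuous_intros)+

text \<open>The exponents form an injective family over an arbitrary index type because the identity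
  is needed for ordinary polynomials, for exponents \<open>2 ^ k\<close>, and for exponents
  \<open>2 ^ k + 2 ^ l\<close> indexed by pairs.\<close>

lemma parseval_finite:
  fixes \<phi> :: "real \<Rightarrow> real" and a :: "'i \<Rightarrow> complex" and e :: "'i \<Rightarrow> nat"
  assumes [measurable]: "\<phi> \<in> borel_measurable borel" and int: "integrable dA (\<lambda>w. \<phi> (rho w))"
    and "finite I" and inj: "inj_on e I"
  shows "(LINT w|dA. \<phi> (rho w) * (norm (\<Sum>i\<in>I. a i * w ^ e i))\<^sup>2) =
         (\<Sum>i\<in>I. (norm (a i))\<^sup>2 * (LINT w|dA. \<phi> (rho w) * (norm w) ^ (2 * e i)))"
proof -
  have bd: "integrable dA (\<lambda>w. of_real (\<phi> (rho w)) * (w ^ n * cnj w ^ m))" for n m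
  proof (rule Bochner_Integration.integrable_bound[OF int])
    show "AE w in dA. norm (of_real (\<phi> (rho w)) * (w ^ n * cnj w ^ m)) \<le> norm (\<phi> (rho w))"
      by (rule AE_I2) (auto simp: norm_mult norm_power mult_le_one power_le_one intro!: mult_left_le)
  qed measurable
  have sq: "(\<Sum>i\<in>I. a i * w ^ e i) * cnj (\<Sum>i\<in>I. a i * w ^ e i) =
    (\<Sum>i\<in>I. \<Sum>j\<in>I. (a i * w ^ e i) * (cnj (a j) * cnj w ^ e j))" for w
    by (simp add: sum_product)
  have eq: "of_real (\<phi> (rho w) * (norm (\<Sum>i\<in>I. a i * w ^ e i))\<^sup>2) =
    (\<Sum>i\<in>I. \<Sum>j\<in>I. (a i * cnj (a j)) * (of_real (\<phi> (rho w)) * (w ^ e i * cnj w ^ e j)))" for w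
    unfolding of_real_mult complex_norm_square sq sum_distrib_left by (simp add: mult_ac)
  have "of_real (LINT w|dA. \<phi> (rho w) * (norm (\<Sum>i\<in>I. a i * w ^ e i))\<^sup>2) =
     (LINT w|dA. of_real (\<phi> (rho w) * (norm (\<Sum>i\<in>I. a i * w ^ e i))\<^sup>2) :: complex)"
    by (rule integral_complex_of_real[symmetric])
  also have "\<dots> = (\<Sum>i\<in>I. \<Sum>j\<in>I. (a i * cnj (a j)) * (LINT w|dA. of_real (\<phi> (rho w)) * (w ^ e i * cnj w ^ e j)))"
    unfolding eq by (subst Bochner_Integration.integral_sum; (intro sum.cong refl)?;
      (subst Bochner_Integration.integral_sum)?) (auto intro!: bd)
  also have "\<dots> = (\<Sum>i\<in>I. (a i * cnj (a i)) * (LINT w|dA. of_real (\<phi> (rho w)) * (w ^ e i * cnj w ^ e i)))"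
  proof (intro sum.cong refl)
    fix i assume i: "i \<in> I"
    have "(\<Sum>j\<in>I. (a i * cnj (a j)) * (LINT w|dA. of_real (\<phi> (rho w)) * (w ^ e i * cnj w ^ e j))) =
      (\<Sum>j\<in>I. if j = i then (a i * cnj (a j)) * (LINT w|dA. of_real (\<phi> (rho w)) * (w ^ e i * cnj w ^ e j)) else 0)"
      using inj i by (intro sum.cong refl) (auto simp: integral_dA_monomials_orthogonal inj_on_eq_iff)
    then show "(\<Sum>j\<in>I. (a i * cnj (a j)) * (LINT w|dA. of_real (\<phi> (rho w)) * (w ^ e i * cnj w ^ e j))) =
      (a i * cnj (a i)) * (LINT w|dA. of_real (\<phi> (rho w)) * (w ^ e i * cnj w ^ e i))"
      using i assms(3) by simp
  qed
  also have "\<dots> = of_real (\<Sum>i\<in>I. (norm (a i))\<^sup>2 * (LINT w|dA. \<phi> (rho w) * (norm w) ^ (2 * e i)))"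
  proof -
    have "w ^ k * cnj w ^ k = of_real ((norm w) ^ (2 * k))" for w k
      by (simp add: power_mult complex_norm_square flip: power_mult_distrib del: of_real_power)
         (simp add: complex_norm_square[symmetric])
    then have "(of_real (\<phi> (rho w)) * (w ^ k * cnj w ^ k) :: complex) = of_real (\<phi> (rho w) * (norm w) ^ (2 * k))" for w k
      by simp
    then have "(LINT w|dA. of_real (\<phi> (rho w)) * (w ^ k * cnj w ^ k)) =
        complex_of_real (LINT w|dA. \<phi> (rho w) * (norm w) ^ (2 * k))" for k
      by (simp only: integral_complex_of_real)
    then show ?thesis
      by (simp only: complex_norm_square[symmetric] of_real_sum of_real_mult)
  qed
  finally show ?thesis by (simp only: of_real_eq_iff)
qed

text \<open>Absolute summability bounds all partial sums by one constant on the disc, which gives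
  dominated convergence. In the application the coefficients contain \<open>cnj z ^ n\<close> with
  \<open>|z| < 1\<close>, so they are summable.\<close>

lemma parseval_series:
  fixes \<phi> :: "real \<Rightarrow> real" and a :: "nat \<Rightarrow> complex"
  assumes [measurable]: "\<phi> \<in> borel_measurable borel" and int: "integrable dA (\<lambda>w. \<phi> (rho w))"
    and sum: "summable (\<lambda>n. norm (a n))"
  shows "(\<lambda>n. (norm (a n))\<^sup>2 * (LINT w|dA. \<phi> (rho w) * (norm w) ^ (2 * n))) sums
         (LINT w|dA. \<phi> (rho w) * (norm (\<Sum>n. a n * w ^ n))\<^sup>2)"
proof -
  define S where "S = (\<Sum>n. norm (a n))"
  have sumw: "summable (\<lambda>n. norm (a n * w ^ n))" if "w \<in> space dA" for w
  proof (rule summable_comparison_test[OF _ sum], intro exI allI impI)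
    fix n
    show "norm (norm (a n * w ^ n)) \<le> norm (a n)"
      using that by (auto simp: norm_mult norm_power intro!: mult_left_le power_le_one)
  qed
  have "(\<lambda>N. LINT w|dA. \<phi> (rho w) * (norm (\<Sum>n<N. a n * w ^ n))\<^sup>2) \<longlonglongrightarrow>
        (LINT w|dA. \<phi> (rho w) * (norm (\<Sum>n. a n * w ^ n))\<^sup>2)"
  proof (rule integral_dominated_convergence[where w = "\<lambda>w. \<bar>\<phi> (rho w)\<bar> * S\<^sup>2"])
    show "integrable dA (\<lambda>w. \<bar>\<phi> (rho w)\<bar> * S\<^sup>2)" using int by auto
    show "AE w in dA. (\<lambda>N. \<phi> (rho w) * (norm (\<Sum>n<N. a n * w ^ n))\<^sup>2) \<longlonglongrightarrow> \<phi> (rho w) * (norm (\<Sum>n. a n * w ^ n))\<^sup>2"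
      by (rule AE_I2) (rule tendsto_mult[OF tendsto_const tendsto_power[OF tendsto_norm[OF summable_LIMSEQ[OF summable_norm_cancel[OF sumw]]]]])
    fix N
    show "AE w in dA. norm (\<phi> (rho w) * (norm (\<Sum>n<N. a n * w ^ n))\<^sup>2) \<le> \<bar>\<phi> (rho w)\<bar> * S\<^sup>2"
    proof (rule AE_I2)
      fix w assume w: "w \<in> space dA"
      have "norm (\<Sum>n<N. a n * w ^ n) \<le> (\<Sum>n<N. norm (a n * w ^ n))" by (rule norm_sum)
      also have "\<dots> \<le> (\<Sum>n<N. norm (a n))"
        using w by (intro sum_mono) (auto simp: norm_mult norm_power intro!: mult_left_le power_le_one)
      also have "\<dots> \<le> S" unfolding S_def by (rule sum_le_suminf[OF sum]) auto
      finally have "(norm (\<Sum>n<N. a n * w ^ n))\<^sup>2 \<le> S\<^sup>2" by (intro power_mono) auto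
      then show "norm (\<phi> (rho w) * (norm (\<Sum>n<N. a n * w ^ n))\<^sup>2) \<le> \<bar>\<phi> (rho w)\<bar> * S\<^sup>2"
        by (simp add: abs_mult mult_left_mono)
    qed
    show "(\<lambda>w. \<phi> (rho w) * (norm (\<Sum>n<N. a n * w ^ n))\<^sup>2) \<in> borel_measurable dA"
      by measurable
    show "(\<lambda>w. \<phi> (rho w) * (norm (\<Sum>n. a n * w ^ n))\<^sup>2) \<in> borel_measurable dA"
      by (intro borel_measurable_times borel_measurable_power borel_measurable_norm borel_measurable_suminf) measurable
  qed
  moreover have "(LINT w|dA. \<phi> (rho w) * (norm (\<Sum>n<N. a n * w ^ n))\<^sup>2) =
    (\<Sum>n<N. (norm (a n))\<^sup>2 * (LINT w|dA. \<phi> (rho w) * (norm w) ^ (2 * n)))" for N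
    by (rule parseval_finite[OF assms(1) int]) auto
  ultimately show ?thesis unfolding sums_def by simp
qed

section \<open>The kernel averaged over circles\<close>

lemma one_minus_mult_cnj_bounds:
  assumes "z \<in> ball 0 1" "w \<in> ball 0 1"
  shows "1 - norm z \<le> norm (1 - z * cnj w)" "norm (1 - z * cnj w) > 0" "norm (1 - z * cnj w) \<le> 2"
    "Re (1 - z * cnj w) > 0" "norm (z * cnj w) < 1"
proof -
  have z: "norm z < 1" and w: "norm w < 1" using assms by auto
  have le: "norm (z * cnj w) \<le> norm z" using w by (simp add: norm_mult mult_left_le)
  show "norm (z * cnj w) < 1" using le z by linarith
  show "1 - norm z \<le> norm (1 - z * cnj w)"
    using norm_triangle_ineq2[of 1 "z * cnj w"] le by simp
  then show "norm (1 - z * cnj w) > 0" using z by linarith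
  show "norm (1 - z * cnj w) \<le> 2"
    using norm_triangle_ineq4[of 1 "z * cnj w"] le z by simp
  show "Re (1 - z * cnj w) > 0"
    using abs_Re_le_cmod[of "z * cnj w"] le z by simp
qed

lemma norm_one_minus_mult_cnj_commute: "norm (1 - z * cnj w) = norm (1 - w * cnj z)"
  using complex_mod_cnj[of "1 - z * cnj w"] by (simp add: mult.commute)

lemma rho_product:
  "1 - (norm z)\<^sup>2 * (norm w)\<^sup>2 = rho z + rho w - rho z * rho w"
  by (simp add: rho_def algebra_simps)

text \<open>The maximum and the sum of two positive numbers differ by a factor of at most 2. Under
  the negative exponent \<open>1 - c\<close> the maximum serves upper estimates and the sum lower
  ones.\<close>

lemma one_minus_norm_product_bounds:
  assumes "z \<in> ball 0 1" "w \<in> ball 0 1"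
  shows "max (rho w) (rho z) \<le> 1 - (norm z)\<^sup>2 * (norm w)\<^sup>2"
    "1 - (norm z)\<^sup>2 * (norm w)\<^sup>2 \<le> rho w + rho z"
proof -
  have "0 < rho z" "rho z \<le> 1" "0 < rho w" "rho w \<le> 1" using assms rho_bounds by auto
  then have "rho z * rho w \<le> rho z" "rho z * rho w \<le> rho w" "0 \<le> rho z * rho w"
    by (auto simp: mult_left_le mult_left_le_one_le)
  then show "max (rho w) (rho z) \<le> 1 - (norm z)\<^sup>2 * (norm w)\<^sup>2"
    "1 - (norm z)\<^sup>2 * (norm w)\<^sup>2 \<le> rho w + rho z"
    unfolding rho_product by auto
qed

text \<open>
  Expand \<open>(1 - z cnj w) powr (- c / 2)\<close> by Parseval: both averages become power series in
  \<open>|z|^2\<close>, with coefficients \<open>bcoeff (c / 2) n ^ 2\<close> and \<open>bcoeff (c - 1) n\<close>, both of order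
  \<open>n powr (c - 2)\<close>.
\<close>

lemma kernel_average_comparable:
  assumes c: "c > 1"
  obtains m M where "0 < m" "0 < M"
    "\<And>z \<phi>. z \<in> ball 0 1 \<Longrightarrow> \<phi> \<in> borel_measurable borel \<Longrightarrow> (\<And>t. 0 \<le> \<phi> t) \<Longrightarrow>
      integrable dA (\<lambda>w. \<phi> (rho w)) \<Longrightarrow>
      m * (LINT w|dA. \<phi> (rho w) * (1 - (norm z)\<^sup>2 * (norm w)\<^sup>2) powr (1 - c)) \<le>
        (LINT w|dA. \<phi> (rho w) * abs_kernel c z w) \<and>
      (LINT w|dA. \<phi> (rho w) * abs_kernel c z w) \<le>
        M * (LINT w|dA. \<phi> (rho w) * (1 - (norm z)\<^sup>2 * (norm w)\<^sup>2) powr (1 - c))"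
proof -
  obtain m M where mM: "0 < m" "0 < M" "\<And>n. m * bcoeff (c - 1) n \<le> (bcoeff (c / 2) n)\<^sup>2"
    "\<And>n. (bcoeff (c / 2) n)\<^sup>2 \<le> M * bcoeff (c - 1) n"
    using bcoeff_half_comparable[OF c] by blast
  show ?thesis
  proof (rule that[OF mM(1,2)])
    fix z :: complex and \<phi> :: "real \<Rightarrow> real"
    assume z: "z \<in> ball 0 1" and [measurable]: "\<phi> \<in> borel_measurable borel" and \<phi>: "\<And>t. 0 \<le> \<phi> t"
      and int: "integrable dA (\<lambda>w. \<phi> (rho w))"
    \<comment> \<open>Both averages are series in the same radial moments \<open>L n\<close>, so
      comparing the coefficients compares the averages.\<close>
    define L where "L = (\<lambda>n. LINT w|dA. \<phi> (rho w) * (norm w) ^ (2 * n))"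
    have L0: "0 \<le> L n" for n unfolding L_def by (intro integral_nonneg_AE AE_I2) (simp add: \<phi>)
    define a where "a = (\<lambda>n. of_real (bcoeff (c / 2) n) * (cnj z) ^ n)"
    have z1: "norm z < 1" using z by simp
    have z2: "(norm z)\<^sup>2 < 1" using z1 by (simp add: power_less_one_iff abs_square_less_1)
    have "summable (\<lambda>n. bcoeff (c / 2) n * (norm z) ^ n)"
      using bcoeff_sums_real[of "norm z" "c/2"] z1 by (auto simp: sums_iff)
    moreover have na: "norm (a n) = bcoeff (c / 2) n * (norm z) ^ n" for n
      using bcoeff_pos[of "c/2" n] c by (simp add: a_def norm_mult norm_power)
    ultimately have sa: "summable (\<lambda>n. norm (a n))" by simp
    have sq: "(norm (\<Sum>n. a n * w ^ n))\<^sup>2 = abs_kernel c z w" if w: "w \<in> space dA" for w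
    proof -
      have "norm (cnj z * w) < 1" using one_minus_mult_cnj_bounds(5)[OF z, of w] w
        by (simp add: norm_mult)
      from bcoeff_sums[OF this, of "c/2"]
      have "(\<Sum>n. a n * w ^ n) = (1 - cnj z * w) powr (- of_real (c / 2))"
        by (simp add: a_def power_mult_distrib mult_ac sums_iff)
      then have "(norm (\<Sum>n. a n * w ^ n))\<^sup>2 = (norm (1 - cnj z * w) powr (- (c / 2)))\<^sup>2"
        by (simp add: norm_powr_real_powr')
      also have "\<dots> = norm (1 - cnj z * w) powr (- c)"
        by (simp add: power2_eq_square flip: powr_add)
      finally show ?thesis using norm_one_minus_mult_cnj_commute[of z w] by (simp add: mult.commute)
    qed
    have J: "(\<lambda>n. (bcoeff (c / 2) n)\<^sup>2 * ((norm z)\<^sup>2) ^ n * L n) sums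
        (LINT w|dA. \<phi> (rho w) * abs_kernel c z w)"
    proof -
      have "(LINT w|dA. \<phi> (rho w) * (norm (\<Sum>n. a n * w ^ n))\<^sup>2) =
        (LINT w|dA. \<phi> (rho w) * abs_kernel c z w)"
        by (intro Bochner_Integration.integral_cong refl) (simp only: sq)
      moreover have "(norm (a n))\<^sup>2 = (bcoeff (c / 2) n)\<^sup>2 * ((norm z)\<^sup>2) ^ n" for n
        by (simp add: na power_mult_distrib mult.commute flip: power_mult)
      ultimately show ?thesis
        using parseval_series[OF _ int sa] by (simp add: L_def)
    qed
    have K: "(\<lambda>n. bcoeff (c - 1) n * ((norm z)\<^sup>2) ^ n * L n) sums
        (LINT w|dA. \<phi> (rho w) * (1 - (norm z)\<^sup>2 * (norm w)\<^sup>2) powr (1 - c))"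
    proof -
      let ?f = "\<lambda>n w. \<phi> (rho w) * (bcoeff (c - 1) n * ((norm z)\<^sup>2 * (norm w)\<^sup>2) ^ n)"
      have pos: "0 \<le> ?f n w" for n w using \<phi> bcoeff_pos[of "c-1" n] c by simp
      have f_eq: "?f n w = bcoeff (c - 1) n * ((norm z)\<^sup>2) ^ n * (\<phi> (rho w) * (norm w) ^ (2 * n))" for n w
        by (simp add: power_mult_distrib power_mult)
      have intL: "integrable dA (\<lambda>w. \<phi> (rho w) * (norm w) ^ (2 * n))" for n
        by (rule Bochner_Integration.integrable_bound[OF int])
           (auto simp: power_le_one abs_mult mult_left_le)
      have s: "(\<lambda>n. ?f n w) sums (\<phi> (rho w) * (1 - (norm z)\<^sup>2 * (norm w)\<^sup>2) powr (1 - c))" if "w \<in> space dA" for w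
      proof -
        have "(norm z)\<^sup>2 * (norm w)\<^sup>2 < 1"
          using one_minus_norm_product_bounds(1)[OF z, of w] rho_bounds(1)[OF z] that by auto
        then show ?thesis using bcoeff_sums_real[of "(norm z)\<^sup>2 * (norm w)\<^sup>2" "c - 1"]
          by (intro sums_mult) simp
      qed
      have intf: "integral\<^sup>L dA (?f n) = bcoeff (c - 1) n * ((norm z)\<^sup>2) ^ n * L n" for n
        unfolding f_eq L_def by simp
      have "(\<lambda>n. integral\<^sup>L dA (?f n)) sums (LINT w|dA. (\<Sum>n. ?f n w))"
      proof (rule sums_integral)
        show "integrable dA (?f n)" for n unfolding f_eq using intL by simp
        show "AE w in dA. summable (\<lambda>n. norm (?f n w))"
          using s pos by (intro AE_I2) (auto simp: sums_iff)
        show "summable (\<lambda>n. LINT w|dA. norm (?f n w))"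
        proof (rule summable_comparison_test[of _ "\<lambda>n. bcoeff (c - 1) n * ((norm z)\<^sup>2) ^ n * (LINT w|dA. \<phi> (rho w))"], intro exI allI impI)
          fix n
          have "L n \<le> (LINT w|dA. \<phi> (rho w))" unfolding L_def
            by (intro integral_mono intL int) (auto simp: \<phi> power_le_one intro!: mult_left_le)
          moreover have "(LINT w|dA. norm (?f n w)) = integral\<^sup>L dA (?f n)"
            using pos by (intro Bochner_Integration.integral_cong) auto
          ultimately show "norm (LINT w|dA. norm (?f n w)) \<le> bcoeff (c - 1) n * ((norm z)\<^sup>2) ^ n * (LINT w|dA. \<phi> (rho w))"
            using L0[of n] bcoeff_pos[of "c-1" n] c by (simp add: intf mult_left_mono)
        next
          show "summable (\<lambda>n. bcoeff (c - 1) n * ((norm z)\<^sup>2) ^ n * (LINT w|dA. \<phi> (rho w)))"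
            using bcoeff_sums_real[of "(norm z)\<^sup>2" "c-1"] z2 by (intro summable_mult2) (auto simp: sums_iff)
        qed
      qed
      moreover have "(LINT w|dA. (\<Sum>n. ?f n w)) = (LINT w|dA. \<phi> (rho w) * (1 - (norm z)\<^sup>2 * (norm w)\<^sup>2) powr (1 - c))"
        using s by (intro Bochner_Integration.integral_cong refl) (auto simp: sums_iff)
      ultimately show ?thesis unfolding intf by simp
    qed
    have z0: "0 \<le> ((norm z)\<^sup>2) ^ n" for n by simp
    have "m * (LINT w|dA. \<phi> (rho w) * (1 - (norm z)\<^sup>2 * (norm w)\<^sup>2) powr (1 - c)) \<le>
        (LINT w|dA. \<phi> (rho w) * abs_kernel c z w)"
    proof (rule sums_le[OF _ sums_mult[OF K] J])
      fix n
      show "m * (bcoeff (c - 1) n * ((norm z)\<^sup>2) ^ n * L n) \<le> (bcoeff (c / 2) n)\<^sup>2 * ((norm z)\<^sup>2) ^ n * L n"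
        using mult_right_mono[OF mM(3)[of n] mult_nonneg_nonneg[OF z0[of n] L0[of n]]] by (simp add: mult_ac)
    qed
    moreover have "(LINT w|dA. \<phi> (rho w) * abs_kernel c z w) \<le>
        M * (LINT w|dA. \<phi> (rho w) * (1 - (norm z)\<^sup>2 * (norm w)\<^sup>2) powr (1 - c))"
    proof (rule sums_le[OF _ J sums_mult[OF K]])
      fix n
      show "(bcoeff (c / 2) n)\<^sup>2 * ((norm z)\<^sup>2) ^ n * L n \<le> M * (bcoeff (c - 1) n * ((norm z)\<^sup>2) ^ n * L n)"
        using mult_right_mono[OF mM(4)[of n] mult_nonneg_nonneg[OF z0[of n] L0[of n]]] by (simp add: mult_ac)
    qed
    ultimately show "m * (LINT w|dA. \<phi> (rho w) * (1 - (norm z)\<^sup>2 * (norm w)\<^sup>2) powr (1 - c)) \<le>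
        (LINT w|dA. \<phi> (rho w) * abs_kernel c z w) \<and>
      (LINT w|dA. \<phi> (rho w) * abs_kernel c z w) \<le>
        M * (LINT w|dA. \<phi> (rho w) * (1 - (norm z)\<^sup>2 * (norm w)\<^sup>2) powr (1 - c))" by blast
  qed
qed

lemma kernel_norm_measurable [measurable]:
  "(\<lambda>w. norm (1 - z * cnj w) powr r) \<in> borel_measurable borel"
  "(\<lambda>w. norm (1 - z * cnj w) powr r) \<in> borel_measurable dA"
proof -
  show 1: "(\<lambda>w. norm (1 - z * cnj w) powr r) \<in> borel_measurable borel" by measurable
  show "(\<lambda>w. norm (1 - z * cnj w) powr r) \<in> borel_measurable dA" by (rule borel_imp_dA_measurable[OF 1])
qed

text \<open>The constants depend on \<open>c\<close> alone; the estimates are uniform in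
  \<open>z\<close> and in the radial function \<open>\<phi>\<close>. The maximum and the sum are the
  two bounds for \<open>1 - |z w|^2\<close> from
  \<open>one_minus_norm_product_bounds\<close>.\<close>

locale kernel_bounds =
  fixes c m M :: real
  assumes m_pos: "0 < m" and M_pos: "0 < M"
    and upper: "\<And>z \<phi>. z \<in> ball 0 1 \<Longrightarrow> \<phi> \<in> borel_measurable borel \<Longrightarrow>
      (\<integral>\<^sub>D w. \<phi> (rho w) * ennreal (abs_kernel c z w)) \<le>
      ennreal M * (\<integral>\<^sup>+t. \<phi> t * ennreal (max t (rho z) powr (1 - c)) * indicator {0<..<1} t \<partial>lborel)"
    and lower: "\<And>z \<phi>. z \<in> ball 0 1 \<Longrightarrow> \<phi> \<in> borel_measurable borel \<Longrightarrow>
      ennreal m * (\<integral>\<^sup>+t. \<phi> t * ennreal ((t + rho z) powr (1 - c)) * indicator {0<..<1} t \<partial>lborel) \<le>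
      (\<integral>\<^sub>D w. \<phi> (rho w) * ennreal (abs_kernel c z w))"

text \<open>For the indicator of a Borel set all integrals are finite and
  \<open>kernel_average_comparable\<close> applies. Both sides are measures in that set, so the
  inequality passes to all nonnegative Borel functions as an inequality between measures.\<close>

lemma kernel_bounds_exist:
  assumes c: "c > 1"
  obtains m M where "kernel_bounds c m M"
proof -
  obtain m M where mM: "0 < m" "0 < M" and
    cmp: "\<And>z \<phi>. z \<in> ball 0 1 \<Longrightarrow> \<phi> \<in> borel_measurable borel \<Longrightarrow> (\<And>t. 0 \<le> \<phi> t) \<Longrightarrow>
      integrable dA (\<lambda>w. \<phi> (rho w)) \<Longrightarrow>
      m * (LINT w|dA. \<phi> (rho w) * (1 - (norm z)\<^sup>2 * (norm w)\<^sup>2) powr (1 - c)) \<le>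
        (LINT w|dA. \<phi> (rho w) * abs_kernel c z w) \<and>
      (LINT w|dA. \<phi> (rho w) * abs_kernel c z w) \<le>
        M * (LINT w|dA. \<phi> (rho w) * (1 - (norm z)\<^sup>2 * (norm w)\<^sup>2) powr (1 - c))"
    using kernel_average_comparable[OF c] by blast
  have main: "ennreal m * (\<integral>\<^sup>+t. indicator A t * ennreal ((t + rho z) powr (1 - c)) * indicator {0<..<1} t \<partial>lborel) \<le>
      (\<integral>\<^sub>D w. indicator A (rho w) * ennreal (abs_kernel c z w)) \<and>
    (\<integral>\<^sub>D w. indicator A (rho w) * ennreal (abs_kernel c z w)) \<le>
      ennreal M * (\<integral>\<^sup>+t. indicator A t * ennreal (max t (rho z) powr (1 - c)) * indicator {0<..<1} t \<partial>lborel)"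
    if z: "z \<in> ball 0 1" and [measurable]: "A \<in> sets borel" for z A
  proof -
    have rz: "0 < rho z" "rho z \<le> 1" using rho_bounds z by auto
    let ?J = "\<lambda>w. indicator A (rho w) * abs_kernel c z w"
    let ?K = "\<lambda>w. indicator A (rho w) * (1 - (norm z)\<^sup>2 * (norm w)\<^sup>2) powr (1 - c)"
    have "integrable dA (\<lambda>w. indicator A (rho w) :: real)"
      by (rule dA.integrable_const_bound[where B = 1]) (auto simp: indicator_def)
    note cmpA = cmp[OF z _ _ this]
    have intJ: "integrable dA ?J"
    proof (rule dA.integrable_const_bound[where B = "(1 - norm z) powr (- c)"], rule AE_I2)
      fix w assume "w \<in> space dA"
      then show "norm (?J w) \<le> (1 - norm z) powr (- c)"
        using z c one_minus_mult_cnj_bounds(1)[OF z, of w]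
        by (auto simp: indicator_def intro!: powr_mono2')
    qed measurable
    have K_le: "(1 - (norm z)\<^sup>2 * (norm w)\<^sup>2) powr (1 - c) \<le> max (rho w) (rho z) powr (1 - c)"
      and K_ge: "(rho w + rho z) powr (1 - c) \<le> (1 - (norm z)\<^sup>2 * (norm w)\<^sup>2) powr (1 - c)" if "w \<in> space dA" for w
      using that z c one_minus_norm_product_bounds[OF z, of w] rz
      by (auto intro!: powr_mono2')
    have intK: "integrable dA ?K"
    proof (rule dA.integrable_const_bound[where B = "rho z powr (1 - c)"], rule AE_I2)
      fix w assume w: "w \<in> space dA"
      have "max (rho w) (rho z) powr (1 - c) \<le> rho z powr (1 - c)"
        using rz c by (intro powr_mono2') auto
      with K_le[OF w] show "norm (?K w) \<le> rho z powr (1 - c)"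
        by (auto simp: indicator_def)
    qed measurable
    have eJ: "(\<integral>\<^sub>D w. indicator A (rho w) * ennreal (abs_kernel c z w)) = ennreal (integral\<^sup>L dA ?J)"
      by (subst nn_integral_eq_integral[OF intJ, symmetric])
         (auto simp: ennreal_mult ennreal_indicator intro!: nn_integral_cong)
    have eK: "(\<integral>\<^sub>D w. indicator A (rho w) * ennreal ((1 - (norm z)\<^sup>2 * (norm w)\<^sup>2) powr (1 - c))) = ennreal (integral\<^sup>L dA ?K)"
      by (subst nn_integral_eq_integral[OF intK, symmetric])
         (auto simp: ennreal_mult ennreal_indicator intro!: nn_integral_cong)
    have "ennreal m * (\<integral>\<^sup>+t. indicator A t * ennreal ((t + rho z) powr (1 - c)) * indicator {0<..<1} t \<partial>lborel) =
      ennreal m * (\<integral>\<^sub>D w. indicator A (rho w) * ennreal ((rho w + rho z) powr (1 - c)))"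
      by (subst nn_integral_dA_rho[of "\<lambda>t. indicator A t * ennreal ((t + rho z) powr (1 - c))"]) simp_all
    also have "\<dots> \<le> ennreal m * (\<integral>\<^sub>D w. indicator A (rho w) * ennreal ((1 - (norm z)\<^sup>2 * (norm w)\<^sup>2) powr (1 - c)))"
      by (intro mult_left_mono nn_integral_mono ennreal_leI K_ge) auto
    also have "\<dots> = ennreal (m * integral\<^sup>L dA ?K)" using mM by (simp add: eK ennreal_mult')
    also have "\<dots> \<le> ennreal (integral\<^sup>L dA ?J)" using cmpA by (intro ennreal_leI) auto
    finally have 1: "ennreal m * (\<integral>\<^sup>+t. indicator A t * ennreal ((t + rho z) powr (1 - c)) * indicator {0<..<1} t \<partial>lborel) \<le>
      (\<integral>\<^sub>D w. indicator A (rho w) * ennreal (abs_kernel c z w))" unfolding eJ .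
    have "ennreal (integral\<^sup>L dA ?J) \<le> ennreal (M * integral\<^sup>L dA ?K)" using cmpA by (intro ennreal_leI) auto
    also have "\<dots> = ennreal M * (\<integral>\<^sub>D w. indicator A (rho w) * ennreal ((1 - (norm z)\<^sup>2 * (norm w)\<^sup>2) powr (1 - c)))"
      using mM by (simp add: eK ennreal_mult')
    also have "\<dots> \<le> ennreal M * (\<integral>\<^sub>D w. indicator A (rho w) * ennreal (max (rho w) (rho z) powr (1 - c)))"
      by (intro mult_left_mono nn_integral_mono ennreal_leI K_le) auto
    also have "\<dots> = ennreal M * (\<integral>\<^sup>+t. indicator A t * ennreal (max t (rho z) powr (1 - c)) * indicator {0<..<1} t \<partial>lborel)"
      by (subst nn_integral_dA_rho[of "\<lambda>t. indicator A t * ennreal (max t (rho z) powr (1 - c))"]) simp_all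
    finally show ?thesis using 1 unfolding eJ by blast
  qed
  \<comment> \<open>The image under \<open>rho\<close> of the measure with density the kernel, and
    the measure on (0, 1) with the comparison density.\<close>
  define \<mu> where "\<mu> = (\<lambda>z. distr (density dA (\<lambda>w. ennreal (abs_kernel c z w))) borel rho)"
  define \<nu> where "\<nu> = (\<lambda>g :: real \<Rightarrow> ennreal. density lborel (\<lambda>t. g t * indicator {0<..<1} t))"
  have I\<mu>: "(\<integral>\<^sup>+t. \<phi> t \<partial>\<mu> z) = (\<integral>\<^sub>D w. \<phi> (rho w) * ennreal (abs_kernel c z w))"
    if [measurable]: "\<phi> \<in> borel_measurable borel" for \<phi> z
    unfolding \<mu>_def by (simp add: nn_integral_distr nn_integral_density mult.commute)
  have I\<nu>: "(\<integral>\<^sup>+t. \<phi> t \<partial>\<nu> g) = (\<integral>\<^sup>+t. \<phi> t * g t * indicator {0<..<1} t \<partial>lborel)"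
    if [measurable]: "\<phi> \<in> borel_measurable borel" "g \<in> borel_measurable borel" for \<phi> g
    unfolding \<nu>_def by (simp add: nn_integral_density mult_ac)
  have s: "sets (\<mu> z) = sets borel" "sets (\<nu> g) = sets borel" "space (\<mu> z) = UNIV" "space (\<nu> g) = UNIV" for z g
    by (simp_all add: \<mu>_def \<nu>_def)
  have e\<mu>: "emeasure (\<mu> z) A = (\<integral>\<^sup>+t. indicator A t \<partial>\<mu> z)" if "A \<in> sets borel" for z A
    using that by (simp add: s)
  have e\<nu>: "emeasure (\<nu> g) A = (\<integral>\<^sup>+t. indicator A t \<partial>\<nu> g)" if "A \<in> sets borel" for g A
    using that by (simp add: s)
  show ?thesis
  proof (rule that[of m M], intro kernel_bounds.intro mM)
    fix z :: complex and \<phi> :: "real \<Rightarrow> ennreal"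
    assume z: "z \<in> ball 0 1" and [measurable]: "\<phi> \<in> borel_measurable borel"
    let ?g = "\<lambda>t. ennreal M * ennreal (max t (rho z) powr (1 - c))"
    have "\<mu> z \<le> \<nu> ?g"
    proof (subst le_measure)
      show "\<forall>A\<in>sets (\<mu> z). emeasure (\<mu> z) A \<le> emeasure (\<nu> ?g) A"
      proof
        fix A assume "A \<in> sets (\<mu> z)"
        then have [measurable]: "A \<in> sets borel" by (simp add: s)
        show "emeasure (\<mu> z) A \<le> emeasure (\<nu> ?g) A"
          using main[OF z, of A] by (simp add: e\<mu> e\<nu> I\<mu> I\<nu> mult_ac nn_integral_cmult del: nn_integral_indicator)
      qed
    qed (simp_all add: s)
    from nn_integral_mono_measure[OF _ this, of \<phi>]
    show "(\<integral>\<^sub>D w. \<phi> (rho w) * ennreal (abs_kernel c z w)) \<le>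
      ennreal M * (\<integral>\<^sup>+t. \<phi> t * ennreal (max t (rho z) powr (1 - c)) * indicator {0<..<1} t \<partial>lborel)"
      by (simp add: s I\<mu> I\<nu> mult_ac nn_integral_cmult)
  next
    fix z :: complex and \<phi> :: "real \<Rightarrow> ennreal"
    assume z: "z \<in> ball 0 1" and [measurable]: "\<phi> \<in> borel_measurable borel"
    let ?h = "\<lambda>t. ennreal m * ennreal ((t + rho z) powr (1 - c))"
    have "\<nu> ?h \<le> \<mu> z"
    proof (subst le_measure)
      show "\<forall>A\<in>sets (\<nu> ?h). emeasure (\<nu> ?h) A \<le> emeasure (\<mu> z) A"
      proof
        fix A assume "A \<in> sets (\<nu> ?h)"
        then have [measurable]: "A \<in> sets borel" by (simp add: s)
        show "emeasure (\<nu> ?h) A \<le> emeasure (\<mu> z) A"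
          using main[OF z, of A] by (simp add: e\<mu> e\<nu> I\<mu> I\<nu> mult_ac nn_integral_cmult del: nn_integral_indicator)
      qed
    qed (simp_all add: s)
    from nn_integral_mono_measure[OF _ this, of \<phi>]
    show "ennreal m * (\<integral>\<^sup>+t. \<phi> t * ennreal ((t + rho z) powr (1 - c)) * indicator {0<..<1} t \<partial>lborel) \<le>
      (\<integral>\<^sub>D w. \<phi> (rho w) * ennreal (abs_kernel c z w))"
      by (simp add: s I\<mu> I\<nu> mult_ac nn_integral_cmult)
  qed
qed

section \<open>Integrals of powers\<close>

lemma nn_integral_powr_from_0:
  fixes x e :: real
  assumes "e > -1" "x \<ge> 0"
  shows "(\<integral>\<^sup>+t. ennreal (t powr e) * indicator {0..x} t \<partial>lborel) = ennreal (x powr (e + 1) / (e + 1))"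
  using has_integral_powr_from_0[OF assms] by (intro nn_integral_has_integral_lebesgue') auto

lemma nn_integral_powr_to_inf:
  fixes x e :: real
  assumes "e < -1" "x > 0"
  shows "(\<integral>\<^sup>+t. ennreal (t powr e) * indicator {x..} t \<partial>lborel) = ennreal (x powr (e + 1) / (- e - 1))"
proof -
  have "- (x powr (e + 1)) / (e + 1) = x powr (e + 1) / (- e - 1)"
    using assms by (simp add: field_simps)
  then show ?thesis
    using has_integral_powr_to_inf[OF assms] by (intro nn_integral_has_integral_lebesgue') auto
qed

section \<open>The pointwise majorant and the kernel integrated against powers of
  \<open>rho\<close>\<close>

lemma rho_powr_measurable [measurable]: "(\<lambda>w. rho w powr r) \<in> borel_measurable dA"
  by measurable

lemma dA_pair_measurable [measurable]:
  "(\<lambda>x. rho (fst x)) \<in> borel_measurable (dA \<Otimes>\<^sub>M dA)"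
  "(\<lambda>x. rho (snd x)) \<in> borel_measurable (dA \<Otimes>\<^sub>M dA)"
  "(\<lambda>x. norm (1 - fst x * cnj (snd x)) powr r) \<in> borel_measurable (dA \<Otimes>\<^sub>M dA)"
proof -
  have [measurable]: "fst \<in> borel_measurable (dA \<Otimes>\<^sub>M dA)"
    by (rule measurable_compose[OF measurable_fst measurable_ident_dA])
  have [measurable]: "snd \<in> borel_measurable (dA \<Otimes>\<^sub>M dA)"
    by (rule measurable_compose[OF measurable_snd measurable_ident_dA])
  show "(\<lambda>x. rho (fst x)) \<in> borel_measurable (dA \<Otimes>\<^sub>M dA)"
    "(\<lambda>x. rho (snd x)) \<in> borel_measurable (dA \<Otimes>\<^sub>M dA)" unfolding rho_def by measurable
  show "(\<lambda>x. norm (1 - fst x * cnj (snd x)) powr r) \<in> borel_measurable (dA \<Otimes>\<^sub>M dA)"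
    by measurable
qed

text \<open>It dominates both operators. With values in \<open>ennreal\<close> it makes sense before
  convergence is known: as \<open>rho z powr a > 0\<close> in the disc, it is finite exactly where
  the integral with absolute values is.\<close>

definition majorant :: "real \<Rightarrow> real \<Rightarrow> real \<Rightarrow> (complex \<Rightarrow> complex) \<Rightarrow> complex \<Rightarrow> ennreal" where
  "majorant a b c f z = ennreal (rho z powr a) *
     (\<integral>\<^sub>D w. ennreal (rho w powr b * abs_kernel c z w) * ennreal (norm (f w)))"

lemma kernel_pair_measurable [measurable]:
  "(\<lambda>(z, w). ennreal (rho w powr b * abs_kernel c z w)) \<in> borel_measurable (dA \<Otimes>\<^sub>M dA)"
  unfolding split_beta by measurable

lemma majorant_measurable [measurable]:
  assumes [measurable]: "f \<in> borel_measurable dA"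
  shows "majorant a b c f \<in> borel_measurable dA"
  unfolding majorant_def[abs_def] by measurable

lemma kernel_integral_measurable [measurable]:
  fixes f :: "complex \<Rightarrow> complex" and K :: "complex \<Rightarrow> complex \<Rightarrow> complex"
  assumes [measurable]: "f \<in> borel_measurable dA" "(\<lambda>(z, w). K z w) \<in> borel_measurable (dA \<Otimes>\<^sub>M dA)"
  shows "(\<lambda>z. LINT w|dA. K z w * f w) \<in> borel_measurable dA"
proof (rule dA.borel_measurable_lebesgue_integral)
  have "(\<lambda>x. (case x of (z, w) \<Rightarrow> K z w) * f (snd x)) \<in> borel_measurable (dA \<Otimes>\<^sub>M dA)"
    by measurable
  then show "(\<lambda>(z, w). K z w * f w) \<in> borel_measurable (dA \<Otimes>\<^sub>M dA)"
    by (simp add: split_beta)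
qed

lemma weighted_op_measurable:
  assumes [measurable]: "f \<in> borel_measurable dA" "(\<lambda>(z, w). K z w) \<in> borel_measurable (dA \<Otimes>\<^sub>M dA)"
  shows "weighted_op a K f \<in> borel_measurable dA"
  unfolding weighted_op_def[abs_def] rho_def[symmetric] by measurable

text \<open>One estimate gives both halves of \<open>maps_boundedly\<close>: letting
  \<open>t\<close> tend to infinity shows that the majorant is finite almost everywhere, which is
  absolute convergence, and the norm inequality follows by domination.\<close>

lemma weak_type_imp_maps_boundedly:
  assumes K_meas [measurable]: "(\<lambda>(z, w). K z w) \<in> borel_measurable (dA \<Otimes>\<^sub>M dA)"
    and K_le: "\<And>z w. z \<in> ball 0 1 \<Longrightarrow> w \<in> ball 0 1 \<Longrightarrow> norm (K z w) \<le> rho w powr b * abs_kernel c z w"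
    and q: "q > 0" and C: "C \<ge> 0"
    and weak: "\<And>f t. f \<in> borel_measurable dA \<Longrightarrow> NX f < \<infinity> \<Longrightarrow> t > 0 \<Longrightarrow>
      t * measure dA {z \<in> space dA. ennreal t < majorant a b c f z} powr (1 / q) \<le> C * enn2real (NX f)"
  shows "maps_boundedly a K NX (Lweak_norm (ereal q))"
  unfolding maps_boundedly_def
proof (intro exI ballI impI conjI)
  fix f assume f [measurable]: "f \<in> borel_measurable dA" and NX: "NX f < \<infinity>"
  have [measurable]: "(\<lambda>(z, w). K z w * f w) \<in> borel_measurable (dA \<Otimes>\<^sub>M dA)"
    unfolding split_beta by measurable
  show [measurable]: "weighted_op a K f \<in> borel_measurable dA"
    by (rule weighted_op_measurable) measurable
  have AE_fin: "AE z in dA. majorant a b c f z < \<infinity>"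
  proof -
    define B where "B = {z \<in> space dA. majorant a b c f z = \<infinity>}"
    have [measurable]: "B \<in> sets dA" unfolding B_def by measurable
    have bound: "measure dA B powr (1 / q) \<le> (C * enn2real (NX f)) * inverse t" if "t > 0" for t
    proof -
      have "measure dA B \<le> measure dA {z \<in> space dA. ennreal t < majorant a b c f z}"
      proof (rule dA.finite_measure_mono)
        show "{z \<in> space dA. ennreal t < majorant a b c f z} \<in> sets dA" by measurable
      qed (auto simp: B_def)
      then have "measure dA B powr (1 / q) \<le> measure dA {z \<in> space dA. ennreal t < majorant a b c f z} powr (1 / q)"
        using q by (intro powr_mono2) auto
      then have "t * measure dA B powr (1 / q) \<le> C * enn2real (NX f)"
        using weak[OF f NX that] that by (intro order_trans[OF mult_left_mono weak[OF f NX that]]) auto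
      then show ?thesis using that by (simp add: field_simps)
    qed
    have "((\<lambda>t. (C * enn2real (NX f)) * inverse t) \<longlongrightarrow> (C * enn2real (NX f)) * 0) at_top"
      by (intro tendsto_mult tendsto_const tendsto_inverse_0_at_top filterlim_ident)
    then have "measure dA B powr (1 / q) \<le> (C * enn2real (NX f)) * 0"
      by (rule tendsto_lowerbound[OF _ _ trivial_limit_at_top_linorder])
         (use bound in \<open>auto simp: eventually_at_top_dense intro!: exI[of _ 0]\<close>)
    then have "measure dA B = 0" by simp
    then have "emeasure dA B = 0" by (simp add: dA.emeasure_eq_measure)
    then have "B \<in> null_sets dA" by auto
    then have "AE z in dA. z \<notin> B" by (rule AE_not_in)
    then show ?thesis
      by (rule AE_mp) (auto simp: B_def less_top intro!: AE_I2)
  qed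
  have le_maj: "ennreal (norm (weighted_op a K f z)) \<le> majorant a b c f z" if z: "z \<in> space dA" for z
  proof -
    \<comment> \<open>Where the integrand is not integrable the Bochner integral is 0, so the
      domination holds at every \<open>z\<close>, as the level sets in \<open>dist_fun\<close>
      require.\<close>
    have "ennreal (norm (LINT w|dA. K z w * f w)) \<le> (\<integral>\<^sub>D w. ennreal (norm (K z w * f w)))"
    proof (cases "integrable dA (\<lambda>w. K z w * f w)")
      case True
      then show ?thesis by (rule integral_norm_bound_ennreal)
    qed (simp add: not_integrable_integral_eq)
    also have "\<dots> \<le> (\<integral>\<^sub>D w. ennreal (rho w powr b * abs_kernel c z w) * ennreal (norm (f w)))"
      using K_le z by (intro nn_integral_mono) (auto simp: norm_mult mult_right_mono simp flip: ennreal_mult'')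
    finally show ?thesis
      unfolding weighted_op_def majorant_def rho_def[of z]
      by (auto simp: norm_mult ennreal_mult'' intro!: mult_left_mono)
  qed
  show "AE z in dA. integrable dA (\<lambda>w. K z w * f w)"
    using AE_fin AE_space
  proof eventually_elim
    fix z assume z: "z \<in> space dA" and fin: "majorant a b c f z < \<infinity>"
    show "integrable dA (\<lambda>w. K z w * f w)"
    proof (rule integrableI_bounded)
      show "(\<lambda>w. K z w * f w) \<in> borel_measurable dA"
        using measurable_Pair2[OF \<open>(\<lambda>(z, w). K z w * f w) \<in> borel_measurable (dA \<Otimes>\<^sub>M dA)\<close> z] by simp
      have "rho z powr a > 0" using rho_bounds(1)[of z] z by simp
      then have "(\<integral>\<^sub>D w. ennreal (rho w powr b * abs_kernel c z w) * ennreal (norm (f w))) < \<infinity>"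
        using fin unfolding majorant_def by (auto simp: ennreal_mult_less_top)
      moreover have "(\<integral>\<^sub>D w. ennreal (norm (K z w * f w))) \<le> (\<integral>\<^sub>D w. ennreal (rho w powr b * abs_kernel c z w) * ennreal (norm (f w)))"
        using K_le z by (intro nn_integral_mono) (auto simp: norm_mult mult_right_mono simp flip: ennreal_mult'')
      ultimately show "(\<integral>\<^sub>D w. ennreal (norm (K z w * f w))) < \<infinity>" by (rule order.strict_trans1[rotated])
    qed
  qed
  show "Lweak_norm (ereal q) (weighted_op a K f) \<le> ennreal C * NX f"
  proof -
    have "ennreal (t * dist_fun (weighted_op a K f) t powr (1 / q)) \<le> ennreal C * NX f" if t: "t > 0" for t
    proof -
      have "dist_fun (weighted_op a K f) t \<le> measure dA {z \<in> space dA. ennreal t < majorant a b c f z}"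
        unfolding dist_fun_def
      proof (rule dA.finite_measure_mono)
        show "{z \<in> space dA. t < norm (weighted_op a K f z)} \<subseteq> {z \<in> space dA. ennreal t < majorant a b c f z}"
        proof safe
          fix z assume z: "z \<in> space dA" and "t < norm (weighted_op a K f z)"
          then have "ennreal t < ennreal (norm (weighted_op a K f z))" using t by (intro ennreal_lessI) auto
          then show "ennreal t < majorant a b c f z" using le_maj[OF z] by simp
        qed
      qed measurable
      then have "t * dist_fun (weighted_op a K f) t powr (1 / q) \<le> t * measure dA {z \<in> space dA. ennreal t < majorant a b c f z} powr (1 / q)"
        using t q by (intro mult_left_mono powr_mono2) (simp_all add: dist_fun_def del: space_dA)
      also have "\<dots> \<le> C * enn2real (NX f)" by (rule weak[OF f NX t])
      finally have "ennreal (t * dist_fun (weighted_op a K f) t powr (1 / q)) \<le> ennreal (C * enn2real (NX f))"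
        by (rule ennreal_leI)
      also have "\<dots> = ennreal C * NX f" using C NX by (simp add: ennreal_mult)
      finally show ?thesis .
    qed
    then show ?thesis unfolding Lweak_norm_def by (auto intro!: SUP_least)
  qed
qed

text \<open>Split the power into exponents \<open>- m\<close> and \<open>m - r\<close>, both
  nonpositive; replace the maximum by \<open>u\<close> in the first factor and by \<open>t\<close>
  in the second.\<close>

lemma powr_max_interpolate:
  fixes t u m r :: real
  assumes "0 < t" "0 < u" "0 \<le> m" "m \<le> r"
  shows "max t u powr (- r) \<le> u powr (- m) * t powr (m - r)"
proof (cases "u \<le> t")
  case True
  have "t powr (- r) = t powr (- m) * t powr (m - r)" by (simp flip: powr_add)
  also have "\<dots> \<le> u powr (- m) * t powr (m - r)"
    using assms True by (intro mult_right_mono powr_mono2') auto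
  finally show ?thesis using True by (simp add: max_def)
next
  case False
  have "u powr (- r) = u powr (- m) * u powr (m - r)" by (simp flip: powr_add)
  also have "\<dots> \<le> u powr (- m) * t powr (m - r)"
    using assms False by (intro mult_left_mono powr_mono2') auto
  finally show ?thesis using False by (simp add: max_def)
qed

text \<open>The parameter \<open>l\<close> is the share of the decay \<open>c - 1\<close> that is
  charged to \<open>rho z\<close>; the rest stays in the integral over \<open>t\<close>. The set
  \<open>A\<close> selects the values of \<open>rho w\<close>, while \<open>B\<close> is the larger
  interval on which the power has a closed integral.\<close>

lemma (in kernel_bounds) radial_bound:
  assumes z: "z \<in> ball 0 1" and m: "0 \<le> l" "l \<le> c - 1" and [measurable]: "A \<in> sets borel" "B \<in> sets borel"
      and AB: "A \<inter> {0<..<1} \<subseteq> B"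
  shows "(\<integral>\<^sub>D w. ennreal (rho w powr e * abs_kernel c z w) * indicator {w. rho w \<in> A} w) \<le>
    ennreal (M * rho z powr (- l)) * (\<integral>\<^sup>+t. ennreal (t powr (e + l + 1 - c)) * indicator B t \<partial>lborel)"
proof -
  have rz: "rho z > 0" using rho_bounds(1)[OF z] .
  have "(\<integral>\<^sub>D w. ennreal (rho w powr e * abs_kernel c z w) * indicator {w. rho w \<in> A} w) =
    (\<integral>\<^sub>D w. (\<lambda>t. ennreal (t powr e) * indicator A t) (rho w) * ennreal (abs_kernel c z w))"
    by (intro nn_integral_cong) (auto simp: indicator_def ennreal_mult)
  also have "\<dots> \<le> ennreal M * (\<integral>\<^sup>+t. (\<lambda>t. ennreal (t powr e) * indicator A t) t * ennreal (max t (rho z) powr (1 - c)) * indicator {0<..<1} t \<partial>lborel)"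
    by (rule upper[OF z]) measurable
  also have "\<dots> \<le> ennreal M * (\<integral>\<^sup>+t. ennreal (rho z powr (- l)) * (ennreal (t powr (e + l + 1 - c)) * indicator B t) \<partial>lborel)"
  proof (intro mult_left_mono nn_integral_mono)
    fix t :: real
    show "(\<lambda>t. ennreal (t powr e) * indicator A t) t * ennreal (max t (rho z) powr (1 - c)) * indicator {0<..<1} t
      \<le> ennreal (rho z powr (- l)) * (ennreal (t powr (e + l + 1 - c)) * indicator B t)"
    proof (cases "t \<in> A \<inter> {0<..<1}")
      case True
      then have "t \<in> B" "t > 0" using AB by auto
      have "t powr e * max t (rho z) powr (1 - c) \<le> t powr e * (rho z powr (- l) * t powr (l - (c - 1)))"
        using powr_max_interpolate[of t "rho z" l "c - 1"] rz m \<open>t > 0\<close> by (intro mult_left_mono) auto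
      also have "\<dots> = rho z powr (- l) * t powr (e + l + 1 - c)"
        by (simp add: mult.left_commute mult.commute flip: powr_add) (simp add: algebra_simps)
      finally show ?thesis using True \<open>t \<in> B\<close> by (simp flip: ennreal_mult)
    next
      case False
      then have "indicator A t * indicator {0<..<1} t = (0::ennreal)" by (auto simp: indicator_def)
      then show ?thesis by (auto simp: indicator_def)
    qed
  qed simp
  also have "\<dots> = ennreal (M * rho z powr (- l)) * (\<integral>\<^sup>+t. ennreal (t powr (e + l + 1 - c)) * indicator B t \<partial>lborel)"
    using M_pos by (subst nn_integral_cmult) (auto simp: ennreal_mult mult.assoc)
  finally show ?thesis .
qed

text \<open>The sign of \<open>e + l + 2 - c\<close> decides at which end the remaining power is
  integrable: positive here, near 0, and negative in \<open>radial_high\<close>. The choice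
  \<open>l = 0\<close> gives a bound independent of \<open>z\<close>, and \<open>l = c - 1\<close>
  charges the whole decay to \<open>rho z\<close>.\<close>

lemma (in kernel_bounds) radial_low:
  assumes "z \<in> ball 0 1" "0 \<le> x" "0 \<le> l" "l \<le> c - 1" "0 < e + l + 2 - c"
  shows "(\<integral>\<^sub>D w. ennreal (rho w powr e * abs_kernel c z w) * indicator {w. rho w \<le> x} w) \<le>
      ennreal (M * rho z powr (- l) * (x powr (e + l + 2 - c) / (e + l + 2 - c)))"
proof -
  have "(\<integral>\<^sub>D w. ennreal (rho w powr e * abs_kernel c z w) * indicator {w. rho w \<in> {..x}} w) \<le>
    ennreal (M * rho z powr (- l)) * (\<integral>\<^sup>+t. ennreal (t powr (e + l + 1 - c)) * indicator {0..x} t \<partial>lborel)"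
    using assms by (intro radial_bound) auto
  also have "(\<integral>\<^sup>+t. ennreal (t powr (e + l + 1 - c)) * indicator {0..x} t \<partial>lborel) = ennreal (x powr (e + l + 2 - c) / (e + l + 2 - c))"
    using nn_integral_powr_from_0[of "e + l + 1 - c" x] assms by (simp add: algebra_simps)
  finally show ?thesis using M_pos assms by (simp flip: ennreal_mult)
qed

lemma (in kernel_bounds) radial_high:
  assumes "z \<in> ball 0 1" "0 < x" "0 \<le> l" "l \<le> c - 1" "e + l + 2 - c < 0"
  shows "(\<integral>\<^sub>D w. ennreal (rho w powr e * abs_kernel c z w) * indicator {w. x \<le> rho w} w) \<le>
      ennreal (M * rho z powr (- l) * (x powr (e + l + 2 - c) / (c - 2 - e - l)))"
proof -
  have "(\<integral>\<^sub>D w. ennreal (rho w powr e * abs_kernel c z w) * indicator {w. rho w \<in> {x..}} w) \<le>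
    ennreal (M * rho z powr (- l)) * (\<integral>\<^sup>+t. ennreal (t powr (e + l + 1 - c)) * indicator {x..} t \<partial>lborel)"
    using assms by (intro radial_bound) auto
  also have "(\<integral>\<^sup>+t. ennreal (t powr (e + l + 1 - c)) * indicator {x..} t \<partial>lborel) = ennreal (x powr (e + l + 2 - c) / (c - 2 - e - l))"
    using nn_integral_powr_to_inf[of "e + l + 1 - c" x] assms by (simp add: algebra_simps)
  finally show ?thesis using M_pos assms by (simp flip: ennreal_mult)
qed

section \<open>Weak type by Schur's test\<close>

text \<open>A pointwise substitute for Hoelder's inequality: whatever exceeds the height
  \<open>s\<close> is paid for by the p-th power, since \<open>x powr (1 - p)\<close>
  decreases.\<close>

lemma le_add_powr:
  fixes x s p :: real
  assumes "0 \<le> x" "0 < s" "1 \<le> p"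
  shows "x \<le> s + s powr (1 - p) * x powr p"
proof (cases "x \<le> s")
  case False
  then have "x = x powr (1 - p) * x powr p" using assms by (simp flip: powr_add)
  also have "\<dots> \<le> s powr (1 - p) * x powr p"
    using assms False by (intro mult_right_mono powr_mono2') auto
  finally show ?thesis using assms by simp
qed (simp add: add_increasing2)

lemma nn_integral_rho_powr_low:
  assumes "-1 < e" "0 \<le> x"
  shows "(\<integral>\<^sub>D z. ennreal (rho z powr e) * indicator {z. rho z \<le> x} z) \<le> ennreal (x powr (1 + e) / (1 + e))"
proof -
  have "(\<integral>\<^sub>D z. ennreal (rho z powr e) * indicator {z. rho z \<le> x} z) =
    (\<integral>\<^sub>D z. (\<lambda>t. ennreal (t powr e) * indicator {..x} t) (rho z))"
    by (intro nn_integral_cong) (auto simp: indicator_def)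
  also have "\<dots> = (\<integral>\<^sup>+t. (\<lambda>t. ennreal (t powr e) * indicator {..x} t) t * indicator {0<..<1} t \<partial>lborel)"
    by (rule nn_integral_dA_rho) measurable
  also have "\<dots> \<le> (\<integral>\<^sup>+t. ennreal (t powr e) * indicator {0..x} t \<partial>lborel)"
    by (intro nn_integral_mono) (auto simp: indicator_def)
  also have "\<dots> = ennreal (x powr (e + 1) / (e + 1))" by (rule nn_integral_powr_from_0[OF assms])
  finally show ?thesis by (simp add: add.commute)
qed

lemma emeasure_rho_less:
  assumes "0 \<le> x" shows "emeasure dA {z \<in> space dA. rho z < x} \<le> ennreal x"
proof -
  have "emeasure dA {z \<in> space dA. rho z < x} = (\<integral>\<^sub>D z. indicator {z \<in> space dA. rho z < x} z)"
    by (rule nn_integral_indicator[symmetric]) measurable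
  also have "\<dots> \<le> (\<integral>\<^sub>D z. ennreal (rho z powr 0) * indicator {z. rho z \<le> x} z)"
    using rho_bounds(1) by (intro nn_integral_mono) (force simp: indicator_def)
  also have "\<dots> \<le> ennreal (x powr (1 + 0) / (1 + 0))" using assms by (intro nn_integral_rho_powr_low) auto
  finally show ?thesis using assms by simp
qed

text \<open>For a given area, sets near the boundary are the worst. Splitting at
  \<open>rho z = |G|\<close>, the near part lies in a boundary ring of area at most
  \<open>|G|\<close>, and on the rest the integrand is at most \<open>|G| powr e\<close>.\<close>

lemma nn_integral_rho_powr_set:
  assumes e: "-1 < e" "e < 0" and [measurable]: "G \<in> sets dA"
  shows "(\<integral>\<^sub>D z. ennreal (rho z powr e) * indicator G z) \<le> ennreal ((1 / (1 + e) + 1) * measure dA G powr (1 + e))"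
proof (cases "measure dA G = 0")
  case True
  then have "G \<in> null_sets dA" by (auto simp: dA.emeasure_eq_measure)
  then have "AE z in dA. z \<notin> G" by (rule AE_not_in)
  then have "(\<integral>\<^sub>D z. ennreal (rho z powr e) * indicator G z) = (\<integral>\<^sub>D z. 0)"
    by (intro nn_integral_cong_AE) (auto elim!: eventually_mono)
  then show ?thesis by simp
next
  case False
  define x where "x = measure dA G"
  have x: "x > 0" using False by (simp add: x_def zero_less_measure_iff)
  have "(\<integral>\<^sub>D z. ennreal (rho z powr e) * indicator G z) \<le>
    (\<integral>\<^sub>D z. ennreal (rho z powr e) * indicator {z. rho z \<le> x} z + ennreal (x powr e) * indicator G z)"
  proof (intro nn_integral_mono)
    fix z assume "z \<in> space dA"
    then have "rho z > 0" using rho_bounds(1) by simp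
    then have "rho z powr e \<le> x powr e" if "\<not> rho z \<le> x"
      using x e that by (intro powr_mono2') auto
    then show "ennreal (rho z powr e) * indicator G z \<le> ennreal (rho z powr e) * indicator {z. rho z \<le> x} z + ennreal (x powr e) * indicator G z"
      by (cases "rho z \<le> x") (auto simp: indicator_def intro: ennreal_leI)
  qed
  also have "\<dots> = (\<integral>\<^sub>D z. ennreal (rho z powr e) * indicator {z. rho z \<le> x} z) + ennreal (x powr e) * emeasure dA G"
    by (subst nn_integral_add) (auto simp: nn_integral_cmult_indicator)
  also have "\<dots> \<le> ennreal (x powr (1 + e) / (1 + e)) + ennreal (x powr e) * ennreal x"
    using x e by (intro add_mono nn_integral_rho_powr_low mult_left_mono) (auto simp: x_def dA.emeasure_eq_measure)
  also have "\<dots> = ennreal (x powr (1 + e) / (1 + e) + x powr e * x)"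
    using x e by (simp flip: ennreal_mult ennreal_plus)
  also have "x powr (1 + e) / (1 + e) + x powr e * x = (1 / (1 + e) + 1) * x powr (1 + e)"
    using x by (simp add: powr_add field_simps)
  finally show ?thesis by (simp add: x_def)
qed

text \<open>
  The part \<open>rho z < (N / t) powr q\<close> of the level set is small by area.  On the rest, \<open>le_add_powr\<close>
  splits \<open>|f|\<close> so that the first summand contributes exactly \<open>t / 2\<close> to the majorant, and
  Chebyshev's inequality applies to the second.
\<close>

lemma schur_weak_type:
  assumes p: "1 \<le> p" and q: "0 < q" and C0: "0 < C0" and C1: "0 \<le> C1"
    and H1: "\<And>z. z \<in> ball 0 1 \<Longrightarrow>
      (\<integral>\<^sub>D w. ennreal (rho w powr (b - g) * abs_kernel c z w)) \<le> ennreal (C0 * rho z powr (- k))"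
    and H2: "\<And>w x. w \<in> ball 0 1 \<Longrightarrow> 0 < x \<Longrightarrow>
      (\<integral>\<^sub>D z. ennreal (rho z powr (a * p - k * (p - 1)) * abs_kernel c w z) * indicator {z. x \<le> rho z} z)
       \<le> ennreal (C1 * rho w powr (- (b + g * (p - 1))) * x powr (1 - p / q))"
    and f [measurable]: "f \<in> borel_measurable dA" and N: "0 < N" and t: "0 < t"
    and fN: "Lp_integral p f \<le> ennreal (N powr p)"
  shows "measure dA {z \<in> space dA. ennreal t < majorant a b c f z} \<le> (1 + 2 * (2 * C0) powr (p - 1) * C1) * (N / t) powr q"
proof -
  \<comment> \<open>The size which the level set may have up to a constant; it also serves as the
    threshold for \<open>rho z\<close>.\<close>
  define x where "x = (N / t) powr q"
  have x: "x > 0" using N t by (simp add: x_def)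
  \<comment> \<open>The cut at \<open>w\<close> is made at height
    \<open>s z * rho w powr (- g)\<close>; \<open>s z\<close> is the solution of
    \<open>rho z powr a * s z * C0 * rho z powr (- k) = t / 2\<close>.\<close>
  define s where "s = (\<lambda>z. t / (2 * C0) * rho z powr (k - a))"
  define D where "D = (t / (2 * C0)) powr (1 - p)"
  define e where "e = a * p - k * (p - 1)"
  define m where "m = b + g * (p - 1)"
  define X where "X = (\<lambda>z. \<integral>\<^sub>D w. ennreal (rho w powr m * abs_kernel c z w) * ennreal (norm (f w) powr p))"
  have Xm [measurable]: "X \<in> borel_measurable dA" unfolding X_def by measurable
  have maj_le: "majorant a b c f z \<le> ennreal (t / 2) + ennreal (D * rho z powr e) * X z" if z: "z \<in> space dA" for z
  proof -
    have rz: "rho z > 0" using rho_bounds(1) z by simp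
    have sz: "s z > 0" using rz t C0 by (simp add: s_def)
    have "(\<integral>\<^sub>D w. ennreal (rho w powr b * abs_kernel c z w) * ennreal (norm (f w))) \<le>
      (\<integral>\<^sub>D w. ennreal (s z) * ennreal (rho w powr (b - g) * abs_kernel c z w) +
         ennreal (s z powr (1 - p)) * (ennreal (rho w powr m * abs_kernel c z w) * ennreal (norm (f w) powr p)))"
    proof (intro nn_integral_mono)
      fix w assume w: "w \<in> space dA"
      have rw: "rho w > 0" using rho_bounds(1) w by simp
      let ?k = "abs_kernel c z w"
      have "norm (f w) \<le> s z * rho w powr (- g) + (s z * rho w powr (- g)) powr (1 - p) * norm (f w) powr p"
        using sz rw p by (intro le_add_powr) auto
      also have "(s z * rho w powr (- g)) powr (1 - p) = s z powr (1 - p) * rho w powr (g * (p - 1))"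
        using sz rw by (simp add: powr_mult powr_powr algebra_simps)
      finally have "rho w powr b * ?k * norm (f w) \<le>
        rho w powr b * ?k * (s z * rho w powr (- g) + s z powr (1 - p) * rho w powr (g * (p - 1)) * norm (f w) powr p)"
        by (intro mult_left_mono) auto
      also have "\<dots> = s z * (rho w powr b * rho w powr (- g) * ?k) + s z powr (1 - p) * ((rho w powr b * rho w powr (g * (p - 1)) * ?k) * norm (f w) powr p)"
        by (simp add: algebra_simps)
      also have "rho w powr b * rho w powr (- g) = rho w powr (b - g)" by (simp flip: powr_add)
      also have "rho w powr b * rho w powr (g * (p - 1)) = rho w powr m" by (simp add: m_def powr_add)
      finally have "ennreal (rho w powr b * ?k * norm (f w)) \<le>
         ennreal (s z * (rho w powr (b - g) * ?k) + s z powr (1 - p) * ((rho w powr m * ?k) * norm (f w) powr p))"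
        by (rule ennreal_leI)
      then show "ennreal (rho w powr b * ?k) * ennreal (norm (f w)) \<le>
        ennreal (s z) * ennreal (rho w powr (b - g) * ?k) + ennreal (s z powr (1 - p)) * (ennreal (rho w powr m * ?k) * ennreal (norm (f w) powr p))"
        using sz by (simp flip: ennreal_mult ennreal_plus)
    qed
    also have "\<dots> = ennreal (s z) * (\<integral>\<^sub>D w. ennreal (rho w powr (b - g) * abs_kernel c z w)) +
        ennreal (s z powr (1 - p)) * X z"
      unfolding X_def by (subst nn_integral_add) (auto simp: nn_integral_cmult)
    also have "\<dots> \<le> ennreal (s z) * ennreal (C0 * rho z powr (- k)) + ennreal (s z powr (1 - p)) * X z"
      using H1[of z] z by (intro add_mono mult_left_mono) auto
    finally have "majorant a b c f z \<le> ennreal (rho z powr a) * (ennreal (s z) * ennreal (C0 * rho z powr (- k)) + ennreal (s z powr (1 - p)) * X z)"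
      unfolding majorant_def by (intro mult_left_mono) auto
    also have "\<dots> = ennreal (rho z powr a * s z * C0 * rho z powr (- k)) + ennreal (rho z powr a * s z powr (1 - p)) * X z"
      using sz C0 by (simp add: distrib_left mult.assoc ennreal_mult)
    also have "rho z powr a * s z * C0 * rho z powr (- k) = t / 2 * (rho z powr a * rho z powr (k - a) * rho z powr (- k))"
      using C0 by (simp add: s_def)
    also have "\<dots> = t / 2" using rz by (simp flip: powr_add)
    also have "rho z powr a * s z powr (1 - p) = D * rho z powr e"
    proof -
      have "s z powr (1 - p) = D * rho z powr ((k - a) * (1 - p))"
        using t C0 rz unfolding s_def D_def by (subst powr_mult) (auto simp: powr_powr)
      then have "rho z powr a * s z powr (1 - p) = D * (rho z powr (a + (k - a) * (1 - p)))"
        by (simp add: powr_add)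
      also have "a + (k - a) * (1 - p) = e" by (simp add: e_def algebra_simps)
      finally show ?thesis .
    qed
    finally show ?thesis .
  qed
  define A where "A = {z \<in> space dA. ennreal t < majorant a b c f z \<and> x \<le> rho z}"
  have [measurable]: "A \<in> sets dA" unfolding A_def by measurable
  have "ennreal (t / 2) * emeasure dA A = (\<integral>\<^sub>D z. ennreal (t / 2) * indicator A z)"
    by (simp add: nn_integral_cmult_indicator)
  also have "\<dots> \<le> (\<integral>\<^sub>D z. ennreal (D * rho z powr e) * X z * indicator {z. x \<le> rho z} z)"
  proof (intro nn_integral_mono)
    fix z assume z: "z \<in> space dA"
    show "ennreal (t / 2) * indicator A z \<le> ennreal (D * rho z powr e) * X z * indicator {z. x \<le> rho z} z"
    proof (cases "z \<in> A")
      case True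
      then have "ennreal t < ennreal (t / 2) + ennreal (D * rho z powr e) * X z"
        using maj_le[OF z] by (auto simp: A_def)
      moreover have "ennreal t = ennreal (t / 2) + ennreal (t / 2)" using t by (simp flip: ennreal_plus)
      ultimately have "ennreal (t / 2) \<le> ennreal (D * rho z powr e) * X z"
        by (metis ennreal_add_left_cancel_less ennreal_neq_top less_imp_le infinity_ennreal_def)
      then show ?thesis using True by (simp add: A_def)
    qed simp
  qed
  also have "\<dots> = (\<integral>\<^sub>D z. (\<integral>\<^sub>D w. ennreal D * ((ennreal (rho w powr m) * ennreal (norm (f w) powr p)) *
      (ennreal (rho z powr e * abs_kernel c w z) * indicator {z. x \<le> rho z} z))))"
  proof (intro nn_integral_cong)
    fix z :: complex
    have "ennreal (D * rho z powr e) * X z * indicator {z. x \<le> rho z} z =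
      (\<integral>\<^sub>D w. ennreal (D * rho z powr e) * indicator {z. x \<le> rho z} z * (ennreal (rho w powr m * abs_kernel c z w) * ennreal (norm (f w) powr p)))"
      unfolding X_def by (subst nn_integral_cmult) (auto simp: mult_ac)
    also have "\<dots> = (\<integral>\<^sub>D w. ennreal D * ((ennreal (rho w powr m) * ennreal (norm (f w) powr p)) *
      (ennreal (rho z powr e * abs_kernel c w z) * indicator {z. x \<le> rho z} z)))"
      by (intro nn_integral_cong) (simp add: D_def ennreal_mult mult_ac norm_one_minus_mult_cnj_commute[of z])
    finally show "ennreal (D * rho z powr e) * X z * indicator {z. x \<le> rho z} z = (\<integral>\<^sub>D w. ennreal D * ((ennreal (rho w powr m) * ennreal (norm (f w) powr p)) *
      (ennreal (rho z powr e * abs_kernel c w z) * indicator {z. x \<le> rho z} z)))" .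
  qed
  \<comment> \<open>With the \<open>z\<close>-integral innermost \<open>H2\<close> applies, and its
    factor \<open>rho w powr (- m)\<close> removes the weight in front of
    \<open>|f|^p\<close>.\<close>
  also have "\<dots> = (\<integral>\<^sub>D w. (\<integral>\<^sub>D z. ennreal D * ((ennreal (rho w powr m) * ennreal (norm (f w) powr p)) *
      (ennreal (rho z powr e * abs_kernel c w z) * indicator {z. x \<le> rho z} z))))"
  proof -
    interpret pair_sigma_finite dA dA ..
    show ?thesis by (rule Fubini') measurable
  qed
  also have "\<dots> = (\<integral>\<^sub>D w. ennreal D * ((ennreal (rho w powr m) * ennreal (norm (f w) powr p)) *
      (\<integral>\<^sub>D z. ennreal (rho z powr e * abs_kernel c w z) * indicator {z. x \<le> rho z} z)))"
    by (simp add: nn_integral_cmult)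
  also have "\<dots> \<le> (\<integral>\<^sub>D w. ennreal D * ((ennreal (rho w powr m) * ennreal (norm (f w) powr p)) *
      ennreal (C1 * rho w powr (- m) * x powr (1 - p / q))))"
    using H2 x by (intro nn_integral_mono mult_left_mono) (auto simp: m_def e_def)
  also have "\<dots> = (\<integral>\<^sub>D w. ennreal (D * C1 * x powr (1 - p / q)) * ennreal (norm (f w) powr p))"
  proof (intro nn_integral_cong)
    fix w assume "w \<in> space dA"
    then have "rho w powr m * rho w powr (- m) = 1" using rho_bounds(1)[of w] by (simp flip: powr_add)
    then have "D * ((rho w powr m * norm (f w) powr p) * (C1 * rho w powr (- m) * x powr (1 - p / q))) =
      D * C1 * x powr (1 - p / q) * norm (f w) powr p"
      by (simp add: algebra_simps)
    then show "ennreal D * ((ennreal (rho w powr m) * ennreal (norm (f w) powr p)) *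
      ennreal (C1 * rho w powr (- m) * x powr (1 - p / q))) = ennreal (D * C1 * x powr (1 - p / q)) * ennreal (norm (f w) powr p)"
      using C1 by (simp add: D_def flip: ennreal_mult)
  qed
  also have "\<dots> \<le> ennreal (D * C1 * x powr (1 - p / q)) * ennreal (N powr p)"
    using fN by (simp add: nn_integral_cmult mult_left_mono)
  also have "\<dots> = ennreal (D * C1 * x powr (1 - p / q) * N powr p)"
    using C1 by (simp add: D_def ennreal_mult)
  finally have "ennreal (t / 2 * measure dA A) \<le> ennreal (D * C1 * x powr (1 - p / q) * N powr p)"
    using t by (simp add: dA.emeasure_eq_measure flip: ennreal_mult)
  then have "t / 2 * measure dA A \<le> D * C1 * x powr (1 - p / q) * N powr p"
    using C1 by (subst (asm) ennreal_le_iff) (auto simp: D_def)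
  \<comment> \<open>Since \<open>x powr (1 - p / q) = x * (N / t) powr (- p)\<close>, the norm
    cancels and only a multiple of \<open>t * x\<close> remains.\<close>
  also have "\<dots> = t / 2 * (2 * (2 * C0) powr (p - 1) * C1 * x)"
  proof -
    have 1: "x powr (1 - p / q) = x * (N / t) powr (- p)"
      using N t q by (simp add: x_def powr_powr powr_add[symmetric] right_diff_distrib)
    have 2: "D = t powr (1 - p) * (2 * C0) powr (p - 1)"
      using t C0 by (simp add: D_def powr_divide powr_diff field_simps)
    have 3: "(N / t) powr (- p) = N powr (- p) * t powr p"
      using t N by (simp add: powr_divide powr_minus field_simps)
    have "D * C1 * x powr (1 - p / q) * N powr p = (N powr (- p) * N powr p) * (t powr (1 - p) * t powr p) * ((2 * C0) powr (p - 1) * C1 * x)"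
      unfolding 1 2 3 by (simp add: algebra_simps)
    also have "\<dots> = t * ((2 * C0) powr (p - 1) * C1 * x)" using N t by (simp flip: powr_add)
    finally show ?thesis by simp
  qed
  finally have mA: "measure dA A \<le> 2 * (2 * C0) powr (p - 1) * C1 * x" using t by simp
  have "measure dA {z \<in> space dA. rho z < x} \<le> x"
    using emeasure_rho_less[of x] x by (simp add: dA.emeasure_eq_measure)
  moreover have "measure dA {z \<in> space dA. ennreal t < majorant a b c f z} \<le> measure dA ({z \<in> space dA. rho z < x} \<union> A)"
  proof (rule dA.finite_measure_mono)
    have "{z \<in> space dA. rho z < x} \<in> sets dA" by measurable
    then show "{z \<in> space dA. rho z < x} \<union> A \<in> sets dA" by simp
  qed (auto simp: A_def)
  moreover have "measure dA ({z \<in> space dA. rho z < x} \<union> A) \<le> measure dA {z \<in> space dA. rho z < x} + measure dA A"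
    by (rule measure_Un_le) measurable
  ultimately have "measure dA {z \<in> space dA. ennreal t < majorant a b c f z} \<le> x + 2 * (2 * C0) powr (p - 1) * C1 * x"
    using mA by linarith
  then show ?thesis by (simp add: x_def algebra_simps)
qed

section \<open>Restricted estimates and the Lorentz endpoints\<close>

text \<open>The bilinear form of the majorant on two indicators. Testing on sets is all that is
  needed from a Lorentz space with second index 1 into a weak space.\<close>

definition kernel_form :: "real \<Rightarrow> real \<Rightarrow> real \<Rightarrow> complex set \<Rightarrow> complex set \<Rightarrow> ennreal" where
  "kernel_form a b c E G = (\<integral>\<^sub>D z. (\<integral>\<^sub>D w. ennreal (rho z powr a * rho w powr b * abs_kernel c z w) *
     indicator E w * indicator G z))"

text \<open>The modulus of the kernel is symmetric, so passing to the adjoint exchanges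
  \<open>a\<close> with \<open>b\<close> and \<open>E\<close> with \<open>G\<close>.\<close>

lemma kernel_form_commute:
  assumes [measurable]: "E \<in> sets dA" "G \<in> sets dA"
  shows "kernel_form a b c E G = kernel_form b a c G E"
proof -
  interpret pair_sigma_finite dA dA ..
  define h where "h = (\<lambda>z w. ennreal (rho z powr a * rho w powr b * abs_kernel c z w) * indicator E w * indicator G z)"
  have [measurable]: "(\<lambda>(z, w). h z w) \<in> borel_measurable (dA \<Otimes>\<^sub>M dA)"
    unfolding h_def split_beta by measurable
  have h_eq: "h z w = ennreal (rho w powr b * rho z powr a * abs_kernel c w z) * indicator G z * indicator E w" for z w
    unfolding h_def norm_one_minus_mult_cnj_commute[of z w] by (simp add: mult_ac)
  have "kernel_form a b c E G = (\<integral>\<^sub>D z. (\<integral>\<^sub>D w. h z w))"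
    unfolding kernel_form_def h_def ..
  also have "\<dots> = (\<integral>\<^sub>D w. (\<integral>\<^sub>D z. h z w))"
    by (rule Fubini') measurable
  also have "\<dots> = kernel_form b a c G E"
    unfolding kernel_form_def h_eq ..
  finally show ?thesis .
qed

lemma one_le_add_powr_neg:
  fixes X k :: real
  assumes "X > 0" "k > 0"
  shows "1 \<le> X + X powr (- k)"
proof (cases "X \<ge> 1")
  case False
  then have "1 \<le> X powr (- k)" using assms by (simp add: powr_minus one_le_inverse_iff powr_le1)
  then show ?thesis using assms by linarith
qed (simp add: add_increasing2)

text \<open>
  Let \<open>x = |E|\<close> and \<open>y = |G|\<close>.  If \<open>rho w \<le> x\<close>, extend the \<open>w\<close>-integral to all such \<open>w\<close>; if \<open>rho z \<le> y\<close>,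
  extend the \<open>z\<close>-integral.  In the remaining region neither suffices: there
  \<open>1 \<le> X + X powr (- k)\<close> with \<open>X = (rho z / y) powr (- a) * (rho w / x) powr (- g)\<close>, and \<open>g\<close>, \<open>k\<close> are
  chosen such that the first summand is integrable in \<open>w\<close> and the second one in \<open>z\<close>.
\<close>

lemma kernel_form_restricted_bound:
  assumes c: "c > 1" and a: "-1 < a" and d: "0 < b + 2 - c" "b + 2 - c < 1" and ad: "- a > b + 2 - c"
  obtains C where "0 \<le> C" "\<And>E G. E \<in> sets dA \<Longrightarrow> G \<in> sets dA \<Longrightarrow>
    kernel_form a b c E G \<le> ennreal (C * measure dA E powr (b + 2 - c) * measure dA G powr (1 + a))"
proof -
  define d where "d = b + 2 - c"
  note dd = d[folded d_def] ad[folded d_def]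
  obtain m' M where kb: "kernel_bounds c m' M" using kernel_bounds_exist[OF c] by blast
  then interpret kernel_bounds c m' M .
  note M = M_pos and low = radial_low and high = radial_high
  \<comment> \<open>This is \<open>- a > d\<close> rewritten. The lower bound on \<open>k\<close>
    gives \<open>a + a * k < - 1\<close>, the decay needed in \<open>z\<close>; the upper bound
    gives \<open>g > d\<close>, the decay needed in \<open>w\<close>.\<close>
  have "(1 + a) / (- a) < (1 - d) / d" using dd a by (simp add: field_simps)
  then obtain k where k: "(1 + a) / (- a) < k" "k < (1 - d) / d" using dense by blast
  have a0: "a < 0" using dd by linarith
  have "0 < (1 + a) / (- a)" using a a0 by (intro divide_pos_pos) auto
  then have k0: "k > 0" using k by linarith
  have k1: "a + a * k + 1 < 0" using k(1) a0 by (simp add: field_simps)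
  \<comment> \<open>Then \<open>X powr (- k)\<close> carries \<open>rho w powr (1 - d)\<close>,
    which turns \<open>rho w powr b\<close> into \<open>rho w powr (c - 1)\<close>. The
    \<open>z\<close>-integral of the kernel contributes \<open>rho w powr (1 - c)\<close> and
    cancels it.\<close>
  define g where "g = (1 - d) / k"
  have gk: "g * k = 1 - d" using k0 by (simp add: g_def)
  have gd: "g > d" using k(2) k0 dd by (simp add: g_def field_simps)
  define A1 A2 A3 A4 where "A1 = (1 / (1 + a) + 1) * (M / d)" and "A2 = M / (1 + a)" and "A3 = M / (g - d)" and "A4 = M / (- 1 - a - a * k)"
  have A: "0 \<le> A1" "0 \<le> A2" "0 \<le> A3" "0 \<le> A4"
    using M a dd gd k1 by (simp_all add: A1_def A2_def A3_def A4_def)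
  show ?thesis
  proof (rule that[of "A1 + A2 + A3 + A4"])
    fix E G assume [measurable]: "E \<in> sets dA" "G \<in> sets dA"
    define x y where "x = measure dA E" and "y = measure dA G"
    show "kernel_form a b c E G \<le> ennreal ((A1 + A2 + A3 + A4) * measure dA E powr (b + 2 - c) * measure dA G powr (1 + a))"
    \<comment> \<open>For a null set the right-hand side is 0 because \<open>0 powr _ = 0\<close>;
      afterwards one may divide by \<open>x\<close> and \<open>y\<close>.\<close>
    proof (cases "x = 0 \<or> y = 0")
      case True
      then have "E \<in> null_sets dA \<or> G \<in> null_sets dA" by (auto simp: dA.emeasure_eq_measure x_def y_def)
      then have "kernel_form a b c E G = 0"
      proof
        assume "E \<in> null_sets dA"
        then have AE: "AE w in dA. w \<notin> E" by (rule AE_not_in)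
        have "(\<integral>\<^sub>D w. ennreal (rho z powr a * rho w powr b * abs_kernel c z w) *
           indicator E w * indicator G z) = (\<integral>\<^sub>D w. 0)" for z
          by (rule nn_integral_cong_AE, use AE in eventually_elim) simp
        then show ?thesis by (simp add: kernel_form_def)
      next
        assume "G \<in> null_sets dA"
        then have AE: "AE z in dA. z \<notin> G" by (rule AE_not_in)
        have "kernel_form a b c E G = (\<integral>\<^sub>D z. 0)"
          unfolding kernel_form_def by (rule nn_integral_cong_AE, use AE in eventually_elim) simp
        then show ?thesis by simp
      qed
      then show ?thesis by simp
    next
      case False
      then have xy: "x > 0" "y > 0" by (auto simp: x_def y_def zero_less_measure_iff)
      let ?k = "\<lambda>z w. abs_kernel c z w"
      \<comment> \<open>\<open>F1\<close> covers \<open>rho w <= x\<close>. \<open>F2\<close> covers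
        \<open>rho w > x\<close> with \<open>rho z <= y\<close>, where
        \<open>rho w powr (d - 1) <= x powr (d - 1)\<close> as \<open>d < 1\<close>.
        \<open>F3\<close> and \<open>F4\<close> are the summands from \<open>X\<close> and from
        \<open>X powr (- k)\<close> in the remaining region.\<close>
      define F1 F2 F3 F4 :: "complex \<Rightarrow> complex \<Rightarrow> ennreal" where
        "F1 = (\<lambda>z w. (ennreal (rho z powr a) * indicator G z) * (ennreal (rho w powr b * ?k z w) * indicator {w. rho w \<le> x} w))" and
        "F2 = (\<lambda>z w. (ennreal (x powr (d - 1)) * ennreal (rho w powr (c - 1)) * indicator E w) * (ennreal (rho z powr a * ?k w z) * indicator {z. rho z \<le> y} z))" and
        "F3 = (\<lambda>z w. (ennreal (y powr a * x powr g) * indicator G z) * (ennreal (rho w powr (b - g) * ?k z w) * indicator {w. x \<le> rho w} w))" and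
        "F4 = (\<lambda>z w. (ennreal (y powr (- a * k) * x powr (d - 1)) * ennreal (rho w powr (c - 1)) * indicator E w) *
            (ennreal (rho z powr (a + a * k) * ?k w z) * indicator {z. y \<le> rho z} z))"
      have [measurable]: "(\<lambda>(z, w). F1 z w) \<in> borel_measurable (dA \<Otimes>\<^sub>M dA)"
         "(\<lambda>(z, w). F2 z w) \<in> borel_measurable (dA \<Otimes>\<^sub>M dA)"
         "(\<lambda>(z, w). F3 z w) \<in> borel_measurable (dA \<Otimes>\<^sub>M dA)"
         "(\<lambda>(z, w). F4 z w) \<in> borel_measurable (dA \<Otimes>\<^sub>M dA)"
        unfolding F1_def F2_def F3_def F4_def split_beta by measurable
      have pw: "ennreal (rho z powr a * rho w powr b * ?k z w) * indicator E w * indicator G z \<le> F1 z w + F2 z w + (F3 z w + F4 z w)"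
        if z: "z \<in> space dA" and w: "w \<in> space dA" for z w
      proof (cases "w \<in> E \<and> z \<in> G")
        case True
        have r: "rho z > 0" "rho w > 0" using rho_bounds(1) z w by auto
        consider "rho w \<le> x" | "rho w > x" "rho z \<le> y" | "rho w > x" "rho z > y" by linarith
        then show ?thesis
        proof cases
          case 1
          then have "ennreal (rho z powr a * rho w powr b * ?k z w) * indicator E w * indicator G z = F1 z w"
            using True by (simp add: F1_def ennreal_mult mult_ac)
          then show ?thesis by (simp add: add_increasing2)
        next
          case 2
          have "rho w powr b = rho w powr (d - 1) * rho w powr (c - 1)"
            by (simp add: d_def flip: powr_add)
          also have "\<dots> \<le> x powr (d - 1) * rho w powr (c - 1)"
            using 2 xy dd by (intro mult_right_mono powr_mono2') auto
          finally have "rho z powr a * rho w powr b * ?k z w \<le> rho z powr a * (x powr (d - 1) * rho w powr (c - 1)) * ?k z w"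
            by (intro mult_right_mono mult_left_mono) auto
          then have "ennreal (rho z powr a * rho w powr b * ?k z w) * indicator E w * indicator G z \<le> F2 z w"
            using True 2 by (auto simp: F2_def norm_one_minus_mult_cnj_commute[of w] mult_ac simp flip: ennreal_mult intro!: ennreal_leI)
          then show ?thesis by (simp add: add_increasing2 add_increasing)
        next
          case 3
          define X where "X = (rho z / y) powr (- a) * (rho w / x) powr (- g)"
          have X: "X > 0" using r xy by (simp add: X_def)
          have X1: "rho z powr a * rho w powr b * X = y powr a * x powr g * rho w powr (b - g)"
            using r xy by (simp add: X_def powr_divide powr_minus powr_diff field_simps)
          have "X powr (- k) = (rho z / y) powr (a * k) * (rho w / x) powr (g * k)"
            using r xy by (simp add: X_def powr_mult powr_powr)
          also have "\<dots> = rho z powr (a * k) * y powr (- a * k) * (rho w powr (1 - d) * x powr (d - 1))"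
            using r xy by (simp add: gk powr_divide powr_minus powr_diff field_simps)
          finally have X2: "rho z powr a * rho w powr b * X powr (- k) =
              y powr (- a * k) * x powr (d - 1) * (rho z powr a * rho z powr (a * k)) * (rho w powr b * rho w powr (1 - d))"
            by (simp add: mult_ac)
          have X3: "rho z powr a * rho z powr (a * k) = rho z powr (a + a * k)"
            "rho w powr b * rho w powr (1 - d) = rho w powr (c - 1)"
            by (simp_all add: d_def flip: powr_add)
          have "rho z powr a * rho w powr b * ?k z w * 1 \<le> rho z powr a * rho w powr b * ?k z w * (X + X powr (- k))"
            by (intro mult_left_mono one_le_add_powr_neg X k0) auto
          also have "\<dots> = (rho z powr a * rho w powr b * X) * ?k z w + (rho z powr a * rho w powr b * X powr (- k)) * ?k z w"
            by (simp add: algebra_simps)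
          also have "\<dots> = y powr a * x powr g * rho w powr (b - g) * ?k z w +
             y powr (- a * k) * x powr (d - 1) * rho z powr (a + a * k) * rho w powr (c - 1) * ?k z w"
            unfolding X1 X2 X3 ..
          finally have "ennreal (rho z powr a * rho w powr b * ?k z w) \<le> ennreal (y powr a * x powr g * rho w powr (b - g) * ?k z w +
             y powr (- a * k) * x powr (d - 1) * rho z powr (a + a * k) * rho w powr (c - 1) * ?k z w)"
            by (intro ennreal_leI) simp
          also have "\<dots> = F3 z w + F4 z w"
            using True 3 by (simp add: F3_def F4_def norm_one_minus_mult_cnj_commute[of w] mult_ac flip: ennreal_mult)
          finally show ?thesis using True by (simp add: add_increasing)
        qed
      qed auto
      have "kernel_form a b c E G \<le> (\<integral>\<^sub>D z. (\<integral>\<^sub>D w. F1 z w + F2 z w + (F3 z w + F4 z w)))"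
        unfolding kernel_form_def by (intro nn_integral_mono pw)
      also have "\<dots> = (\<integral>\<^sub>D z. (\<integral>\<^sub>D w. F1 z w) + (\<integral>\<^sub>D w. F2 z w) + ((\<integral>\<^sub>D w. F3 z w) + (\<integral>\<^sub>D w. F4 z w)))"
        by (intro nn_integral_cong) (simp add: nn_integral_add)
      also have "\<dots> = (\<integral>\<^sub>D z. (\<integral>\<^sub>D w. F1 z w)) + (\<integral>\<^sub>D z. (\<integral>\<^sub>D w. F2 z w)) +
         ((\<integral>\<^sub>D z. (\<integral>\<^sub>D w. F3 z w)) + (\<integral>\<^sub>D z. (\<integral>\<^sub>D w. F4 z w)))"
        by (simp add: nn_integral_add)
      also have "\<dots> \<le> ennreal (A1 * x powr d * y powr (1 + a)) + ennreal (A2 * x powr d * y powr (1 + a)) +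
         (ennreal (A3 * x powr d * y powr (1 + a)) + ennreal (A4 * x powr d * y powr (1 + a)))"
      proof (intro add_mono)
        have "(\<integral>\<^sub>D z. (\<integral>\<^sub>D w. F1 z w)) \<le> (\<integral>\<^sub>D z. (ennreal (rho z powr a) * indicator G z) * ennreal (M * (x powr d / d)))"
        proof (intro nn_integral_mono)
          fix z assume z: "z \<in> space dA"
          have "rho z > 0" using rho_bounds(1) z by auto
          then have "(\<integral>\<^sub>D w. ennreal (rho w powr b * ?k z w) * indicator {w. rho w \<le> x} w) \<le> ennreal (M * (x powr d / d))"
            using low[of z x 0 b] z xy c dd by (simp add: d_def)
          then show "(\<integral>\<^sub>D w. F1 z w) \<le> (ennreal (rho z powr a) * indicator G z) * ennreal (M * (x powr d / d))"
            unfolding F1_def by (subst nn_integral_cmult) (auto intro!: mult_left_mono)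
        qed
        also have "\<dots> = (\<integral>\<^sub>D z. ennreal (rho z powr a) * indicator G z) * ennreal (M * (x powr d / d))"
          by (rule nn_integral_multc) measurable
        also have "\<dots> \<le> ennreal ((1 / (1 + a) + 1) * y powr (1 + a)) * ennreal (M * (x powr d / d))"
          unfolding y_def by (intro mult_right_mono nn_integral_rho_powr_set a a0) auto
        also have "\<dots> = ennreal (A1 * x powr d * y powr (1 + a))"
          using M a dd by (simp add: A1_def mult_ac flip: ennreal_mult)
        finally show "(\<integral>\<^sub>D z. (\<integral>\<^sub>D w. F1 z w)) \<le> ennreal (A1 * x powr d * y powr (1 + a))" .
      next
        interpret pair_sigma_finite dA dA ..
        have "(\<integral>\<^sub>D z. (\<integral>\<^sub>D w. F2 z w)) = (\<integral>\<^sub>D w. (\<integral>\<^sub>D z. F2 z w))"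
          by (rule Fubini') measurable
        also have "\<dots> \<le> (\<integral>\<^sub>D w. ennreal (x powr (d - 1) * (M * (y powr (1 + a) / (1 + a)))) * indicator E w)"
        proof (intro nn_integral_mono)
          fix w assume w: "w \<in> space dA"
          have r: "rho w > 0" using rho_bounds(1) w by auto
          have "(\<integral>\<^sub>D z. F2 z w) = (ennreal (x powr (d - 1)) * ennreal (rho w powr (c - 1)) * indicator E w) *
             (\<integral>\<^sub>D z. ennreal (rho z powr a * ?k w z) * indicator {z. rho z \<le> y} z)"
            unfolding F2_def by (rule nn_integral_cmult) measurable
          also have "\<dots> \<le> (ennreal (x powr (d - 1)) * ennreal (rho w powr (c - 1)) * indicator E w) *
              ennreal (M * rho w powr (1 - c) * (y powr (1 + a) / (1 + a)))"
            using low[of w y "c - 1" a] w xy c a by (intro mult_left_mono) (simp_all add: add.commute)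
          also have "\<dots> = ennreal (x powr (d - 1) * (M * (y powr (1 + a) / (1 + a))) * (rho w powr (c - 1) * rho w powr (1 - c))) * indicator E w"
            using M a by (simp add: indicator_def mult_ac flip: ennreal_mult)
          also have "rho w powr (c - 1) * rho w powr (1 - c) = 1" using r by (simp flip: powr_add)
          finally show "(\<integral>\<^sub>D z. F2 z w) \<le> ennreal (x powr (d - 1) * (M * (y powr (1 + a) / (1 + a)))) * indicator E w" by simp
        qed
        also have "\<dots> = ennreal (x powr (d - 1) * (M * (y powr (1 + a) / (1 + a)))) * ennreal x"
          by (simp add: nn_integral_cmult_indicator dA.emeasure_eq_measure x_def)
        also have "\<dots> = ennreal ((x powr (d - 1) * x) * (M * (y powr (1 + a) / (1 + a))))"
          using M a xy by (simp add: mult_ac flip: ennreal_mult)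
        also have "x powr (d - 1) * x = x powr d" using xy by (simp add: powr_diff)
        also have "x powr d * (M * (y powr (1 + a) / (1 + a))) = A2 * x powr d * y powr (1 + a)" by (simp add: A2_def)
        finally show "(\<integral>\<^sub>D z. (\<integral>\<^sub>D w. F2 z w)) \<le> ennreal (A2 * x powr d * y powr (1 + a))" .
      next
        have "(\<integral>\<^sub>D z. (\<integral>\<^sub>D w. F3 z w)) \<le> (\<integral>\<^sub>D z. ennreal (y powr a * x powr g * (M * (x powr (d - g) / (g - d)))) * indicator G z)"
        proof (intro nn_integral_mono)
          fix z assume z: "z \<in> space dA"
          have "rho z > 0" using rho_bounds(1) z by auto
          then have *: "(\<integral>\<^sub>D w. ennreal (rho w powr (b - g) * ?k z w) * indicator {w. x \<le> rho w} w) \<le> ennreal (M * (x powr (d - g) / (g - d)))"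
            using high[of z x 0 "b - g"] z xy c dd gd by (simp add: d_def algebra_simps)
          have "(\<integral>\<^sub>D w. F3 z w) = (ennreal (y powr a * x powr g) * indicator G z) *
             (\<integral>\<^sub>D w. ennreal (rho w powr (b - g) * ?k z w) * indicator {w. x \<le> rho w} w)"
            unfolding F3_def by (rule nn_integral_cmult) measurable
          also have "\<dots> \<le> (ennreal (y powr a * x powr g) * indicator G z) * ennreal (M * (x powr (d - g) / (g - d)))"
            by (intro mult_left_mono *) auto
          also have "\<dots> = ennreal (y powr a * x powr g * (M * (x powr (d - g) / (g - d)))) * indicator G z"
            using M gd by (simp add: indicator_def flip: ennreal_mult)
          finally show "(\<integral>\<^sub>D w. F3 z w) \<le> ennreal (y powr a * x powr g * (M * (x powr (d - g) / (g - d)))) * indicator G z" .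
        qed
        also have "\<dots> = ennreal (y powr a * x powr g * (M * (x powr (d - g) / (g - d)))) * ennreal y"
          by (simp add: nn_integral_cmult_indicator dA.emeasure_eq_measure y_def)
        also have "\<dots> = ennreal ((y powr a * y) * (x powr g * x powr (d - g)) * A3)"
          using M gd xy by (simp add: A3_def mult_ac flip: ennreal_mult)
        also have "y powr a * y = y powr (1 + a)" using xy by (simp add: powr_add)
        also have "x powr g * x powr (d - g) = x powr d" by (simp flip: powr_add)
        finally show "(\<integral>\<^sub>D z. (\<integral>\<^sub>D w. F3 z w)) \<le> ennreal (A3 * x powr d * y powr (1 + a))" by (simp add: mult_ac)
      next
        interpret pair_sigma_finite dA dA ..
        have "(\<integral>\<^sub>D z. (\<integral>\<^sub>D w. F4 z w)) = (\<integral>\<^sub>D w. (\<integral>\<^sub>D z. F4 z w))"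
          by (rule Fubini') measurable
        also have "\<dots> \<le> (\<integral>\<^sub>D w. ennreal (y powr (- a * k) * x powr (d - 1) * (M * (y powr (1 + a + a * k) / (- 1 - a - a * k)))) * indicator E w)"
        proof (intro nn_integral_mono)
          fix w assume w: "w \<in> space dA"
          have r: "rho w > 0" using rho_bounds(1) w by auto
          have "(\<integral>\<^sub>D z. F4 z w) = (ennreal (y powr (- a * k) * x powr (d - 1)) * ennreal (rho w powr (c - 1)) * indicator E w) *
             (\<integral>\<^sub>D z. ennreal (rho z powr (a + a * k) * ?k w z) * indicator {z. y \<le> rho z} z)"
            unfolding F4_def by (rule nn_integral_cmult) measurable
          also have "\<dots> \<le> (ennreal (y powr (- a * k) * x powr (d - 1)) * ennreal (rho w powr (c - 1)) * indicator E w) *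
              ennreal (M * rho w powr (1 - c) * (y powr (1 + a + a * k) / (- 1 - a - a * k)))"
            using high[of w y "c - 1" "a + a * k"] w xy c k1 by (intro mult_left_mono) (simp_all add: algebra_simps)
          also have "\<dots> = ennreal (y powr (- a * k) * x powr (d - 1) * (M * (y powr (1 + a + a * k) / (- 1 - a - a * k))) * (rho w powr (c - 1) * rho w powr (1 - c))) * indicator E w"
            using M k1 by (simp add: indicator_def mult_ac flip: ennreal_mult)
          also have "rho w powr (c - 1) * rho w powr (1 - c) = 1" using r by (simp flip: powr_add)
          finally show "(\<integral>\<^sub>D z. F4 z w) \<le> ennreal (y powr (- a * k) * x powr (d - 1) * (M * (y powr (1 + a + a * k) / (- 1 - a - a * k)))) * indicator E w" by simp
        qed
        also have "\<dots> = ennreal (y powr (- a * k) * x powr (d - 1) * (M * (y powr (1 + a + a * k) / (- 1 - a - a * k)))) * ennreal x"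
          by (simp add: nn_integral_cmult_indicator dA.emeasure_eq_measure x_def)
        also have "\<dots> = ennreal ((x powr (d - 1) * x) * (y powr (- a * k) * y powr (1 + a + a * k)) * A4)"
          using M k1 xy by (simp add: A4_def mult_ac flip: ennreal_mult)
        also have "x powr (d - 1) * x = x powr d" using xy by (simp add: powr_diff)
        also have "y powr (- a * k) * y powr (1 + a + a * k) = y powr (1 + a)" by (simp flip: powr_add)
        finally show "(\<integral>\<^sub>D z. (\<integral>\<^sub>D w. F4 z w)) \<le> ennreal (A4 * x powr d * y powr (1 + a))" by (simp add: mult_ac)
      qed
      also have "\<dots> = ennreal ((A1 + A2 + A3 + A4) * x powr d * y powr (1 + a))"
        using A by (simp add: algebra_simps flip: ennreal_plus)
      finally show ?thesis by (simp add: x_def y_def d_def)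
    qed
  qed (use A in auto)
qed

text \<open>Integrate the majorant over its own level set \<open>G\<close> and write
  \<open>|f|\<close> as the integral of the indicators of its level sets. The restricted bound then
  yields \<open>t * |G| <= C * |G| powr (1 - 1 / q)\<close> times the integral defining the Lorentz
  norm. Dividing by the power of \<open>|G|\<close> is allowed as \<open>dA\<close> is
  finite.\<close>

lemma restricted_imp_Lorentz_weak_type:
  assumes p: "0 < p" and q: "0 < q" and C: "0 \<le> C"
    and restr: "\<And>E G. E \<in> sets dA \<Longrightarrow> G \<in> sets dA \<Longrightarrow>
      kernel_form a b c E G \<le> ennreal (C * measure dA E powr (1 / p) * measure dA G powr (1 - 1 / q))"
    and f [measurable]: "f \<in> borel_measurable dA" and fin: "Lp1_norm p f < \<infinity>" and t: "t > 0"
  shows "t * measure dA {z \<in> space dA. ennreal t < majorant a b c f z} powr (1 / q) \<le> C / p * enn2real (Lp1_norm p f)"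
proof -
  define G where "G = {z \<in> space dA. ennreal t < majorant a b c f z}"
  have [measurable]: "G \<in> sets dA" unfolding G_def by measurable
  define y where "y = measure dA G"
  define E where "E = (\<lambda>s. {w \<in> space dA. s < norm (f w)})"
  have [measurable]: "E s \<in> sets dA" for s unfolding E_def by measurable
  define I where "I = (\<integral>\<^sup>+ s\<in>{0<..}. ennreal (dist_fun f s powr (1 / p)) \<partial>lborel)"
  have LpI: "Lp1_norm p f = ennreal p * I" by (simp add: Lp1_norm_def I_def)
  define h where "h = (\<lambda>z w. ennreal (rho z powr a * rho w powr b * abs_kernel c z w) * indicator G z)"
  have hm [measurable]: "(\<lambda>(z, w). h z w) \<in> borel_measurable (dA \<Otimes>\<^sub>M dA)" unfolding h_def split_beta by measurable
  define \<psi> where "\<psi> = (\<lambda>w. \<integral>\<^sub>D z. h z w)"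
  have [measurable]: "\<psi> \<in> borel_measurable dA" unfolding \<psi>_def by measurable
  interpret P: pair_sigma_finite dA dA ..
  interpret Q: pair_sigma_finite dA "lborel :: real measure" ..
  have lc: "ennreal (norm (f w)) = (\<integral>\<^sup>+s. indicator {0<..<norm (f w)} s \<partial>lborel)" for w
    by simp
  have "ennreal t * emeasure dA G = (\<integral>\<^sub>D z. ennreal t * indicator G z)"
    by (simp add: nn_integral_cmult_indicator)
  also have "\<dots> \<le> (\<integral>\<^sub>D z. majorant a b c f z * indicator G z)"
    by (intro nn_integral_mono) (auto simp: G_def indicator_def)
  also have "\<dots> = (\<integral>\<^sub>D z. (\<integral>\<^sub>D w. h z w * ennreal (norm (f w))))"
  proof (intro nn_integral_cong)
    fix z
    have "majorant a b c f z * indicator G z = (\<integral>\<^sub>D w. (ennreal (rho z powr a) * indicator G z) *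
      (ennreal (rho w powr b * abs_kernel c z w) * ennreal (norm (f w))))"
      unfolding majorant_def by (subst nn_integral_cmult) (auto simp: mult_ac)
    also have "\<dots> = (\<integral>\<^sub>D w. h z w * ennreal (norm (f w)))"
      by (intro nn_integral_cong) (simp add: h_def ennreal_mult mult_ac)
    finally show "majorant a b c f z * indicator G z = (\<integral>\<^sub>D w. h z w * ennreal (norm (f w)))" .
  qed
  also have "\<dots> = (\<integral>\<^sub>D w. (\<integral>\<^sub>D z. h z w * ennreal (norm (f w))))"
    by (rule P.Fubini') measurable
  also have "\<dots> = (\<integral>\<^sub>D w. \<psi> w * ennreal (norm (f w)))"
    unfolding \<psi>_def by (intro nn_integral_cong nn_integral_multc) measurable
  also have "\<dots> = (\<integral>\<^sub>D w. (\<integral>\<^sup>+s. \<psi> w * indicator {0<..<norm (f w)} s \<partial>lborel))"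
    unfolding lc by (intro nn_integral_cong nn_integral_cmult[symmetric]) simp
  also have "\<dots> = (\<integral>\<^sup>+s. (\<integral>\<^sub>D w. \<psi> w * indicator {0<..<norm (f w)} s) \<partial>lborel)"
  proof (rule Q.Fubini'[symmetric])
    have "(\<lambda>(w, s). indicator {0<..<norm (f w)} s :: ennreal) = (\<lambda>x. if 0 < snd x \<and> snd x < norm (f (fst x)) then 1 else 0)"
      by (auto simp: indicator_def)
    moreover have "(\<lambda>x. if 0 < snd x \<and> snd x < norm (f (fst x)) then 1 else 0 :: ennreal) \<in> borel_measurable (dA \<Otimes>\<^sub>M lborel)"
      by measurable
    ultimately have [measurable]: "(\<lambda>(w, s). indicator {0<..<norm (f w)} s :: ennreal) \<in> borel_measurable (dA \<Otimes>\<^sub>M lborel)" by simp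
    show "(\<lambda>(w, s). \<psi> w * indicator {0<..<norm (f w)} s) \<in> borel_measurable (dA \<Otimes>\<^sub>M lborel)"
      by measurable
  qed
  also have "\<dots> \<le> (\<integral>\<^sup>+s. ennreal (C * y powr (1 - 1 / q)) * (ennreal (dist_fun f s powr (1 / p)) * indicator {0<..} s) \<partial>lborel)"
  proof (intro nn_integral_mono)
    fix s :: real
    show "(\<integral>\<^sub>D w. \<psi> w * indicator {0<..<norm (f w)} s) \<le> ennreal (C * y powr (1 - 1 / q)) * (ennreal (dist_fun f s powr (1 / p)) * indicator {0<..} s)"
    proof (cases "s > 0")
      case True
      have "(\<integral>\<^sub>D w. \<psi> w * indicator {0<..<norm (f w)} s) = (\<integral>\<^sub>D w. (\<integral>\<^sub>D z. h z w * indicator (E s) w))"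
        unfolding \<psi>_def using True
        by (intro nn_integral_cong) (auto simp: E_def indicator_def nn_integral_multc)
      also have "\<dots> = (\<integral>\<^sub>D z. (\<integral>\<^sub>D w. h z w * indicator (E s) w))"
        by (rule P.Fubini'[symmetric]) measurable
      also have "\<dots> = kernel_form a b c (E s) G"
        unfolding kernel_form_def h_def by (intro nn_integral_cong) (simp add: mult_ac)
      also have "\<dots> \<le> ennreal (C * measure dA (E s) powr (1 / p) * y powr (1 - 1 / q))"
        unfolding y_def by (rule restr) auto
      also have "measure dA (E s) = dist_fun f s" by (simp add: E_def dist_fun_def)
      finally show ?thesis using True C by (simp add: mult_ac flip: ennreal_mult)
    qed (auto simp: indicator_def)
  qed
  also have "\<dots> = ennreal (C * y powr (1 - 1 / q)) * I"
  proof -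
    have "(\<lambda>s. dist_fun f s) \<in> borel_measurable lborel"
    proof -
      have "(\<lambda>s. - dist_fun f s) \<in> borel_measurable borel"
      proof (rule borel_measurable_mono)
        show "mono (\<lambda>s. - dist_fun f s)"
          unfolding dist_fun_def by (intro monoI) (auto intro!: dA.finite_measure_mono simp del: space_dA)
      qed
      from borel_measurable_uminus[OF this] show ?thesis by simp
    qed
    then show ?thesis unfolding I_def by (subst nn_integral_cmult) auto
  qed
  finally have main: "ennreal t * ennreal y \<le> ennreal (C * y powr (1 - 1 / q)) * I"
    by (simp add: y_def dA.emeasure_eq_measure)
  obtain i where i: "I = ennreal i" "0 \<le> i"
    using fin p unfolding LpI by (cases I) (auto simp: ennreal_mult_top)
  have ei: "enn2real (Lp1_norm p f) = p * i" using i p by (simp add: LpI flip: ennreal_mult)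
  have le: "t * y \<le> C * y powr (1 - 1 / q) * i"
    using main i C t by (simp add: y_def flip: ennreal_mult)
  show ?thesis
  proof (cases "y = 0")
    case True
    then show ?thesis using C p by (simp add: y_def G_def)
  next
    case False
    then have y: "y > 0" by (simp add: y_def zero_less_measure_iff)
    have yy: "y = y powr (1 - 1 / q) * y powr (1 / q)" using y by (simp flip: powr_add)
    have "(t * y powr (1 / q)) * y powr (1 - 1 / q) \<le> (C * i) * y powr (1 - 1 / q)"
      using le by (subst (asm) yy) (simp add: mult_ac)
    then have "t * y powr (1 / q) \<le> C * i" using y by simp
    also have "C * i = C / p * enn2real (Lp1_norm p f)" using p by (simp add: ei)
    finally show ?thesis by (simp add: y_def G_def)
  qed
qed

section \<open>Boundedness of both operators\<close>

lemma S_kernel_measurable: "(\<lambda>(z, w). S_kernel b c z w) \<in> borel_measurable (dA \<Otimes>\<^sub>M dA)"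
proof -
  have [measurable]: "fst \<in> borel_measurable (dA \<Otimes>\<^sub>M dA)"
    by (rule measurable_compose[OF measurable_fst measurable_ident_dA])
  have [measurable]: "snd \<in> borel_measurable (dA \<Otimes>\<^sub>M dA)"
    by (rule measurable_compose[OF measurable_snd measurable_ident_dA])
  show ?thesis unfolding S_kernel_def split_beta by measurable
qed

text \<open>The principal power is continuous only off the negative real axis. As
  \<open>1 - z * cnj w\<close> lies in the right half-plane, the power may be cut off there before
  measurability is used.\<close>

lemma T_kernel_measurable: "(\<lambda>(z, w). T_kernel b c z w) \<in> borel_measurable (dA \<Otimes>\<^sub>M dA)"
proof -
  have [measurable]: "fst \<in> borel_measurable (dA \<Otimes>\<^sub>M dA)"
    by (rule measurable_compose[OF measurable_fst measurable_ident_dA])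
  have [measurable]: "snd \<in> borel_measurable (dA \<Otimes>\<^sub>M dA)"
    by (rule measurable_compose[OF measurable_snd measurable_ident_dA])
  let ?H = "{x::complex. 0 < Re x}"
  have "open ?H" by (rule open_halfspace_Re_gt)
  then have "?H \<in> sets borel" by simp
  moreover have "continuous_on ?H (\<lambda>x. x powr complex_of_real c)"
    by (intro continuous_intros) (auto simp: complex_nonpos_Reals_iff)
  ultimately have [measurable]: "(\<lambda>x. indicator ?H x *\<^sub>R (x powr complex_of_real c)) \<in> borel_measurable borel"
    by (rule borel_measurable_continuous_on_indicator)
  have "(\<lambda>x. complex_of_real ((1 - (norm (snd x))\<^sup>2) powr b) / (\<lambda>x. indicator ?H x *\<^sub>R (x powr complex_of_real c)) (1 - fst x * cnj (snd x)))
      \<in> borel_measurable (dA \<Otimes>\<^sub>M dA)" by measurable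
  also have "?this \<longleftrightarrow> ?thesis"
  proof (rule measurable_cong)
    fix x assume "x \<in> space (dA \<Otimes>\<^sub>M dA)"
    then have "0 < Re (1 - fst x * cnj (snd x))"
      by (intro one_minus_mult_cnj_bounds) (auto simp: space_pair_measure)
    then show "complex_of_real ((1 - (norm (snd x))\<^sup>2) powr b) / (\<lambda>x. indicator ?H x *\<^sub>R (x powr complex_of_real c)) (1 - fst x * cnj (snd x))
       = (case x of (z, w) \<Rightarrow> T_kernel b c z w)"
      by (simp add: split_beta T_kernel_def)
  qed
  finally show ?thesis .
qed

text \<open>For a real exponent the modulus of the power does not see the branch, so both operators
  share one majorant.\<close>

lemma norm_kernels:
  "norm (S_kernel b c z w) = rho w powr b * abs_kernel c z w"
  "norm (T_kernel b c z w) = rho w powr b * abs_kernel c z w"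
  by (simp_all add: S_kernel_def T_kernel_def rho_def norm_divide norm_mult norm_powr_real_powr' powr_minus_divide del: of_real_divide of_real_mult)

lemma weak_type_imp_T_S_bounded:
  assumes "q > 0" "C \<ge> 0" and "\<And>f t. f \<in> borel_measurable dA \<Longrightarrow> NX f < \<infinity> \<Longrightarrow> t > 0 \<Longrightarrow>
      t * measure dA {z \<in> space dA. ennreal t < majorant a b c f z} powr (1 / q) \<le> C * enn2real (NX f)"
  shows "T_bounded a b c NX (Lweak_norm (ereal q)) \<and> S_bounded a b c NX (Lweak_norm (ereal q))"
  unfolding T_bounded_def S_bounded_def
  using weak_type_imp_maps_boundedly[OF T_kernel_measurable _ assms]
    weak_type_imp_maps_boundedly[OF S_kernel_measurable _ assms]
  by (simp add: norm_kernels)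

lemma Lp_norm_bound_imp:
  assumes p: "1 \<le> p" and fin: "Lp_norm (ereal p) f < \<infinity>" and N: "enn2real (Lp_norm (ereal p) f) < N"
  shows "Lp_integral p f \<le> ennreal (N powr p)"
proof -
  define I where "I = (Lp_integral p f)"
  have I: "I \<noteq> \<infinity>" using fin by (auto simp: Lp_norm_def I_def Let_def)
  then have "enn2real (Lp_norm (ereal p) f) = enn2real I powr (1 / p)"
    by (simp add: Lp_norm_def I_def Let_def)
  then have "(enn2real I powr (1 / p)) powr p \<le> N powr p"
    using N p by (intro powr_mono2) auto
  then have "enn2real I \<le> N powr p" using p by (simp add: powr_powr)
  have "I = ennreal (enn2real I)" using I by (simp add: less_top)
  also have "\<dots> \<le> ennreal (N powr p)" by (rule ennreal_leI) fact
  finally show ?thesis by (simp add: I_def)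
qed

text \<open>The distribution estimates require \<open>N > 0\<close>, while the norm of
  \<open>f\<close> may vanish; hence the norm is approached from above.\<close>

lemma distribution_bound_imp_Lp_weak_type:
  assumes p: "1 \<le> p" and q: "q > 0" and C: "C \<ge> 0"
    and bd: "\<And>N. N > 0 \<Longrightarrow> (Lp_integral p f) \<le> ennreal (N powr p) \<Longrightarrow> m \<le> C * (N / t) powr q"
    and m: "m \<ge> 0" and fin: "Lp_norm (ereal p) f < \<infinity>" and t: "t > 0"
  shows "t * m powr (1 / q) \<le> C powr (1 / q) * enn2real (Lp_norm (ereal p) f)"
proof -
  let ?n = "enn2real (Lp_norm (ereal p) f)"
  have *: "t * m powr (1 / q) \<le> C powr (1 / q) * N" if N: "?n < N" for N
  proof -
    have N0: "N > 0" using N enn2real_nonneg[of "Lp_norm (ereal p) f"] by linarith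
    have "m \<le> C * (N / t) powr q" by (rule bd[OF N0 Lp_norm_bound_imp[OF p fin N]])
    then have "m powr (1 / q) \<le> (C * (N / t) powr q) powr (1 / q)" using m q by (intro powr_mono2) auto
    also have "\<dots> = C powr (1 / q) * (N / t)" using C N0 t q by (simp add: powr_mult powr_powr)
    finally show ?thesis using t by (simp add: field_simps)
  qed
  have "((\<lambda>N. C powr (1 / q) * N) \<longlongrightarrow> C powr (1 / q) * ?n) (at_right ?n)"
    by (intro tendsto_intros)
  then show ?thesis
    by (rule tendsto_lowerbound) (use * in \<open>auto simp: eventually_at_right_less eventually_at_filter\<close>)
qed

text \<open>For \<open>p > 1 / d\<close> Schur's test works with \<open>k = 0\<close>, with no loss
  in \<open>z\<close>; the resulting weak exponent \<open>- 1 / a\<close> is that of the function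
  \<open>rho powr a\<close> itself.\<close>

lemma Lp_bounded_large_exponent:
  assumes c: "c > 1" and d: "0 < 2 - c + b" "2 - c + b < 1" and a: "- a > 2 - c + b"
    and p: "(2 - c + b) * p > 1"
  shows "T_bounded a b c (Lp_norm (ereal p)) (Lweak_norm (ereal (- 1 / a))) \<and>
    S_bounded a b c (Lp_norm (ereal p)) (Lweak_norm (ereal (- 1 / a)))"
proof -
  define d where "d = 2 - c + b"
  note dd = d[folded d_def] a[folded d_def] p[folded d_def]
  obtain m' M where kb: "kernel_bounds c m' M" using kernel_bounds_exist[OF c] by blast
  then interpret kernel_bounds c m' M .
  note M = M_pos and low = radial_low and high = radial_high
  have p1: "p > 1"
  proof -
    have "p > 0" using dd by (metis mult_nonneg_nonpos less_eq_real_def linorder_not_less not_one_less_zero order_trans)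
    then have "d * p < 1 * p" using dd by (intro mult_strict_right_mono) auto
    then show ?thesis using dd by linarith
  qed
  have a0: "a < 0" using dd by linarith
  define q where "q = - 1 / a"
  have q: "q > 0" using a0 by (simp add: q_def)
  \<comment> \<open>Chosen so that \<open>b + g * (p - 1) = c - 1\<close>, the largest value of
    \<open>l\<close> that \<open>radial_high\<close> admits. The requirement \<open>g < d\<close> of
    the first test is equivalent to \<open>d * p > 1\<close>.\<close>
  define g where "g = (1 - d) / (p - 1)"
  have gp: "g * (p - 1) = 1 - d" using p1 by (simp add: g_def)
  have gd: "g < d" using p1 dd by (simp add: g_def field_simps)
  have ap: "a * p < - 1"
  proof -
    have "d * p < - a * p" using dd p1 by (intro mult_strict_right_mono) auto
    then show ?thesis using dd by simp
  qed
  define C0 C1 where "C0 = M / (d - g)" and "C1 = M / (- 1 - a * p)"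
  have C: "C0 > 0" "C1 \<ge> 0" using M gd ap by (simp_all add: C0_def C1_def)
  have weak: "measure dA {z \<in> space dA. ennreal t < majorant a b c f z} \<le> (1 + 2 * (2 * C0) powr (p - 1) * C1) * (N / t) powr q"
    if f: "f \<in> borel_measurable dA" and N: "N > 0" and t: "t > 0"
      and fN: "Lp_integral p f \<le> ennreal (N powr p)" for f N t
  proof (rule schur_weak_type[where k = 0 and g = g, OF _ q C _ _ f N t fN])
    fix z :: complex assume z: "z \<in> ball 0 1"
    have "(\<integral>\<^sub>D w. ennreal (rho w powr (b - g) * abs_kernel c z w)) =
      (\<integral>\<^sub>D w. ennreal (rho w powr (b - g) * abs_kernel c z w) * indicator {w. rho w \<le> 1} w)"
      by (intro nn_integral_cong) (auto simp: rho_bounds)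
    also have "\<dots> \<le> ennreal (C0 * rho z powr (- 0))"
      using low[OF z, of 1 0 "b - g"] c gd by (simp add: C0_def d_def algebra_simps)
    finally show "(\<integral>\<^sub>D w. ennreal (rho w powr (b - g) * abs_kernel c z w)) \<le> ennreal (C0 * rho z powr (- 0))" .
  next
    fix w :: complex and x :: real assume w: "w \<in> ball 0 1" and x: "0 < x"
    have e1: "1 - p / q = a * p + 1" using a0 by (simp add: q_def)
    have e2: "b + g * (p - 1) = c - 1" by (simp add: gp d_def)
    show "(\<integral>\<^sub>D z. ennreal (rho z powr (a * p - 0 * (p - 1)) * abs_kernel c w z) * indicator {z. x \<le> rho z} z)
       \<le> ennreal (C1 * rho w powr (- (b + g * (p - 1))) * x powr (1 - p / q))"
      unfolding e1 e2 using high[OF w x, of "c - 1" "a * p"] c ap by (simp add: C1_def add.commute)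
  qed (use p1 in simp)
  have "T_bounded a b c (Lp_norm (ereal p)) (Lweak_norm (ereal q)) \<and>
    S_bounded a b c (Lp_norm (ereal p)) (Lweak_norm (ereal q))"
    using p1 q C
    by (intro weak_type_imp_T_S_bounded[OF q, of "(1 + 2 * (2 * C0) powr (p - 1) * C1) powr (1 / q)"]
      distribution_bound_imp_Lp_weak_type weak) auto
  then show ?thesis by (simp add: q_def)
qed

text \<open>In the range \<open>d < 1 / p < b + 1\<close> all exponents in Schur's test follow from
  homogeneity, and \<open>s\<close> enters as the gain \<open>x powr (- s * p)\<close> in the second
  test.\<close>

lemma Lp_bounded_small_exponent:
  assumes c: "c > 1" and d: "0 < 2 - c + b" and s: "0 < c - a - b - 2"
    and p: "p > 0" "2 - c + b < 1 / p" "1 / p < b + 1" "b < 0" and q: "1 / q = 1 / p + (c - a - b - 2)"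
  shows "T_bounded a b c (Lp_norm (ereal p)) (Lweak_norm (ereal q)) \<and>
    S_bounded a b c (Lp_norm (ereal p)) (Lweak_norm (ereal q))"
proof -
  define d where "d = 2 - c + b"
  define s where "s = c - a - b - 2"
  note dd = d[folded d_def] s[folded s_def] p[folded d_def] q[folded s_def]
  obtain m' M where kb: "kernel_bounds c m' M" using kernel_bounds_exist[OF c] by blast
  then interpret kernel_bounds c m' M .
  note M = M_pos and low = radial_low and high = radial_high
  have q0: "q > 0"
  proof -
    have "1 / q > 0" unfolding dd(7) using dd by simp
    then show ?thesis by (simp add: zero_less_divide_iff)
  qed
  have p1: "p > 1"
  proof -
    have "1 / p < 1" using dd by linarith
    then show ?thesis using p by (simp add: divide_less_eq_1)
  qed
  \<comment> \<open>The first test is split at \<open>rho w = rho z\<close>: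
    \<open>g < b + 1\<close> gives convergence below that level and \<open>g > d\<close> decay above
    it. Both parts are of size \<open>rho z powr (- k)\<close>.\<close>
  define g where "g = 1 / p"
  have gp: "g * p = 1" using p1 by (simp add: g_def)
  note gg = dd(4,5)[folded g_def]
  define k where "k = g - d"
  define C0 C1 where "C0 = M / (b + 1 - g) + M / (g - d)" and "C1 = M / (s * p)"
  have C: "C0 > 0" "C1 \<ge> 0" using M gg dd p1 by (auto simp: C0_def C1_def intro!: add_pos_pos)
  have pq: "1 - p / q = - s * p"
  proof -
    have "p / q = p * (1 / q)" by simp
    also have "\<dots> = 1 + s * p" unfolding dd(7) using p by (simp add: field_simps)
    finally show ?thesis by simp
  qed
  have weak: "measure dA {z \<in> space dA. ennreal t < majorant a b c f z} \<le> (1 + 2 * (2 * C0) powr (p - 1) * C1) * (N / t) powr q"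
    if f: "f \<in> borel_measurable dA" and N: "N > 0" and t: "t > 0"
      and fN: "Lp_integral p f \<le> ennreal (N powr p)" for f N t
  proof (rule schur_weak_type[where k = k and g = g, OF _ q0 C _ _ f N t fN])
    fix z :: complex assume z: "z \<in> ball 0 1"
    let ?F = "\<lambda>w. ennreal (rho w powr (b - g) * abs_kernel c z w)"
    have rz: "rho z > 0" using rho_bounds(1) z by auto
    have "(\<integral>\<^sub>D w. ?F w) \<le> (\<integral>\<^sub>D w. ?F w * indicator {w. rho w \<le> rho z} w + ?F w * indicator {w. rho z \<le> rho w} w)"
      by (intro nn_integral_mono) (auto simp: indicator_def)
    also have "\<dots> = (\<integral>\<^sub>D w. ?F w * indicator {w. rho w \<le> rho z} w) + (\<integral>\<^sub>D w. ?F w * indicator {w. rho z \<le> rho w} w)"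
      by (rule nn_integral_add) measurable
    also have "\<dots> \<le> ennreal (M / (b + 1 - g) * rho z powr (- k)) + ennreal (M / (g - d) * rho z powr (- k))"
    proof (intro add_mono)
      have e: "b - g + (c - 1) + 2 - c = b + 1 - g" by simp
      have "rho z powr (- (c - 1)) * rho z powr (b + 1 - g) = rho z powr (- k)"
        by (simp add: k_def d_def algebra_simps flip: powr_add)
      then have "M / (b + 1 - g) * rho z powr (- k) = M * rho z powr (- (c - 1)) * (rho z powr (b - g + (c - 1) + 2 - c) / (b - g + (c - 1) + 2 - c))"
        unfolding e by simp
      then show "(\<integral>\<^sub>D w. ?F w * indicator {w. rho w \<le> rho z} w) \<le> ennreal (M / (b + 1 - g) * rho z powr (- k))"
        using low[OF z, of "rho z" "c - 1" "b - g"] rz c gg by simp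
      show "(\<integral>\<^sub>D w. ?F w * indicator {w. rho z \<le> rho w} w) \<le> ennreal (M / (g - d) * rho z powr (- k))"
        using high[OF z rz, of 0 "b - g"] rz c gg by (simp add: k_def d_def algebra_simps)
    qed
    also have "\<dots> = ennreal (C0 * rho z powr (- k))"
      using M gg by (simp add: C0_def distrib_right flip: ennreal_plus)
    finally show "(\<integral>\<^sub>D w. ?F w) \<le> ennreal (C0 * rho z powr (- k))" .
  next
    fix w :: complex and x :: real assume w: "w \<in> ball 0 1" and x: "0 < x"
    \<comment> \<open>\<open>m = b + 1 - g\<close> lies between 0 and \<open>c - 1\<close> by
      \<open>d < g < b + 1\<close>, so it is admissible as \<open>l\<close>.\<close>
    define m where "m = b + g * (p - 1)"
    define e where "e = a * p - k * (p - 1)"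
    have m: "m = b + 1 - g" using gp by (simp add: m_def algebra_simps)
    have e: "e + m + 2 - c = - s * p"
      using gp unfolding e_def m_def k_def d_def s_def by (simp add: algebra_simps)
    have e2: "c - 2 - e - m = s * p" using e by simp
    have "(\<integral>\<^sub>D z. ennreal (rho z powr e * abs_kernel c w z) * indicator {z. x \<le> rho z} z)
       \<le> ennreal (M * rho w powr (- m) * (x powr (e + m + 2 - c) / (c - 2 - e - m)))"
    proof (rule high[OF w x])
      show "0 \<le> m" using gg m by linarith
      show "m \<le> c - 1" using gg m by (simp add: d_def)
      show "e + m + 2 - c < 0" unfolding e using dd p1 by simp
    qed
    then show "(\<integral>\<^sub>D z. ennreal (rho z powr (a * p - k * (p - 1)) * abs_kernel c w z) * indicator {z. x \<le> rho z} z)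
       \<le> ennreal (C1 * rho w powr (- (b + g * (p - 1))) * x powr (1 - p / q))"
      unfolding e e2 unfolding pq C1_def e_def m_def by simp
  qed (use p1 in simp)
  show ?thesis
    using p1 q0 C
    by (intro weak_type_imp_T_S_bounded[OF q0, of "(1 + 2 * (2 * C0) powr (p - 1) * C1) powr (1 / q)"]
      distribution_bound_imp_Lp_weak_type weak) auto
qed

lemma Lorentz_bounded_kernel_endpoint:
  assumes c: "c > 1" and d: "0 < 2 - c + b" "2 - c + b < 1" and a: "- a > 2 - c + b" "-1 < a"
  shows "T_bounded a b c (Lp1_norm (1 / (2 - c + b))) (Lweak_norm (ereal (- 1 / a))) \<and>
    S_bounded a b c (Lp1_norm (1 / (2 - c + b))) (Lweak_norm (ereal (- 1 / a)))"
proof -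
  obtain C where C: "0 \<le> C" and restr: "\<And>E G. E \<in> sets dA \<Longrightarrow> G \<in> sets dA \<Longrightarrow>
    kernel_form a b c E G \<le> ennreal (C * measure dA E powr (b + 2 - c) * measure dA G powr (1 + a))"
    using kernel_form_restricted_bound[of c a b] assms by (auto simp: algebra_simps)
  have a0: "a < 0" using a d by linarith
  have p: "0 < 1 / (2 - c + b)" using d by simp
  have q: "0 < - 1 / a" using a0 by simp
  have e: "1 / (1 / (2 - c + b)) = b + 2 - c" "1 - 1 / (- 1 / a) = 1 + a" using a0 by simp_all
  have restr': "kernel_form a b c E G \<le> ennreal (C * measure dA E powr (1 / (1 / (2 - c + b))) * measure dA G powr (1 - 1 / (- 1 / a)))"
    if "E \<in> sets dA" "G \<in> sets dA" for E G unfolding e by (rule restr[OF that])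
  show ?thesis
    by (rule weak_type_imp_T_S_bounded[OF q _ restricted_imp_Lorentz_weak_type[OF p q C restr']])
       (use C d in auto)
qed

text \<open>The restricted bound for the adjoint, with \<open>a\<close> and \<open>b\<close>
  exchanged; its hypothesis \<open>- b > a + 2 - c\<close> is once more
  \<open>s > 0\<close>.\<close>

lemma Lorentz_bounded_integrability_endpoint:
  assumes c: "c > 1" and d: "0 < a + 2 - c" "a + 2 - c < 1" and b: "- b > a + 2 - c" "-1 < b"
    and q: "0 < q" "c - 1 - a \<le> 1 / q"
  shows "T_bounded a b c (Lp1_norm (1 / (b + 1))) (Lweak_norm (ereal q)) \<and>
    S_bounded a b c (Lp1_norm (1 / (b + 1))) (Lweak_norm (ereal q))"
proof -
  obtain C where C: "0 \<le> C" and restr: "\<And>E G. E \<in> sets dA \<Longrightarrow> G \<in> sets dA \<Longrightarrow>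
    kernel_form b a c E G \<le> ennreal (C * measure dA E powr (a + 2 - c) * measure dA G powr (1 + b))"
    using kernel_form_restricted_bound[of c b a] assms by auto
  have p: "0 < 1 / (b + 1)" using b by simp
  have restr': "kernel_form a b c E G \<le> ennreal (C * measure dA E powr (1 / (1 / (b + 1))) * measure dA G powr (1 - 1 / q))"
    if EG: "E \<in> sets dA" "G \<in> sets dA" for E G
  proof -
    have "kernel_form a b c E G = kernel_form b a c G E" by (rule kernel_form_commute[OF EG])
    also have "\<dots> \<le> ennreal (C * measure dA G powr (a + 2 - c) * measure dA E powr (1 + b))"
      by (rule restr[OF EG(2,1)])
    \<comment> \<open>As \<open>|G| <= 1\<close>, the exponent may be lowered from
      \<open>a + 2 - c\<close> to \<open>1 - 1 / q\<close>. One restricted bound thus serves the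
      whole range of \<open>q\<close>.\<close>
    also have "\<dots> \<le> ennreal (C * measure dA G powr (1 - 1 / q) * measure dA E powr (1 + b))"
      using q C by (intro ennreal_leI mult_right_mono mult_left_mono powr_mono') auto
    finally show ?thesis by (simp add: mult_ac add.commute)
  qed
  show ?thesis
    by (rule weak_type_imp_T_S_bounded[OF q(1) _ restricted_imp_Lorentz_weak_type[OF p q(1) C restr']])
       (use C b in auto)
qed

lemma maps_boundedly_domain_mono:
  assumes "maps_boundedly a K NX NY" and "\<And>f. f \<in> borel_measurable dA \<Longrightarrow> NX f \<le> NX' f"
  shows "maps_boundedly a K NX' NY"
  using assms unfolding maps_boundedly_def
  by (meson mult_left_mono order_trans le_less_trans zero_le)

lemma Lp_norm_le_Linf_norm:
  assumes p: "1 \<le> p" and [measurable]: "f \<in> borel_measurable dA"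
  shows "Lp_norm (ereal p) f \<le> Linf_norm f"
proof (cases "Linf_norm f")
  case (real r)
  have "AE w in dA. ennreal (norm (f w)) \<le> Linf_norm f" unfolding Linf_norm_def by (rule esssup_AE)
  then have AE: "AE w in dA. norm (f w) \<le> r" using real by simp
  have "Lp_integral p f \<le> (\<integral>\<^sub>D w. ennreal (r powr p))"
    using AE p by (intro nn_integral_mono_AE) (auto elim!: eventually_mono intro!: ennreal_leI powr_mono2)
  also have "\<dots> = ennreal (r powr p)" by (simp add: dA.emeasure_space_1[unfolded space_dA])
  finally have le: "Lp_integral p f \<le> ennreal (r powr p)" .
  then have "enn2real (Lp_integral p f) \<le> r powr p"
    by (intro enn2real_leI) auto
  then have "enn2real (Lp_integral p f) powr (1 / p) \<le> (r powr p) powr (1 / p)"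
    using p by (intro powr_mono2) auto
  then have "enn2real (Lp_integral p f) powr (1 / p) \<le> r"
    using p real by (simp add: powr_powr)
  moreover have "Lp_integral p f \<noteq> top" using le by (auto simp: top_unique)
  ultimately show ?thesis using real by (auto simp: Lp_norm_def Let_def intro!: ennreal_leI)
qed simp

lemma Linf_bounded:
  assumes c: "c > 1" and d: "0 < 2 - c + b" "2 - c + b < 1" and a: "- a > 2 - c + b"
  shows "T_bounded a b c (Lp_norm \<infinity>) (Lweak_norm (ereal (- 1 / a))) \<and>
    S_bounded a b c (Lp_norm \<infinity>) (Lweak_norm (ereal (- 1 / a)))"
proof -
  \<comment> \<open>Any finite exponent above \<open>1 / d\<close> would do, since the supremum norm
    dominates the \<open>Lp\<close> norms on a probability space.\<close>
  define p where "p = 2 / (2 - c + b)"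
  have p: "(2 - c + b) * p > 1" "1 \<le> p" using d by (auto simp: p_def field_simps)
  have "Lp_norm (ereal p) f \<le> Lp_norm \<infinity> f" if "f \<in> borel_measurable dA" for f
    using Lp_norm_le_Linf_norm[OF p(2) that] by (simp add: Lp_norm_def)
  with Lp_bounded_large_exponent[OF c d a p(1)] show ?thesis
    unfolding T_bounded_def S_bounded_def by (auto intro: maps_boundedly_domain_mono)
qed

section \<open>The endpoint for the analytic kernel\<close>

text \<open>The moment is the Beta integral B(2 * c - 2, n + 1), of order n^(2 - 2 c), and the
  squared coefficient has order n^(2 c - 2). The weight exponent \<open>2 * c - 3\<close> is the one
  for which the orders balance; it exceeds -1 because \<open>c > 1\<close>.\<close>

lemma bcoeff_moment_bounded:
  assumes c: "c > 1"
  obtains K where "K > 0"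
    "\<And>n. (bcoeff c n)\<^sup>2 * (LINT w|dA. rho w powr (2 * c - 3) * (norm w) ^ (2 * n)) \<le> K"
    "integrable dA (\<lambda>w. rho w powr (2 * c - 3))"
proof -
  have moment: "(\<integral>\<^sub>D w. ennreal (rho w powr (2 * c - 3) * (norm w) ^ (2 * n))) = ennreal (1 / ((2 * c - 2) * bcoeff (2 * c - 1) n))" for n
  proof -
    let ?B = "Beta (2 * c - 2) (real n + 1)"
    have "(\<integral>\<^sub>D w. ennreal (rho w powr (2 * c - 3) * (norm w) ^ (2 * n))) =
      (\<integral>\<^sub>D w. (\<lambda>t. ennreal (t powr (2 * c - 3) * (1 - t) ^ n)) (rho w))"
      by (intro nn_integral_cong) (simp add: rho_def power_mult)
    also have "\<dots> = (\<integral>\<^sup>+t. ennreal (t powr (2 * c - 3) * (1 - t) ^ n) * indicator {0<..<1} t \<partial>lborel)"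
      by (rule nn_integral_dA_rho) measurable
    also have "\<dots> = (\<integral>\<^sup>+t. ennreal (t powr (2 * c - 2 - 1) * (1 - t) powr (real n + 1 - 1)) * indicator {0..1} t \<partial>lborel)"
    proof (rule nn_integral_cong_AE)
      have "AE t in lborel. t \<noteq> (0::real) \<and> t \<noteq> 1"
        by (intro AE_conjI AE_lborel_singleton)
      then show "AE t in lborel. ennreal (t powr (2 * c - 3) * (1 - t) ^ n) * indicator {0<..<1} t =
         ennreal (t powr (2 * c - 2 - 1) * (1 - t) powr (real n + 1 - 1)) * indicator {0..1::real} t"
        by eventually_elim (auto simp: indicator_def powr_realpow)
    qed
    also have "\<dots> = ennreal ?B"
      using has_integral_Beta_real[of "2 * c - 2" "real n + 1"] c
      by (intro nn_integral_has_integral_lebesgue') auto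
    also have "?B = 1 / ((2 * c - 2) * bcoeff (2 * c - 1) n)"
    proof -
      have g: "Gamma (2 * c - 2) > 0" using c by (intro Gamma_real_pos) auto
      have "Gamma (2 * c - 2 + 1) = (2 * c - 2) * Gamma (2 * c - 2)"
        using c by (intro Gamma_plus1) (auto elim!: nonpos_Ints_cases)
      then have 1: "Gamma (2 * c - 1) = (2 * c - 2) * Gamma (2 * c - 2)" by simp
      have "2 * c - 1 \<notin> \<int>\<^sub>\<le>\<^sub>0" using c by (auto elim!: nonpos_Ints_cases)
      then have "pochhammer (2 * c - 1) n = Gamma (2 * c - 1 + real n) / Gamma (2 * c - 1)"
        by (rule pochhammer_Gamma)
      moreover have "Gamma (2 * c - 1) > 0" using c by (intro Gamma_real_pos) auto
      ultimately have G: "Gamma (2 * c - 1 + real n) = pochhammer (2 * c - 1) n * Gamma (2 * c - 1)" by simp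
      have e: "2 * c - 2 + (real n + 1) = 2 * c - 1 + real n" by simp
      have 2: "Gamma (2 * c - 2 + (real n + 1)) = pochhammer (2 * c - 1) n * ((2 * c - 2) * Gamma (2 * c - 2))"
        unfolding e G 1 ..
      have "Gamma (real n + 1) = fact n" using Gamma_fact[of n, where 'a = real] by (simp add: add.commute)
      then show ?thesis unfolding Beta_def 2 using less_imp_neq[OF g] c by (simp add: bcoeff_def)
    qed
    finally show ?thesis .
  qed
  have int0: "integrable dA (\<lambda>w. rho w powr (2 * c - 3) * (norm w) ^ (2 * n))" for n
    by (rule integrableI_nonneg) (auto simp: moment)
  have L: "(LINT w|dA. rho w powr (2 * c - 3) * (norm w) ^ (2 * n)) = 1 / ((2 * c - 2) * bcoeff (2 * c - 1) n)" for n
    using c bcoeff_pos[of "2 * c - 1" n] by (subst integral_eq_nn_integral) (auto simp: moment)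
  obtain m1 M1 where 1: "0 < M1" "\<And>n. bcoeff c n \<le> M1 * real (Suc n) powr (c - 1)"
    using bcoeff_bounds[of c] c by (metis less_trans zero_less_one)
  obtain m2 M2 where 2: "0 < m2" "\<And>n. m2 * real (Suc n) powr (2 * c - 1 - 1) \<le> bcoeff (2 * c - 1) n"
  proof -
    have "2 * c - 1 > 0" using c by simp
    then show ?thesis using bcoeff_bounds[of "2 * c - 1"] that by metis
  qed
  show ?thesis
  proof (rule that[of "M1\<^sup>2 / ((2 * c - 2) * m2)"])
    show "0 < M1\<^sup>2 / ((2 * c - 2) * m2)" using 1 2 c by simp
    show "integrable dA (\<lambda>w. rho w powr (2 * c - 3))" using int0[of 0] by simp
    fix n
    have "(bcoeff c n)\<^sup>2 \<le> (M1 * real (Suc n) powr (c - 1))\<^sup>2"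
      using 1 bcoeff_pos[of c n] c by (intro power_mono) auto
    also have "\<dots> = M1\<^sup>2 / m2 * (m2 * real (Suc n) powr (2 * c - 1 - 1))"
      using 2 by (simp add: power_mult_distrib power2_eq_square powr_add[symmetric] del: of_nat_Suc)
    also have "\<dots> \<le> M1\<^sup>2 / m2 * bcoeff (2 * c - 1) n"
      using 2 by (intro mult_left_mono) auto
    finally have "(bcoeff c n)\<^sup>2 * (1 / ((2 * c - 2) * bcoeff (2 * c - 1) n)) \<le> M1\<^sup>2 / m2 * bcoeff (2 * c - 1) n * (1 / ((2 * c - 2) * bcoeff (2 * c - 1) n))"
      using c bcoeff_pos[of "2 * c - 1" n] by (intro mult_right_mono) auto
    also have "\<dots> = M1\<^sup>2 / ((2 * c - 2) * m2)" using bcoeff_pos[of "2 * c - 1" n] c by simp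
    finally show "(bcoeff c n)\<^sup>2 * (LINT w|dA. rho w powr (2 * c - 3) * (norm w) ^ (2 * n)) \<le> M1\<^sup>2 / ((2 * c - 2) * m2)"
      by (simp add: L)
  qed
qed

lemma T_kernel_sums:
  assumes "z \<in> ball 0 1" "w \<in> ball 0 1"
  shows "(\<lambda>n. of_real (bcoeff c n) * z ^ n * (of_real (rho w powr b) * cnj w ^ n)) sums T_kernel b c z w"
proof -
  have "(\<lambda>n. of_real (rho w powr b) * (of_real (bcoeff c n) * (z * cnj w) ^ n)) sums (of_real (rho w powr b) * (1 - z * cnj w) powr (- of_real c))"
    by (intro sums_mult bcoeff_sums one_minus_mult_cnj_bounds assms)
  then show ?thesis
    by (simp add: T_kernel_def rho_def powr_minus_divide power_mult_distrib mult_ac)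
qed

text \<open>For fixed \<open>z\<close> the kernel is at most
  \<open>(1 - norm z) powr (- c) * rho w powr b\<close>, so a single condition on \<open>f\<close>
  gives absolute convergence at every point of the disc.\<close>

lemma weight_integrable_imp_kernel_integrable:
  fixes f :: "complex \<Rightarrow> complex"
  assumes K_meas: "(\<lambda>(z, w). K z w) \<in> borel_measurable (dA \<Otimes>\<^sub>M dA)"
    and K_norm: "\<And>z w. norm (K z w) = rho w powr b * abs_kernel c z w"
    and c: "0 \<le> c" and z: "z \<in> ball 0 1"
    and [measurable]: "f \<in> borel_measurable dA" and int: "integrable dA (\<lambda>w. of_real (rho w powr b) * f w)"
  shows "integrable dA (\<lambda>w. K z w * f w)"
proof (rule Bochner_Integration.integrable_bound)
  show "integrable dA (\<lambda>w. (1 - norm z) powr (- c) *\<^sub>R (of_real (rho w powr b) * f w))"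
    using int by (intro integrable_scaleR_right)
  have "(\<lambda>w. K z w) \<in> borel_measurable dA"
    using measurable_Pair2[OF K_meas, of z] z by simp
  then show "(\<lambda>w. K z w * f w) \<in> borel_measurable dA" by measurable
  show "AE w in dA. norm (K z w * f w) \<le> norm ((1 - norm z) powr (- c) *\<^sub>R (of_real (rho w powr b) * f w))"
  proof (rule AE_I2)
    fix w assume "w \<in> space dA"
    then have "abs_kernel c z w \<le> (1 - norm z) powr (- c)"
      using z c one_minus_mult_cnj_bounds(1)[OF z, of w] by (intro powr_mono2') auto
    then have "rho w powr b * abs_kernel c z w * norm (f w) \<le> rho w powr b * (1 - norm z) powr (- c) * norm (f w)"
      by (intro mult_right_mono mult_left_mono) auto
    then show "norm (K z w * f w) \<le> norm ((1 - norm z) powr (- c) *\<^sub>R (of_real (rho w powr b) * f w))"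
      using z by (simp add: norm_mult K_norm mult_ac)
  qed
qed

text \<open>Without the factor \<open>rho z powr a\<close> the output is holomorphic, and its Taylor
  coefficients are weighted moments of \<open>f\<close>. Termwise integration is justified by the
  convergence of \<open>bcoeff c n * norm z ^ n\<close> for \<open>norm z < 1\<close>.\<close>

lemma T_integral_power_series:
  fixes f :: "complex \<Rightarrow> complex"
  assumes c: "c > 0" and z: "z \<in> ball 0 1"
    and [measurable]: "f \<in> borel_measurable dA" and int: "integrable dA (\<lambda>w. of_real (rho w powr b) * f w)"
  shows "(\<lambda>n. of_real (bcoeff c n) * (LINT w|dA. of_real (rho w powr b) * cnj w ^ n * f w) * z ^ n) sums
    (T_integral b c f z)"
proof -
  let ?g = "\<lambda>n w. of_real (bcoeff c n) * z ^ n * (of_real (rho w powr b) * cnj w ^ n * f w)"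
  have z1: "norm z < 1" using z by simp
  have I: "integrable dA (\<lambda>w. of_real (rho w powr b) * cnj w ^ n * f w)" for n
  proof (rule Bochner_Integration.integrable_bound[OF int])
    show "AE w in dA. norm (of_real (rho w powr b) * cnj w ^ n * f w) \<le> norm (of_real (rho w powr b) * f w)"
      by (rule AE_I2) (auto simp: norm_mult norm_power power_le_one mult_left_le intro!: mult_right_mono)
  qed measurable
  have nb: "norm (?g n w) \<le> bcoeff c n * norm z ^ n * norm (of_real (rho w powr b) * f w)" if "w \<in> space dA" for n w
  proof -
    have "norm (?g n w) = (bcoeff c n * norm z ^ n * norm (of_real (rho w powr b) * f w)) * norm w ^ n"
      using bcoeff_pos[OF c, of n] by (simp add: norm_mult norm_power mult_ac)
    also have "\<dots> \<le> bcoeff c n * norm z ^ n * norm (of_real (rho w powr b) * f w)"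
      using that bcoeff_pos[OF c, of n] by (intro mult_left_le) (auto simp: power_le_one norm_mult)
    finally show ?thesis .
  qed
  have sm: "summable (\<lambda>n. bcoeff c n * norm z ^ n)"
    using bcoeff_sums_real[of "norm z" c] z1 by (auto simp: sums_iff)
  have s1: "(\<lambda>n. integral\<^sup>L dA (?g n)) sums (LINT w|dA. (\<Sum>n. ?g n w))"
  proof (rule sums_integral)
    show "integrable dA (?g n)" for n by (intro integrable_mult_right I)
    show "AE w in dA. summable (\<lambda>n. norm (?g n w))"
    proof (rule AE_I2)
      fix w assume w: "w \<in> space dA"
      show "summable (\<lambda>n. norm (?g n w))"
        by (rule summable_comparison_test[OF _ summable_mult2[OF sm, of "norm (of_real (rho w powr b) * f w)"]])
           (use nb[OF w] in auto)
    qed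
    show "summable (\<lambda>n. LINT w|dA. norm (?g n w))"
    proof (rule summable_comparison_test[OF _ summable_mult2[OF sm, of "LINT w|dA. norm (of_real (rho w powr b) * f w)"]], intro exI allI impI)
      fix n
      have "(LINT w|dA. norm (?g n w)) \<le> (LINT w|dA. bcoeff c n * norm z ^ n * norm (of_real (rho w powr b) * f w))"
        by (intro integral_mono_AE integrable_norm integrable_mult_right I int AE_I2 nb)
      then show "norm (LINT w|dA. norm (?g n w)) \<le> bcoeff c n * norm z ^ n * (LINT w|dA. norm (of_real (rho w powr b) * f w))"
        by simp
    qed
  qed
  have s2: "(LINT w|dA. (\<Sum>n. ?g n w)) = (T_integral b c f z)"
  proof (intro Bochner_Integration.integral_cong refl)
    fix w assume w: "w \<in> space dA"
    have "(\<lambda>n. of_real (bcoeff c n) * z ^ n * (of_real (rho w powr b) * cnj w ^ n) * f w) sums (T_kernel b c z w * f w)"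
      using T_kernel_sums[OF z, of w c b] w by (intro sums_mult2) simp
    then show "(\<Sum>n. ?g n w) = T_kernel b c z w * f w" by (simp add: sums_iff mult_ac)
  qed
  have intg: "integral\<^sup>L dA (?g n) = of_real (bcoeff c n) * (LINT w|dA. of_real (rho w powr b) * cnj w ^ n * f w) * z ^ n" for n
    unfolding integral_mult_right_zero by (simp add: mult_ac)
  show ?thesis using s1 unfolding intg s2 .
qed

section \<open>Estimates for the analytic kernel on a single shell\<close>

lemma emeasure_shell:
  "emeasure dA {z \<in> space dA. r < rho z \<and> rho z \<le> x} = (\<integral>\<^sub>D z. indicator {r<..x} (rho z))"
proof -
  have "{z \<in> space dA. r < rho z \<and> rho z \<le> x} \<in> sets dA" by measurable
  then show ?thesis
    by (subst nn_integral_indicator[symmetric]) (simp, rule nn_integral_cong, simp add: indicator_def)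
qed

lemma emeasure_shell_le:
  assumes "0 < r"
  shows "emeasure dA {z \<in> space dA. r < rho z \<and> rho z \<le> 2 * r} \<le> ennreal r"
proof -
  have "emeasure dA {z \<in> space dA. r < rho z \<and> rho z \<le> 2 * r} = (\<integral>\<^sub>D z. indicator {r<..2 * r} (rho z))"
    by (rule emeasure_shell)
  also have "\<dots> = (\<integral>\<^sup>+t. indicator {r<..2 * r} t * indicator {0<..<1} t \<partial>lborel)"
    by (rule nn_integral_dA_rho) simp
  also have "\<dots> \<le> (\<integral>\<^sup>+t. indicator {r<..2 * r} t \<partial>lborel)"
    by (intro nn_integral_mono) (auto simp: indicator_def)
  also have "\<dots> = ennreal r" using assms by simp
  finally show ?thesis .
qed

text \<open>
  By duality, the Taylor coefficients \<open>A n\<close> of the output satisfy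
  \<open>(\<Sum>n. |A n|^2) = \<integral> f * rho powr b * cnj P\<close> with \<open>P\<close> the polynomial with coefficients
  \<open>bcoeff c n * A n\<close>, whose weighted norm is controlled by Parseval.
\<close>

lemma T_shell_L2:
  assumes c: "c > 1"
  obtains K where "K > 0"
    "\<And>f r H. f \<in> borel_measurable dA \<Longrightarrow> 0 < r \<Longrightarrow> 0 \<le> H \<Longrightarrow>
      (\<integral>\<^sub>D w. ennreal (rho w powr (2 * (2 - c + b) - 1) * (norm (f w))\<^sup>2)) \<le> ennreal H \<Longrightarrow>
      integrable dA (\<lambda>w. of_real (rho w powr b) * f w) \<and>
      (\<integral>\<^sub>D z. ennreal ((norm (T_integral b c f z))\<^sup>2) * indicator {z. r < rho z \<and> rho z \<le> 2 * r} z) \<le> ennreal (K * r * H)"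
proof -
  obtain K where K: "K > 0" and Kb: "\<And>n. (bcoeff c n)\<^sup>2 * (LINT w|dA. rho w powr (2 * c - 3) * (norm w) ^ (2 * n)) \<le> K"
    and int: "integrable dA (\<lambda>w. rho w powr (2 * c - 3))"
    using bcoeff_moment_bounded[OF c] by blast
  \<comment> \<open>Half the sum of this weight and of the Parseval weight \<open>2 * c - 3\<close>
    is \<open>b\<close>, the weight of the operator.\<close>
  define e where "e = 2 * (2 - c + b) - 1"
  show ?thesis
  proof (rule that[OF K])
    fix f :: "complex \<Rightarrow> complex" and r H :: real
    assume f [measurable]: "f \<in> borel_measurable dA" and r: "0 < r" and H: "0 \<le> H"
      and fH: "(\<integral>\<^sub>D w. ennreal (rho w powr (2 * (2 - c + b) - 1) * (norm (f w))\<^sup>2)) \<le> ennreal H"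
    have i2: "integrable dA (\<lambda>w. rho w powr e * (norm (f w))\<^sup>2)"
      using fH by (intro integrableI_nonneg) (auto simp: e_def intro: le_less_trans)
    have H2: "(LINT w|dA. rho w powr e * (norm (f w))\<^sup>2) \<le> H"
    proof -
      have "ennreal (LINT w|dA. rho w powr e * (norm (f w))\<^sup>2) \<le> ennreal H"
        using fH by (subst nn_integral_eq_integral[OF i2, symmetric]) (auto simp: e_def)
      then show ?thesis using H by simp
    qed
    \<comment> \<open>Cauchy-Schwarz in additive form. The parameter \<open>L = 1\<close> gives
      integrability; \<open>L = K\<close> turns the Parseval term into S / 2, which the left-hand
      side absorbs.\<close>
    have amgm: "rho w powr b * x * y \<le> (L * (rho w powr e * x\<^sup>2) + (1 / L) * (rho w powr (2 * c - 3) * y\<^sup>2)) / 2"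
      if L: "L > 0" for w and x y L :: real
    proof -
      define X Y where "X = rho w powr (e / 2) * x" and "Y = rho w powr ((2 * c - 3) / 2) * y"
      have "e / 2 + (2 * c - 3) / 2 = b" by (simp add: e_def field_simps)
      then have XY: "X * Y = rho w powr b * x * y"
        by (simp add: X_def Y_def mult_ac flip: powr_add)
      have X2: "X\<^sup>2 = rho w powr e * x\<^sup>2" "Y\<^sup>2 = rho w powr (2 * c - 3) * y\<^sup>2"
        by (simp_all add: X_def Y_def power_mult_distrib power2_eq_square[of "_ powr _"] flip: powr_add)
      have "0 \<le> (L * X - Y)\<^sup>2 / (2 * L)" using L by simp
      also have "\<dots> = (L * X\<^sup>2 + (1 / L) * Y\<^sup>2) / 2 - X * Y"
        using L by (simp add: power2_eq_square field_simps)
      finally show ?thesis unfolding XY X2 by simp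
    qed
    have ib: "integrable dA (\<lambda>w. of_real (rho w powr b) * f w)"
    proof (rule Bochner_Integration.integrable_bound)
      show "integrable dA (\<lambda>w. rho w powr e * (norm (f w))\<^sup>2 + rho w powr (2 * c - 3))"
        using i2 int by auto
      show "AE w in dA. norm (of_real (rho w powr b) * f w) \<le> norm (rho w powr e * (norm (f w))\<^sup>2 + rho w powr (2 * c - 3))"
      proof (rule AE_I2)
        fix w
        have "0 \<le> rho w powr e * (norm (f w))\<^sup>2" "0 \<le> rho w powr (2 * c - 3)" by auto
        then show "norm (of_real (rho w powr b) * f w) \<le> norm (rho w powr e * (norm (f w))\<^sup>2 + rho w powr (2 * c - 3))"
          using amgm[of 1 w "norm (f w)" 1]
          by (simp add: norm_mult) (smt (verit) mult_nonneg_nonneg norm_ge_zero powr_ge_zero)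
      qed
    qed measurable
    define A where "A = (\<lambda>n. of_real (bcoeff c n) * (LINT w|dA. of_real (rho w powr b) * cnj w ^ n * f w))"
    have In: "integrable dA (\<lambda>w. of_real (rho w powr b) * cnj w ^ n * f w)" for n
    proof (rule Bochner_Integration.integrable_bound[OF ib])
      show "AE w in dA. norm (of_real (rho w powr b) * cnj w ^ n * f w) \<le> norm (of_real (rho w powr b) * f w)"
        by (rule AE_I2) (auto simp: norm_mult norm_power power_le_one mult_left_le intro!: mult_right_mono)
    qed measurable
    \<comment> \<open>Partial sums are finite, so \<open>S <= (K * H + S) / 2\<close> may be solved
      for \<open>S\<close>.\<close>
    have coeff: "(\<Sum>n<N. (norm (A n))\<^sup>2) \<le> K * H" for N
    proof -
      define S where "S = (\<Sum>n<N. (norm (A n))\<^sup>2)"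
      define P where "P = (\<lambda>w. \<Sum>n<N. (of_real (bcoeff c n) * A n) * w ^ n)"
      have Pm [measurable]: "P \<in> borel_measurable dA" unfolding P_def by measurable
      have intP: "integrable dA (\<lambda>w. rho w powr (2 * c - 3) * (norm (P w))\<^sup>2)"
      proof -
        define B where "B = (\<Sum>n<N. norm (of_real (bcoeff c n) * A n))"
        show ?thesis
        proof (rule Bochner_Integration.integrable_bound[OF integrable_mult_left[OF int, of "B\<^sup>2"]])
          show "AE w in dA. norm (rho w powr (2 * c - 3) * (norm (P w))\<^sup>2) \<le> norm (rho w powr (2 * c - 3) * B\<^sup>2)"
          proof (rule AE_I2)
            fix w assume w: "w \<in> space dA"
            have "norm (P w) \<le> B" unfolding P_def B_def
              using w by (intro sum_norm_le) (auto simp: norm_mult norm_power power_le_one intro!: mult_left_le)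
            then have "(norm (P w))\<^sup>2 \<le> B\<^sup>2" by (intro power_mono) auto
            then show "norm (rho w powr (2 * c - 3) * (norm (P w))\<^sup>2) \<le> norm (rho w powr (2 * c - 3) * B\<^sup>2)"
              by (simp add: mult_left_mono)
          qed
        qed measurable
      qed
      have "(LINT w|dA. rho w powr (2 * c - 3) * (norm (P w))\<^sup>2) =
         (\<Sum>n<N. (norm (of_real (bcoeff c n) * A n))\<^sup>2 * (LINT w|dA. rho w powr (2 * c - 3) * (norm w) ^ (2 * n)))"
        unfolding P_def by (rule parseval_finite[where \<phi> = "\<lambda>t. t powr (2 * c - 3)" and e = "\<lambda>n. n"]) (use int in auto)
      also have "\<dots> \<le> (\<Sum>n<N. K * (norm (A n))\<^sup>2)"
      proof (intro sum_mono)
        fix n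
        show "(norm (of_real (bcoeff c n) * A n))\<^sup>2 * (LINT w|dA. rho w powr (2 * c - 3) * (norm w) ^ (2 * n)) \<le> K * (norm (A n))\<^sup>2"
          using mult_right_mono[OF Kb[of n], of "(norm (A n))\<^sup>2"] by (simp add: norm_mult power_mult_distrib mult_ac)
      qed
      finally have PK: "(LINT w|dA. rho w powr (2 * c - 3) * (norm (P w))\<^sup>2) \<le> K * S" by (simp add: S_def sum_distrib_left)
      have "of_real S = (\<Sum>n<N. cnj (A n) * A n)"
        by (simp add: S_def complex_norm_square mult.commute del: of_real_power)
      also have "\<dots> = (\<Sum>n<N. (LINT w|dA. (cnj (A n) * of_real (bcoeff c n)) * (of_real (rho w powr b) * cnj w ^ n * f w)))"
        by (intro sum.cong refl) (simp add: A_def)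
      also have "\<dots> = (LINT w|dA. (\<Sum>n<N. (cnj (A n) * of_real (bcoeff c n)) * (of_real (rho w powr b) * cnj w ^ n * f w)))"
        by (rule Bochner_Integration.integral_sum[symmetric]) (intro integrable_mult_right In)
      also have "\<dots> = (LINT w|dA. of_real (rho w powr b) * f w * cnj (P w))"
        by (intro Bochner_Integration.integral_cong refl) (simp add: P_def sum_distrib_left mult_ac)
      finally have SP: "of_real S = (LINT w|dA. of_real (rho w powr b) * f w * cnj (P w))" .
      have "0 \<le> S" by (simp add: S_def sum_nonneg)
      then have "S = norm (of_real S :: complex)" by (simp only: norm_of_real abs_of_nonneg)
      also have "\<dots> = norm (LINT w|dA. of_real (rho w powr b) * f w * cnj (P w))" by (simp only: SP)
      also have "\<dots> \<le> (LINT w|dA. (K * (rho w powr e * (norm (f w))\<^sup>2) + (1 / K) * (rho w powr (2 * c - 3) * (norm (P w))\<^sup>2)) / 2)"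
      proof (rule Bochner_Integration.integral_norm_bound_integral)
        show i3: "integrable dA (\<lambda>w. (K * (rho w powr e * (norm (f w))\<^sup>2) + (1 / K) * (rho w powr (2 * c - 3) * (norm (P w))\<^sup>2)) / 2)"
          using i2 intP by simp
        have le: "norm (of_real (rho w powr b) * f w * cnj (P w)) \<le> (K * (rho w powr e * (norm (f w))\<^sup>2) + (1 / K) * (rho w powr (2 * c - 3) * (norm (P w))\<^sup>2)) / 2" for w
          using amgm[OF K, of w "norm (f w)" "norm (P w)"] by (simp add: norm_mult)
        then show "\<And>w. w \<in> space dA \<Longrightarrow> norm (of_real (rho w powr b) * f w * cnj (P w)) \<le> (K * (rho w powr e * (norm (f w))\<^sup>2) + (1 / K) * (rho w powr (2 * c - 3) * (norm (P w))\<^sup>2)) / 2" .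
        show "integrable dA (\<lambda>w. of_real (rho w powr b) * f w * cnj (P w))"
        proof (rule Bochner_Integration.integrable_bound[OF i3])
          show "AE w in dA. norm (of_real (rho w powr b) * f w * cnj (P w)) \<le> norm ((K * (rho w powr e * (norm (f w))\<^sup>2) + (1 / K) * (rho w powr (2 * c - 3) * (norm (P w))\<^sup>2)) / 2)"
            by (rule AE_I2) (use order_trans[OF le abs_ge_self] in simp)
          show "(\<lambda>w. of_real (rho w powr b) * f w * cnj (P w)) \<in> borel_measurable dA"
            using measurable_compose[OF Pm cnj_borel_measurable] by measurable
        qed
      qed
      also have "\<dots> = (K * (LINT w|dA. rho w powr e * (norm (f w))\<^sup>2) + (1 / K) * (LINT w|dA. rho w powr (2 * c - 3) * (norm (P w))\<^sup>2)) / 2"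
        using i2 intP by simp
      also have "\<dots> \<le> (K * H + (1 / K) * (K * S)) / 2"
        using H2 PK K by (intro divide_right_mono add_mono mult_left_mono) auto
      finally show ?thesis using K by (simp add: S_def)
    qed
    \<comment> \<open>On the shell each moment of \<open>|z|\<close> is at most the area of the
      shell, hence at most \<open>r\<close>; this is the source of the factor
      \<open>r\<close>.\<close>
    define \<phi> where "\<phi> = (indicator {r<..2 * r} :: real \<Rightarrow> real)"
    have i\<phi>: "integrable dA (\<lambda>w. \<phi> (rho w))"
      by (rule dA.integrable_const_bound[where B = 1]) (auto simp: \<phi>_def indicator_def)
    have i\<phi>n: "integrable dA (\<lambda>w. \<phi> (rho w) * norm w ^ (2 * n))" for n
      by (rule Bochner_Integration.integrable_bound[OF i\<phi>]) (auto simp: \<phi>_def indicator_def power_le_one)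
    have \<phi>r: "(LINT w|dA. \<phi> (rho w)) \<le> r"
    proof -
      have "ennreal (LINT w|dA. \<phi> (rho w)) = (\<integral>\<^sub>D w. ennreal (\<phi> (rho w)))"
        by (rule nn_integral_eq_integral[OF i\<phi>, symmetric]) (auto simp: \<phi>_def)
      also have "\<dots> = emeasure dA {z \<in> space dA. r < rho z \<and> rho z \<le> 2 * r}"
        unfolding emeasure_shell by (intro nn_integral_cong) (simp add: \<phi>_def indicator_def)
      also have "\<dots> \<le> ennreal r" by (rule emeasure_shell_le[OF r])
      finally show ?thesis using r by simp
    qed
    let ?F = "\<lambda>z. LINT w|dA. T_kernel b c z w * f w"
    have partial: "(\<integral>\<^sub>D z. ennreal (\<phi> (rho z) * (norm (\<Sum>n<N. A n * z ^ n))\<^sup>2)) \<le> ennreal (K * r * H)" for N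
    proof -
      have ii: "integrable dA (\<lambda>z. \<phi> (rho z) * (norm (\<Sum>n<N. A n * z ^ n))\<^sup>2)"
      proof (rule Bochner_Integration.integrable_bound[OF integrable_mult_left[OF i\<phi>, of "(\<Sum>n<N. norm (A n))\<^sup>2"]])
        show "AE z in dA. norm (\<phi> (rho z) * (norm (\<Sum>n<N. A n * z ^ n))\<^sup>2) \<le> norm (\<phi> (rho z) * (\<Sum>n<N. norm (A n))\<^sup>2)"
        proof (rule AE_I2)
          fix z assume z: "z \<in> space dA"
          have "norm (\<Sum>n<N. A n * z ^ n) \<le> (\<Sum>n<N. norm (A n))"
            using z by (intro sum_norm_le) (auto simp: norm_mult norm_power power_le_one intro!: mult_left_le)
          then have "(norm (\<Sum>n<N. A n * z ^ n))\<^sup>2 \<le> (\<Sum>n<N. norm (A n))\<^sup>2" by (intro power_mono) auto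
          then show "norm (\<phi> (rho z) * (norm (\<Sum>n<N. A n * z ^ n))\<^sup>2) \<le> norm (\<phi> (rho z) * (\<Sum>n<N. norm (A n))\<^sup>2)"
            by (simp add: abs_mult mult_left_mono)
        qed
      qed (unfold \<phi>_def, measurable)
      have "(\<integral>\<^sub>D z. ennreal (\<phi> (rho z) * (norm (\<Sum>n<N. A n * z ^ n))\<^sup>2)) = ennreal (LINT z|dA. \<phi> (rho z) * (norm (\<Sum>n<N. A n * z ^ n))\<^sup>2)"
        by (rule nn_integral_eq_integral[OF ii]) (auto simp: \<phi>_def)
      also have "(LINT z|dA. \<phi> (rho z) * (norm (\<Sum>n<N. A n * z ^ n))\<^sup>2) = (\<Sum>n<N. (norm (A n))\<^sup>2 * (LINT z|dA. \<phi> (rho z) * (norm z) ^ (2 * n)))"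
        by (rule parseval_finite[OF _ i\<phi>]) (auto simp: \<phi>_def)
      also have "\<dots> \<le> (\<Sum>n<N. (norm (A n))\<^sup>2 * r)"
      proof (intro sum_mono mult_left_mono)
        fix n
        have "(LINT z|dA. \<phi> (rho z) * (norm z) ^ (2 * n)) \<le> (LINT z|dA. \<phi> (rho z))"
          by (intro integral_mono i\<phi>n i\<phi>) (auto simp: \<phi>_def indicator_def power_le_one)
        then show "(LINT z|dA. \<phi> (rho z) * (norm z) ^ (2 * n)) \<le> r" using \<phi>r by linarith
      qed auto
      also have "\<dots> = (\<Sum>n<N. (norm (A n))\<^sup>2) * r" by (simp add: sum_distrib_right)
      also have "\<dots> \<le> K * H * r" using coeff r by (intro mult_right_mono) auto
      finally show ?thesis by (simp add: mult_ac ennreal_leI)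
    qed
    \<comment> \<open>The output is the pointwise limit of its Taylor polynomials, so Fatou's lemma
      carries over the bound uniform in \<open>N\<close>.\<close>
    have "(\<integral>\<^sub>D z. ennreal ((norm (?F z))\<^sup>2) * indicator {z. r < rho z \<and> rho z \<le> 2 * r} z) =
      (\<integral>\<^sub>D z. liminf (\<lambda>N. ennreal (\<phi> (rho z) * (norm (\<Sum>n<N. A n * z ^ n))\<^sup>2)))"
    proof (intro nn_integral_cong)
      fix z assume z: "z \<in> space dA"
      have "(\<lambda>n. A n * z ^ n) sums ?F z"
        unfolding A_def using z c by (intro T_integral_power_series f ib) auto
      then have "(\<lambda>N. \<Sum>n<N. A n * z ^ n) \<longlonglongrightarrow> ?F z" by (simp add: sums_def)
      then have "(\<lambda>N. ennreal (\<phi> (rho z) * (norm (\<Sum>n<N. A n * z ^ n))\<^sup>2)) \<longlonglongrightarrow> ennreal (\<phi> (rho z) * (norm (?F z))\<^sup>2)"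
        by (intro tendsto_ennrealI tendsto_mult tendsto_const tendsto_power tendsto_norm)
      then have "liminf (\<lambda>N. ennreal (\<phi> (rho z) * (norm (\<Sum>n<N. A n * z ^ n))\<^sup>2)) = ennreal (\<phi> (rho z) * (norm (?F z))\<^sup>2)"
        by (intro lim_imp_Liminf) auto
      then show "ennreal ((norm (?F z))\<^sup>2) * indicator {z. r < rho z \<and> rho z \<le> 2 * r} z =
         liminf (\<lambda>N. ennreal (\<phi> (rho z) * (norm (\<Sum>n<N. A n * z ^ n))\<^sup>2))"
        by (simp add: \<phi>_def indicator_def)
    qed
    also have "\<dots> \<le> liminf (\<lambda>N. (\<integral>\<^sub>D z. ennreal (\<phi> (rho z) * (norm (\<Sum>n<N. A n * z ^ n))\<^sup>2)))"
      unfolding \<phi>_def by (rule nn_integral_liminf) measurable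
    also have "\<dots> \<le> ennreal (K * r * H)"
      using Liminf_mono[of "\<lambda>N. (\<integral>\<^sub>D z. ennreal (\<phi> (rho z) * (norm (\<Sum>n<N. A n * z ^ n))\<^sup>2))" "\<lambda>_. ennreal (K * r * H)" sequentially] partial
      by (simp add: Liminf_const)
    finally show "integrable dA (\<lambda>w. of_real (rho w powr b) * f w) \<and>
      (\<integral>\<^sub>D z. ennreal ((norm (?F z))\<^sup>2) * indicator {z. r < rho z \<and> rho z \<le> 2 * r} z) \<le> ennreal (K * r * H)"
      using ib by blast
  qed
qed

text \<open>The averaged kernel is at most a multiple of \<open>rho w powr (1 - c)\<close> whatever
  \<open>rho z\<close> is, so integration over the shell contributes only its area. The input weight
  is \<open>b + 1 - c = d - 1\<close>.\<close>

lemma T_shell_L1: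
  assumes c: "c > 1"
  obtains M where "M > 0"
    "\<And>f r H. f \<in> borel_measurable dA \<Longrightarrow> 0 < r \<Longrightarrow> 0 \<le> H \<Longrightarrow>
      (\<integral>\<^sub>D w. ennreal (rho w powr (b + 1 - c) * norm (f w))) \<le> ennreal H \<Longrightarrow>
      integrable dA (\<lambda>w. of_real (rho w powr b) * f w) \<and>
      (\<integral>\<^sub>D z. ennreal (norm (T_integral b c f z)) * indicator {z. r < rho z \<and> rho z \<le> 2 * r} z) \<le> ennreal (M * r * H)"
proof -
  obtain m' M where kb: "kernel_bounds c m' M" using kernel_bounds_exist[OF c] by blast
  then interpret kernel_bounds c m' M .
  note M = M_pos
  have shell: "(\<integral>\<^sub>D z. indicator {r<..2 * r} (rho z) * ennreal (abs_kernel c w z)) \<le> ennreal (M * r * rho w powr (1 - c))"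
    if w: "w \<in> ball 0 1" and r: "0 < r" for w r
  proof -
    have rw: "rho w > 0" using rho_bounds(1)[OF w] .
    have "(\<integral>\<^sub>D z. indicator {r<..2 * r} (rho z) * ennreal (abs_kernel c w z)) \<le>
      ennreal M * (\<integral>\<^sup>+t. indicator {r<..2 * r} t * ennreal (max t (rho w) powr (1 - c)) * indicator {0<..<1} t \<partial>lborel)"
      by (rule upper[OF w]) measurable
    also have "\<dots> \<le> ennreal M * (\<integral>\<^sup>+t. ennreal (rho w powr (1 - c)) * indicator {r<..2 * r} t \<partial>lborel)"
      using rw c by (intro mult_left_mono nn_integral_mono) (auto simp: indicator_def intro!: ennreal_leI powr_mono2')
    also have "\<dots> = ennreal (M * r * rho w powr (1 - c))"
      using M r by (simp add: nn_integral_cmult_indicator mult_ac flip: ennreal_mult)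
    finally show ?thesis .
  qed
  show ?thesis
  proof (rule that[OF M])
    fix f :: "complex \<Rightarrow> complex" and r H :: real
    assume f [measurable]: "f \<in> borel_measurable dA" and r: "0 < r" and H: "0 \<le> H"
      and fH: "(\<integral>\<^sub>D w. ennreal (rho w powr (b + 1 - c) * norm (f w))) \<le> ennreal H"
    have "integrable dA (\<lambda>w. of_real (rho w powr b) * f w)"
    proof (rule integrableI_bounded)
      have "(\<integral>\<^sub>D w. ennreal (norm (of_real (rho w powr b) * f w))) \<le> (\<integral>\<^sub>D w. ennreal (rho w powr (b + 1 - c) * norm (f w)))"
      proof (intro nn_integral_mono ennreal_leI)
        fix w assume "w \<in> space dA"
        then have "rho w powr b \<le> rho w powr (b + 1 - c)"
          using c rho_bounds[of w] by (intro powr_mono') auto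
        then show "norm (of_real (rho w powr b) * f w) \<le> rho w powr (b + 1 - c) * norm (f w)"
          by (simp add: norm_mult mult_right_mono)
      qed
      also note fH
      finally show "(\<integral>\<^sub>D w. ennreal (norm (of_real (rho w powr b) * f w))) < \<infinity>" by (simp add: le_less_trans)
    qed measurable
    moreover have "(\<integral>\<^sub>D z. ennreal (norm (T_integral b c f z)) * indicator {z. r < rho z \<and> rho z \<le> 2 * r} z) \<le> ennreal (M * r * H)"
    proof -
      define h where "h = (\<lambda>z w. ennreal (rho w powr b * norm (f w)) * (indicator {r<..2 * r} (rho z) * ennreal (abs_kernel c z w)))"
      have [measurable]: "(\<lambda>(z, w). h z w) \<in> borel_measurable (dA \<Otimes>\<^sub>M dA)"
        unfolding h_def split_beta by measurable
      interpret pair_sigma_finite dA dA ..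
      have "(\<integral>\<^sub>D z. ennreal (norm (T_integral b c f z)) * indicator {z. r < rho z \<and> rho z \<le> 2 * r} z) \<le>
        (\<integral>\<^sub>D z. (\<integral>\<^sub>D w. h z w))"
      proof (intro nn_integral_mono)
        fix z
        have "ennreal (norm (T_integral b c f z)) \<le> (\<integral>\<^sub>D w. ennreal (norm (T_kernel b c z w * f w)))"
        proof (cases "integrable dA (\<lambda>w. T_kernel b c z w * f w)")
          case True
          then show ?thesis by (rule integral_norm_bound_ennreal)
        qed (simp add: not_integrable_integral_eq)
        also have "\<dots> = (\<integral>\<^sub>D w. ennreal (rho w powr b * norm (f w)) * ennreal (abs_kernel c z w))"
          by (intro nn_integral_cong) (simp add: norm_mult norm_kernels mult_ac flip: ennreal_mult)
        finally show "ennreal (norm (T_integral b c f z)) * indicator {z. r < rho z \<and> rho z \<le> 2 * r} z \<le> (\<integral>\<^sub>D w. h z w)"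
          by (auto simp: h_def indicator_def)
      qed
      also have "\<dots> = (\<integral>\<^sub>D w. (\<integral>\<^sub>D z. h z w))" by (rule Fubini') measurable
      also have "\<dots> \<le> (\<integral>\<^sub>D w. ennreal (M * r) * ennreal (rho w powr (b + 1 - c) * norm (f w)))"
      proof (intro nn_integral_mono)
        fix w assume w: "w \<in> space dA"
        have "(\<integral>\<^sub>D z. h z w) = ennreal (rho w powr b * norm (f w)) * (\<integral>\<^sub>D z. indicator {r<..2 * r} (rho z) * ennreal (abs_kernel c w z))"
          unfolding h_def norm_one_minus_mult_cnj_commute[of _ w] by (rule nn_integral_cmult) measurable
        also have "\<dots> \<le> ennreal (rho w powr b * norm (f w)) * ennreal (M * r * rho w powr (1 - c))"
          using shell[of w r] w r by (intro mult_left_mono) auto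
        also have "\<dots> = ennreal (M * r * ((rho w powr b * rho w powr (1 - c)) * norm (f w)))"
          using M r by (simp add: mult_ac flip: ennreal_mult)
        also have "rho w powr b * rho w powr (1 - c) = rho w powr (b + 1 - c)"
          by (simp add: algebra_simps flip: powr_add)
        finally show "(\<integral>\<^sub>D z. h z w) \<le> ennreal (M * r) * ennreal (rho w powr (b + 1 - c) * norm (f w))"
          using M r by (simp flip: ennreal_mult)
      qed
      also have "\<dots> = ennreal (M * r) * (\<integral>\<^sub>D w. ennreal (rho w powr (b + 1 - c) * norm (f w)))"
        by (rule nn_integral_cmult) measurable
      also have "\<dots> \<le> ennreal (M * r) * ennreal H" using fH by (rule mult_left_mono) simp
      finally show ?thesis using M r H by (simp add: ennreal_mult)
    qed
    ultimately show "integrable dA (\<lambda>w. of_real (rho w powr b) * f w) \<and>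
      (\<integral>\<^sub>D z. ennreal (norm (T_integral b c f z)) * indicator {z. r < rho z \<and> rho z \<le> 2 * r} z) \<le> ennreal (M * r * H)" by blast
  qed
qed

text \<open>Interpolation with change of measure: the weights \<open>rho powr (d - 1)\<close> and
  \<open>rho powr (2 * d - 1)\<close> of the two shell estimates differ, so the height of the cut
  varies with \<open>rho\<close>. The integrability part later provides absolute convergence at
  every \<open>z\<close>.\<close>

lemma T_shell_weak_type:
  assumes c: "c > 1" and d: "1 / 2 \<le> 2 - c + b" "2 - c + b < 1" and p: "p = 1 / (2 - c + b)"
  obtains C where "C > 0"
    "\<And>f r N t. f \<in> borel_measurable dA \<Longrightarrow> 0 < r \<Longrightarrow> 0 < N \<Longrightarrow> 0 < t \<Longrightarrow>
      (Lp_integral p f) \<le> ennreal (N powr p) \<Longrightarrow>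
      integrable dA (\<lambda>w. of_real (rho w powr b) * f w) \<and>
      measure dA {z \<in> space dA. r < rho z \<and> rho z \<le> 2 * r \<and> t < norm (T_integral b c f z)} \<le> C * r * (N / t) powr p"
proof -
  define d where "d = 2 - c + b"
  note dd = d[folded d_def]
  have p': "p = 1 / d" by (simp add: p d_def)
  have p1: "1 < p" "p \<le> 2" using dd by (auto simp: p' field_simps)
  have dp: "d * p = 1" using dd by (simp add: p')
  obtain M where M: "M > 0" and L1: "\<And>f r H. f \<in> borel_measurable dA \<Longrightarrow> 0 < r \<Longrightarrow> 0 \<le> H \<Longrightarrow>
      (\<integral>\<^sub>D w. ennreal (rho w powr (b + 1 - c) * norm (f w))) \<le> ennreal H \<Longrightarrow>
      integrable dA (\<lambda>w. of_real (rho w powr b) * f w) \<and>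
      (\<integral>\<^sub>D z. ennreal (norm (T_integral b c f z)) * indicator {z. r < rho z \<and> rho z \<le> 2 * r} z) \<le> ennreal (M * r * H)"
    using T_shell_L1[OF c] by blast
  obtain K where K: "K > 0" and L2: "\<And>f r H. f \<in> borel_measurable dA \<Longrightarrow> 0 < r \<Longrightarrow> 0 \<le> H \<Longrightarrow>
      (\<integral>\<^sub>D w. ennreal (rho w powr (2 * (2 - c + b) - 1) * (norm (f w))\<^sup>2)) \<le> ennreal H \<Longrightarrow>
      integrable dA (\<lambda>w. of_real (rho w powr b) * f w) \<and>
      (\<integral>\<^sub>D z. ennreal ((norm (T_integral b c f z))\<^sup>2) * indicator {z. r < rho z \<and> rho z \<le> 2 * r} z) \<le> ennreal (K * r * H)"
    using T_shell_L2[OF c] by blast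
  show ?thesis
  proof (rule that[of "2 * M + 4 * K"])
    fix f :: "complex \<Rightarrow> complex" and r N t :: real
    assume f [measurable]: "f \<in> borel_measurable dA" and r: "0 < r" and N: "0 < N" and t: "0 < t"
      and fN: "Lp_integral p f \<le> ennreal (N powr p)"
    \<comment> \<open>Since \<open>d * p = 1\<close>, the powers of \<open>rho\<close> cancel. Above
      the cut \<open>|f| <= t^(1-p) rho^(1-d) |f|^p\<close>, and below it
      \<open>|f|^2 <= t^(2-p) rho^(1-2d) |f|^p\<close>, where the second bound uses
      \<open>p <= 2\<close>.\<close>
    define h1 h2 where "h1 = (\<lambda>w. if t * rho w powr (- d) < norm (f w) then f w else 0)"
      and "h2 = (\<lambda>w. if t * rho w powr (- d) < norm (f w) then 0 else f w)"
    have [measurable]: "h1 \<in> borel_measurable dA" "h2 \<in> borel_measurable dA"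
      unfolding h1_def h2_def by measurable
    let ?F = "\<lambda>f z. LINT w|dA. T_kernel b c z w * f w"
    note Tm [measurable] = T_kernel_measurable[of b c]
    have [measurable]: "?F f \<in> borel_measurable dA" "?F h1 \<in> borel_measurable dA" "?F h2 \<in> borel_measurable dA"
      by measurable
    define H1 H2 where "H1 = t powr (1 - p) * N powr p" and "H2 = t powr (2 - p) * N powr p"
    have H: "0 \<le> H1" "0 \<le> H2" by (auto simp: H1_def H2_def)
    have "(\<integral>\<^sub>D w. ennreal (rho w powr (b + 1 - c) * norm (h1 w))) \<le> (\<integral>\<^sub>D w. ennreal (t powr (1 - p)) * ennreal (norm (f w) powr p))"
    proof (intro nn_integral_mono)
      fix w assume "w \<in> space dA"
      then have rw: "rho w > 0" using rho_bounds(1) by auto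
      show "ennreal (rho w powr (b + 1 - c) * norm (h1 w)) \<le> ennreal (t powr (1 - p)) * ennreal (norm (f w) powr p)"
      proof (cases "t * rho w powr (- d) < norm (f w)")
        case True
        moreover have "0 < t * rho w powr (- d)" using t rw by simp
        ultimately have x: "norm (f w) > 0" by linarith
        have "norm (f w) = norm (f w) powr (1 - p) * norm (f w) powr p" using x by (simp flip: powr_add)
        also have "\<dots> \<le> (t * rho w powr (- d)) powr (1 - p) * norm (f w) powr p"
          using True t rw p1 by (intro mult_right_mono powr_mono2') auto
        also have "(t * rho w powr (- d)) powr (1 - p) = t powr (1 - p) * rho w powr (1 - d)"
          using t rw dp by (simp add: powr_mult powr_powr algebra_simps)
        finally have "rho w powr (b + 1 - c) * norm (f w) \<le> rho w powr (b + 1 - c) * (t powr (1 - p) * rho w powr (1 - d) * norm (f w) powr p)"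
          by (rule mult_left_mono) simp
        also have "\<dots> = t powr (1 - p) * norm (f w) powr p * (rho w powr (b + 1 - c) * rho w powr (1 - d))" by (simp add: mult_ac)
        also have "rho w powr (b + 1 - c) * rho w powr (1 - d) = 1"
          using rw by (simp add: d_def flip: powr_add)
        finally show ?thesis using True by (simp add: h1_def flip: ennreal_mult)
      qed (simp add: h1_def)
    qed
    also have "\<dots> = ennreal (t powr (1 - p)) * (Lp_integral p f)" by (rule nn_integral_cmult) measurable
    also have "\<dots> \<le> ennreal H1"
      using mult_left_mono[OF fN, of "ennreal (t powr (1 - p))"] by (simp add: H1_def ennreal_mult)
    finally have B1: "integrable dA (\<lambda>w. of_real (rho w powr b) * h1 w)"
      "(\<integral>\<^sub>D z. ennreal (norm (?F h1 z)) * indicator {z. r < rho z \<and> rho z \<le> 2 * r} z) \<le> ennreal (M * r * H1)"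
      using L1[of h1 r H1] r H by auto
    have "(\<integral>\<^sub>D w. ennreal (rho w powr (2 * (2 - c + b) - 1) * (norm (h2 w))\<^sup>2)) \<le> (\<integral>\<^sub>D w. ennreal (t powr (2 - p)) * ennreal (norm (f w) powr p))"
    proof (intro nn_integral_mono)
      fix w assume "w \<in> space dA"
      then have rw: "rho w > 0" using rho_bounds(1) by auto
      show "ennreal (rho w powr (2 * (2 - c + b) - 1) * (norm (h2 w))\<^sup>2) \<le> ennreal (t powr (2 - p)) * ennreal (norm (f w) powr p)"
      proof (cases "t * rho w powr (- d) < norm (f w) \<or> f w = 0")
        case False
        then have x: "norm (f w) > 0" "norm (f w) \<le> t * rho w powr (- d)" by auto
        have "(norm (f w))\<^sup>2 = norm (f w) powr 2" using x by (simp add: powr_numeral)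
        also have "\<dots> = norm (f w) powr (2 - p) * norm (f w) powr p" by (simp flip: powr_add)
        also have "\<dots> \<le> (t * rho w powr (- d)) powr (2 - p) * norm (f w) powr p"
          using x t rw p1 by (intro mult_right_mono powr_mono2) auto
        also have "(t * rho w powr (- d)) powr (2 - p) = t powr (2 - p) * rho w powr (1 - 2 * d)"
          using t rw dp by (simp add: powr_mult powr_powr algebra_simps)
        finally have "rho w powr (2 * (2 - c + b) - 1) * (norm (f w))\<^sup>2 \<le> rho w powr (2 * (2 - c + b) - 1) * (t powr (2 - p) * rho w powr (1 - 2 * d) * norm (f w) powr p)"
          by (rule mult_left_mono) simp
        also have "\<dots> = t powr (2 - p) * norm (f w) powr p * (rho w powr (2 * (2 - c + b) - 1) * rho w powr (1 - 2 * d))" by (simp add: mult_ac)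
        also have "rho w powr (2 * (2 - c + b) - 1) * rho w powr (1 - 2 * d) = 1"
          using rw by (simp add: d_def flip: powr_add)
        finally show ?thesis using False by (simp add: h2_def flip: ennreal_mult)
      qed (auto simp: h2_def)
    qed
    also have "\<dots> = ennreal (t powr (2 - p)) * (Lp_integral p f)" by (rule nn_integral_cmult) measurable
    also have "\<dots> \<le> ennreal H2"
      using mult_left_mono[OF fN, of "ennreal (t powr (2 - p))"] by (simp add: H2_def ennreal_mult)
    finally have B2: "integrable dA (\<lambda>w. of_real (rho w powr b) * h2 w)"
      "(\<integral>\<^sub>D z. ennreal ((norm (?F h2 z))\<^sup>2) * indicator {z. r < rho z \<and> rho z \<le> 2 * r} z) \<le> ennreal (K * r * H2)"
      using L2[of h2 r H2] r H by auto
    have f12: "f w = h1 w + h2 w" for w by (simp add: h1_def h2_def)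
    have int: "integrable dA (\<lambda>w. of_real (rho w powr b) * f w)"
      using Bochner_Integration.integrable_add[OF B1(1) B2(1)] by (simp add: f12 distrib_left)
    have F12: "?F f z = ?F h1 z + ?F h2 z" if z: "z \<in> space dA" for z
    proof -
      have "integrable dA (\<lambda>w. T_kernel b c z w * h1 w)" "integrable dA (\<lambda>w. T_kernel b c z w * h2 w)"
        using B1(1) B2(1) z c by (auto intro!: weight_integrable_imp_kernel_integrable[OF T_kernel_measurable norm_kernels(2)])
      then show ?thesis by (simp add: f12 distrib_left)
    qed
    \<comment> \<open>Each half is tested at level t / 2; Chebyshev for the first and second power
      produces the constants \<open>2 * M\<close> and \<open>4 * K\<close>.\<close>
    define A1 A2 where "A1 = {z \<in> space dA. r < rho z \<and> rho z \<le> 2 * r \<and> t / 2 \<le> norm (?F h1 z)}"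
      and "A2 = {z \<in> space dA. r < rho z \<and> rho z \<le> 2 * r \<and> t / 2 \<le> norm (?F h2 z)}"
    have [measurable]: "A1 \<in> sets dA" "A2 \<in> sets dA" unfolding A1_def A2_def by measurable
    have "ennreal (t / 2) * emeasure dA A1 = (\<integral>\<^sub>D z. ennreal (t / 2) * indicator A1 z)"
      by (simp add: nn_integral_cmult_indicator)
    also have "\<dots> \<le> (\<integral>\<^sub>D z. ennreal (norm (?F h1 z)) * indicator {z. r < rho z \<and> rho z \<le> 2 * r} z)"
      by (intro nn_integral_mono) (auto simp: A1_def indicator_def intro!: ennreal_leI)
    also note B1(2)
    finally have "ennreal (t / 2 * measure dA A1) \<le> ennreal (M * r * H1)"
      using t by (simp add: dA.emeasure_eq_measure flip: ennreal_mult)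
    then have "t / 2 * measure dA A1 \<le> M * r * H1" using M r H by simp
    also have "M * r * H1 = t / 2 * (2 * M * r * (N / t) powr p)"
      using t N by (simp add: H1_def powr_divide powr_diff field_simps)
    finally have m1: "measure dA A1 \<le> 2 * M * r * (N / t) powr p" using t by simp
    have "ennreal ((t / 2)\<^sup>2) * emeasure dA A2 = (\<integral>\<^sub>D z. ennreal ((t / 2)\<^sup>2) * indicator A2 z)"
      by (simp add: nn_integral_cmult_indicator)
    also have "\<dots> \<le> (\<integral>\<^sub>D z. ennreal ((norm (?F h2 z))\<^sup>2) * indicator {z. r < rho z \<and> rho z \<le> 2 * r} z)"
      using t by (intro nn_integral_mono) (auto simp: A2_def indicator_def intro!: ennreal_leI power_mono simp del: power_divide)
    also note B2(2)
    finally have "ennreal ((t / 2)\<^sup>2 * measure dA A2) \<le> ennreal (K * r * H2)"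
      using t by (simp add: dA.emeasure_eq_measure flip: ennreal_mult)
    then have "(t / 2)\<^sup>2 * measure dA A2 \<le> K * r * H2" using K r H by simp
    also have "K * r * H2 = (t / 2)\<^sup>2 * (4 * K * r * (N / t) powr p)"
      using t N by (simp add: H2_def powr_divide powr_diff field_simps powr_numeral)
    finally have m2: "measure dA A2 \<le> 4 * K * r * (N / t) powr p" using t by simp
    have "measure dA {z \<in> space dA. r < rho z \<and> rho z \<le> 2 * r \<and> t < norm (?F f z)} \<le> measure dA (A1 \<union> A2)"
    proof (rule dA.finite_measure_mono)
      show "{z \<in> space dA. r < rho z \<and> rho z \<le> 2 * r \<and> t < norm (?F f z)} \<subseteq> A1 \<union> A2"
      proof
        fix z assume z: "z \<in> {z \<in> space dA. r < rho z \<and> rho z \<le> 2 * r \<and> t < norm (?F f z)}"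
        then have "t < norm (?F h1 z) + norm (?F h2 z)" using F12[of z] norm_triangle_ineq[of "?F h1 z" "?F h2 z"] by auto
        then have "t / 2 \<le> norm (?F h1 z) \<or> t / 2 \<le> norm (?F h2 z)" by linarith
        then show "z \<in> A1 \<union> A2" using z by (auto simp: A1_def A2_def)
      qed
    qed measurable
    also have "\<dots> \<le> measure dA A1 + measure dA A2" by (rule measure_Un_le) measurable
    also have "\<dots> \<le> (2 * M + 4 * K) * r * (N / t) powr p" using m1 m2 by (simp add: algebra_simps)
    finally show "integrable dA (\<lambda>w. of_real (rho w powr b) * f w) \<and>
      measure dA {z \<in> space dA. r < rho z \<and> rho z \<le> 2 * r \<and> t < norm (?F f z)} \<le> (2 * M + 4 * K) * r * (N / t) powr p"
      using int by blast
  qed (use M K in simp)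
qed

text \<open>On each shell \<open>rho z powr a\<close> is essentially constant and is moved into the
  level. The ring \<open>rho z < 2 * e\<close> is small by area, and the shells outside it
  contribute a geometric series.\<close>

lemma T_bounded_endpoint:
  assumes c: "c > 1" and d: "1 / 2 \<le> 2 - c + b" "2 - c + b < 1" and a: "- a > 2 - c + b"
  shows "T_bounded a b c (Lp_norm (ereal (1 / (2 - c + b)))) (Lweak_norm (ereal (- 1 / a)))"
proof -
  define p where "p = 1 / (2 - c + b)"
  define q where "q = - 1 / a"
  have a0: "a < 0" using a d by linarith
  have q0: "q > 0" using a0 by (simp add: q_def)
  have p1: "1 \<le> p" using d by (simp add: p_def field_simps)
  have ap: "a * p < - 1" using a d by (simp add: p_def field_simps)
  obtain C where C: "C > 0" and W: "\<And>f r N t. f \<in> borel_measurable dA \<Longrightarrow> 0 < r \<Longrightarrow> 0 < N \<Longrightarrow> 0 < t \<Longrightarrow>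
      (Lp_integral p f) \<le> ennreal (N powr p) \<Longrightarrow>
      integrable dA (\<lambda>w. of_real (rho w powr b) * f w) \<and>
      measure dA {z \<in> space dA. r < rho z \<and> rho z \<le> 2 * r \<and> t < norm (T_integral b c f z)} \<le> C * r * (N / t) powr p"
    using T_shell_weak_type[OF c d p_def] by blast
  \<comment> \<open>From one shell to the next the area bound doubles and the level grows by 2^(-a),
    which multiplies the estimate by 2^(1 + a p). The ratio is below 1 because
    \<open>- a > d = 1 / p\<close>.\<close>
  define x where "x = (2::real) powr (1 + a * p)"
  have "x < 2 powr 0" unfolding x_def using ap by (intro powr_less_mono) auto
  then have x: "0 < x" "x < 1" by (auto simp: x_def)
  define C' where "C' = 2 + C / (1 - x)"
  have C': "C' > 0" using C x by (auto simp: C'_def intro!: add_pos_pos)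
  note Tm [measurable] = T_kernel_measurable[of b c]
  let ?F = "\<lambda>f z. LINT w|dA. T_kernel b c z w * f w"
  have Wm: "weighted_op a (T_kernel b c) f = (\<lambda>z. complex_of_real (rho z powr a) * ?F f z)" for f
    by (auto simp: weighted_op_def rho_def)
  have dist: "dist_fun (weighted_op a (T_kernel b c) f) t \<le> C' * (N / t) powr q"
    if f [measurable]: "f \<in> borel_measurable dA" and N: "N > 0" and t: "t > 0"
      and fN: "Lp_integral p f \<le> ennreal (N powr p)" for f N t
  proof -
    define e where "e = (N / t) powr q"
    have e: "e > 0" using N t by (simp add: e_def)
    \<comment> \<open>As \<open>rho <= 1 < 2 ^ J * e\<close>, the first \<open>J\<close> shells
      reach the centre of the disc.\<close>
    obtain J :: nat where J: "1 / e < 2 ^ J" using real_arch_pow[of 2 "1 / e"] by auto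
    define A where "A = (\<lambda>j::nat. {z \<in> space dA. 2 ^ j * e < rho z \<and> rho z \<le> 2 * (2 ^ j * e) \<and> t * (2 ^ j * e) powr (- a) < norm (?F f z)})"
    have [measurable]: "?F f \<in> borel_measurable dA" by measurable
    have [measurable]: "A j \<in> sets dA" for j unfolding A_def by measurable
    have mA: "measure dA (A j) \<le> C * e * x ^ j" for j
    proof -
      have "measure dA (A j) \<le> C * (2 ^ j * e) * (N / (t * (2 ^ j * e) powr (- a))) powr p"
        using W[OF f _ N _ fN, of "2 ^ j * e" "t * (2 ^ j * e) powr (- a)"] e t unfolding A_def by simp
      also have "(N / (t * (2 ^ j * e) powr (- a))) powr p = (N / t) powr p * (2 ^ j * e) powr (a * p)"
        using N t e by (simp add: powr_divide powr_mult powr_powr powr_minus field_simps)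
      also have "\<dots> = (N / t) powr p * (e powr (a * p) * (2 ^ j) powr (a * p))"
        using e by (simp add: powr_mult)
      also have "e powr (a * p) = (N / t) powr (- p)"
        using a0 by (simp add: e_def q_def powr_powr)
      also have "(N / t) powr p * ((N / t) powr (- p) * (2 ^ j) powr (a * p)) = (2 ^ j) powr (a * p)"
        using N t by (simp add: mult.assoc[symmetric] flip: powr_add)
      also have "C * (2 ^ j * e) * (2 ^ j) powr (a * p) = C * e * ((2 ^ j) powr 1 * (2 ^ j) powr (a * p))" by simp
      also have "(2 ^ j) powr 1 * (2 ^ j) powr (a * p) = x ^ j"
        by (simp add: x_def powr_powr algebra_simps flip: powr_add powr_realpow)
      finally show ?thesis .
    qed
    have "dist_fun (weighted_op a (T_kernel b c) f) t \<le> measure dA ({z \<in> space dA. rho z < 2 * e} \<union> (\<Union>j<J. A j))"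
      unfolding dist_fun_def
    proof (rule dA.finite_measure_mono)
      show "{z \<in> space dA. t < norm (weighted_op a (T_kernel b c) f z)} \<subseteq> {z \<in> space dA. rho z < 2 * e} \<union> (\<Union>j<J. A j)"
      proof
        fix z assume "z \<in> {z \<in> space dA. t < norm (weighted_op a (T_kernel b c) f z)}"
        then have z: "z \<in> space dA" and tz: "t < rho z powr a * norm (?F f z)" by (auto simp: Wm norm_mult)
        have rz: "0 < rho z" "rho z \<le> 1" using rho_bounds z by auto
        show "z \<in> {z \<in> space dA. rho z < 2 * e} \<union> (\<Union>j<J. A j)"
        proof (cases "rho z < 2 * e")
          case False
          \<comment> \<open>Here \<open>rho z >= 2 * e > e\<close>, so \<open>n\<close> is positive
            and its predecessor \<open>j\<close> is the index of the shell containing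
            \<open>z\<close>.\<close>
          define n where "n = (LEAST n. rho z \<le> 2 ^ n * e)"
          have J': "rho z \<le> 2 ^ J * e" using J e rz by (simp add: field_simps)
          have n1: "rho z \<le> 2 ^ n * e" unfolding n_def by (rule LeastI[of _ J]) (rule J')
          have n2: "n \<le> J" unfolding n_def by (rule Least_le) (rule J')
          obtain j where j: "n = Suc j" using n1 False e by (cases n) auto
          have "\<not> rho z \<le> 2 ^ j * e" using not_less_Least[of j "\<lambda>n. rho z \<le> 2 ^ n * e"] j by (simp add: n_def)
          then have j1: "2 ^ j * e < rho z" by simp
          have "t * (2 ^ j * e) powr (- a) \<le> t * rho z powr (- a)"
            using j1 e t a0 by (intro mult_left_mono powr_mono2) auto
          also have "\<dots> < (rho z powr a * norm (?F f z)) * rho z powr (- a)"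
            using tz rz by (intro mult_strict_right_mono) auto
          also have "\<dots> = norm (?F f z)" using rz by (simp add: powr_minus field_simps)
          finally have "z \<in> A j" using z j1 n1 j by (simp add: A_def)
          then show ?thesis using n2 j by auto
        qed (use z in simp)
      qed
      have "{z \<in> space dA. rho z < 2 * e} \<in> sets dA" by measurable
      then show "{z \<in> space dA. rho z < 2 * e} \<union> (\<Union>j<J. A j) \<in> sets dA" by auto
    qed
    also have "\<dots> \<le> measure dA {z \<in> space dA. rho z < 2 * e} + measure dA (\<Union>j<J. A j)"
      by (rule measure_Un_le) measurable
    also have "\<dots> \<le> 2 * e + (\<Sum>j<J. measure dA (A j))"
    proof (intro add_mono measure_UNION_le)
      show "measure dA {z \<in> space dA. rho z < 2 * e} \<le> 2 * e"
        using emeasure_rho_less[of "2 * e"] e by (simp add: dA.emeasure_eq_measure)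
    qed auto
    also have "\<dots> \<le> 2 * e + (\<Sum>j<J. C * e * x ^ j)" by (intro add_mono sum_mono mA order_refl)
    also have "(\<Sum>j<J. C * e * x ^ j) = C * e * ((1 - x ^ J) / (1 - x))"
      using x by (simp add: sum_gp_strict flip: sum_distrib_left)
    also have "\<dots> \<le> C * e * (1 / (1 - x))"
      using C e x by (intro mult_left_mono divide_right_mono) auto
    finally show ?thesis by (simp add: C'_def e_def algebra_simps)
  qed
  show ?thesis
    unfolding T_bounded_def maps_boundedly_def p_def[symmetric] q_def[symmetric]
  proof (intro exI[of _ "C' powr (1 / q)"] ballI impI conjI)
    fix f assume f [measurable]: "f \<in> borel_measurable dA" and fin: "Lp_norm (ereal p) f < \<infinity>"
    define n where "n = enn2real (Lp_norm (ereal p) f)"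
    have "0 \<le> n" by (simp add: n_def)
    \<comment> \<open>The bound \<open>n + 1\<close> is positive and exceeds the norm; it only
      serves to obtain integrability.\<close>
    have fn: "Lp_integral p f \<le> ennreal ((n + 1) powr p)"
      by (rule Lp_norm_bound_imp[OF p1 fin]) (simp add: n_def)
    have int: "integrable dA (\<lambda>w. of_real (rho w powr b) * f w)"
      using W[OF f zero_less_one _ zero_less_one fn] \<open>0 \<le> n\<close> by simp
    show "AE z in dA. integrable dA (\<lambda>w. T_kernel b c z w * f w)"
      by (rule AE_I2, rule weight_integrable_imp_kernel_integrable[OF T_kernel_measurable norm_kernels(2) _ _ f int])
         (use c in auto)
    show "weighted_op a (T_kernel b c) f \<in> borel_measurable dA"
      by (rule weighted_op_measurable[OF f T_kernel_measurable])
    show "Lweak_norm (ereal q) (weighted_op a (T_kernel b c) f) \<le> ennreal (C' powr (1 / q)) * Lp_norm (ereal p) f"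
    proof -
      have "ennreal (t * dist_fun (weighted_op a (T_kernel b c) f) t powr (1 / q)) \<le> ennreal (C' powr (1 / q)) * Lp_norm (ereal p) f" if t: "t > 0" for t
      proof -
        have "t * dist_fun (weighted_op a (T_kernel b c) f) t powr (1 / q) \<le> C' powr (1 / q) * enn2real (Lp_norm (ereal p) f)"
          by (rule distribution_bound_imp_Lp_weak_type[OF p1 q0 _ _ _ fin t])
             (use dist[OF f _ t] C' in \<open>auto simp: dist_fun_def\<close>)
        then have "ennreal (t * dist_fun (weighted_op a (T_kernel b c) f) t powr (1 / q)) \<le> ennreal (C' powr (1 / q) * enn2real (Lp_norm (ereal p) f))"
          by (rule ennreal_leI)
        also have "\<dots> = ennreal (C' powr (1 / q)) * Lp_norm (ereal p) f" using fin by (simp add: ennreal_mult)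
        finally show ?thesis .
      qed
      then show ?thesis unfolding Lweak_norm_def by (auto intro!: SUP_least)
    qed
  qed
qed

section \<open>Unboundedness\<close>

lemma nn_integral_inverse_Icc:
  assumes "0 < e" "e \<le> 1"
  shows "(\<integral>\<^sup>+t. ennreal (t powr (- 1)) * indicator {e..1} t \<partial>lborel) = ennreal (ln (1 / e))"
proof -
  have "(\<integral>\<^sup>+t. ennreal (t powr (- 1)) * indicator {e..1} t \<partial>lborel) = ennreal (ln 1 - ln e)"
  proof (rule nn_integral_FTC_Icc)
    fix t assume "t \<in> {e..1}"
    then show "(ln has_real_derivative t powr (- 1)) (at t)"
      using assms by (auto intro!: derivative_eq_intros simp: powr_minus field_simps)
  qed (use assms in auto)
  then show ?thesis using assms by (simp add: ln_div)
qed

text \<open>An antiderivative is \<open>(1 - ln t) powr (1 - p) / (p - 1)\<close>. It is evaluated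
  on intervals that stay away from 0, and Fatou's lemma removes the truncation.\<close>

lemma log_weight_integral_bounded:
  fixes p :: real
  assumes p: "p > 1"
  shows "(\<integral>\<^sup>+t. ennreal (t powr (- 1) * (1 - ln t) powr (- p)) * indicator {0<..<1} t \<partial>lborel) \<le> ennreal (1 / (p - 1))"
proof -
  let ?g = "\<lambda>n t. ennreal (t powr (- 1) * (1 - ln t) powr (- p)) * indicator {1 / real (Suc n)..1} t"
  have b: "(\<integral>\<^sup>+t. ?g n t \<partial>lborel) \<le> ennreal (1 / (p - 1))" for n
  proof -
    let ?e = "1 / real (Suc n)"
    have e: "0 < ?e" "?e \<le> 1" by auto
    have "(\<integral>\<^sup>+t. ?g n t \<partial>lborel) = ennreal ((1 - ln 1) powr (1 - p) / (p - 1) - (1 - ln ?e) powr (1 - p) / (p - 1))"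
    proof (rule nn_integral_FTC_Icc)
      fix t assume t: "t \<in> {?e..1}"
      then have "?e \<le> t" "t \<le> 1" by auto
      moreover from this have "t > 0" using e(1) by (meson less_le_trans)
      ultimately have t0: "t > 0" "ln t \<le> 0" by simp_all
      have "((\<lambda>t. 1 - ln t) has_real_derivative - (1 / t)) (at t)"
        using t0 by (auto intro!: derivative_eq_intros)
      from DERIV_cdivide[OF DERIV_fun_powr[OF this, of "1 - p"], of "p - 1"]
      have "((\<lambda>t. (1 - ln t) powr (1 - p) / (p - 1)) has_real_derivative
          ((1 - p) * (1 - ln t) powr (1 - p - 1) * (- (1 / t))) / (p - 1)) (at t)"
        using t0 by simp
      moreover have "((1 - p) * (1 - ln t) powr (1 - p - 1) * (- (1 / t))) / (p - 1) = t powr (- 1) * (1 - ln t) powr (- p)"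
      proof -
        let ?x = "(1 - ln t) powr (- p)"
        have "1 - p - 1 = - p" by simp
        moreover have "(1 - p) * ?x * (- (1 / t)) = (p - 1) * (?x * (1 / t))"
          by (simp add: algebra_simps add_divide_distrib diff_divide_distrib)
        ultimately have "((1 - p) * (1 - ln t) powr (1 - p - 1) * (- (1 / t))) / (p - 1) = (p - 1) * (?x * (1 / t)) / (p - 1)"
          by (simp only:)
        also have "\<dots> = ?x * (1 / t)" using p by simp
        also have "\<dots> = t powr (- 1) * ?x" using t0 by (simp add: powr_minus_divide)
        finally show ?thesis .
      qed
      ultimately show "((\<lambda>t. (1 - ln t) powr (1 - p) / (p - 1)) has_real_derivative t powr (- 1) * (1 - ln t) powr (- p)) (at t)"
        by simp
    qed (use e in auto)
    also have "\<dots> \<le> ennreal (1 / (p - 1))" using p by (intro ennreal_leI) auto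
    finally show ?thesis .
  qed
  have "(\<integral>\<^sup>+t. ennreal (t powr (- 1) * (1 - ln t) powr (- p)) * indicator {0<..<1} t \<partial>lborel) \<le> (\<integral>\<^sup>+t. liminf (\<lambda>n. ?g n t) \<partial>lborel)"
  proof (intro nn_integral_mono)
    fix t :: real
    show "ennreal (t powr (- 1) * (1 - ln t) powr (- p)) * indicator {0<..<1} t \<le> liminf (\<lambda>n. ?g n t)"
    proof (cases "t \<in> {0<..<1}")
      case True
      have "\<forall>\<^sub>F n in sequentially. 1 / real (Suc n) < t"
        using order_tendstoD(2)[OF LIMSEQ_inverse_real_of_nat, of t] True by (simp add: inverse_eq_divide)
      then have "\<forall>\<^sub>F n in sequentially. ennreal (t powr (- 1) * (1 - ln t) powr (- p)) \<le> ?g n t"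
        by eventually_elim (use True in auto)
      then show ?thesis using True by (simp add: Liminf_bounded)
    qed simp
  qed
  also have "\<dots> \<le> liminf (\<lambda>n. \<integral>\<^sup>+t. ?g n t \<partial>lborel)" by (rule nn_integral_liminf) measurable
  also have "\<dots> \<le> ennreal (1 / (p - 1))"
    using Liminf_mono[of "\<lambda>n. \<integral>\<^sup>+t. ?g n t \<partial>lborel" "\<lambda>_. ennreal (1 / (p - 1))" sequentially] b by (simp add: Liminf_const)
  finally show ?thesis .
qed

lemma log_weight_integral_infinite:
  "(\<integral>\<^sup>+t. ennreal (t powr (- 1) * (1 - ln t) powr (- 1)) * indicator {0<..<1} t \<partial>lborel) = \<infinity>" (is "?I = _")
proof (rule ccontr)
  assume "?I \<noteq> \<infinity>"
  then obtain r where r: "?I = ennreal r" "0 \<le> r" by (cases ?I) auto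
  \<comment> \<open>An antiderivative is \<open>- ln (1 - ln t)\<close>; this \<open>e\<close> makes
    the integral over [e, 1] exactly \<open>r + 1\<close>.\<close>
  define e where "e = exp (1 - exp (r + 1))"
  have "exp (r + 1) > 1" using r by simp
  then have e: "0 < e" "e < 1" "ln e = 1 - exp (r + 1)" by (auto simp: e_def)
  have "(\<integral>\<^sup>+t. ennreal (t powr (- 1) * (1 - ln t) powr (- 1)) * indicator {e..1} t \<partial>lborel) = ennreal (- ln (1 - ln 1) - (- ln (1 - ln e)))"
  proof (rule nn_integral_FTC_Icc)
    fix t assume t: "t \<in> {e..1}"
    then have "t > 0" "1 - ln t > 0" using e by (auto intro: le_less_trans[of _ 0])
    then show "((\<lambda>t. - ln (1 - ln t)) has_real_derivative t powr (- 1) * (1 - ln t) powr (- 1)) (at t)"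
      by (auto intro!: derivative_eq_intros simp: powr_minus_divide field_simps)
  qed (use e in auto)
  also have "\<dots> = ennreal (r + 1)" using e by (simp add: add.commute)
  finally have "ennreal (r + 1) = (\<integral>\<^sup>+t. ennreal (t powr (- 1) * (1 - ln t) powr (- 1)) * indicator {e..1} t \<partial>lborel)" ..
  also have "\<dots> \<le> ?I"
  proof (rule nn_integral_mono_AE)
    have "AE t in lborel. t \<noteq> (1::real)" by (rule AE_lborel_singleton)
    then show "AE t in lborel. ennreal (t powr (- 1) * (1 - ln t) powr (- 1)) * indicator {e..1} t \<le> ennreal (t powr (- 1) * (1 - ln t) powr (- 1)) * indicator {0<..<1::real} t"
      by eventually_elim (use e in \<open>auto simp: indicator_def\<close>)
  qed
  finally show False using r by simp
qed

text \<open>In the disc \<open>|1 - z * cnj w| <= 2\<close>, so the kernel cannot compensate a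
  non-integrable \<open>rho powr b * |f|\<close>. The integral then diverges at every
  \<open>z\<close>, which contradicts boundedness for any target norm.\<close>

lemma not_bounded_at_integrability_endpoint:
  assumes K_norm: "\<And>z w. norm (K z w) = rho w powr b * abs_kernel c z w" and c: "0 \<le> c"
    and b: "-1 < b" "b < 0"
  shows "\<not> maps_boundedly a K (Lp_norm (ereal (1 / (b + 1)))) NY"
proof
  assume bd: "maps_boundedly a K (Lp_norm (ereal (1 / (b + 1)))) NY"
  define p where "p = 1 / (b + 1)"
  have p: "p > 1" using b by (simp add: p_def field_simps)
  \<comment> \<open>The p-th power is \<open>t^(-1) (1 - ln t)^(-p)\<close>, integrable for
    \<open>p > 1\<close>, while \<open>t^b g(t) = t^(-1) (1 - ln t)^(-1)\<close> is not. Using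
    \<open>1 - ln t\<close> instead of \<open>- ln t\<close> avoids a singularity at
    \<open>t = 1\<close>.\<close>
  define g where "g = (\<lambda>t. t powr (- (b + 1)) * (1 - ln t) powr (- 1))"
  define f where "f = (\<lambda>w. complex_of_real (g (rho w)))"
  have [measurable]: "g \<in> borel_measurable borel" unfolding g_def by measurable
  have f [measurable]: "f \<in> borel_measurable dA" unfolding f_def by measurable
  have g0: "0 \<le> g t" for t by (simp add: g_def)
  have nf: "norm (f w) = g (rho w)" for w using g0 by (simp add: f_def)
  have "Lp_integral p f = (\<integral>\<^sub>D w. (\<lambda>t. ennreal (g t powr p)) (rho w))"
    by (simp add: nf)
  also have "\<dots> = (\<integral>\<^sup>+t. ennreal (g t powr p) * indicator {0<..<1} t \<partial>lborel)"
    by (rule nn_integral_dA_rho) measurable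
  also have "\<dots> = (\<integral>\<^sup>+t. ennreal (t powr (- 1) * (1 - ln t) powr (- p)) * indicator {0<..<1} t \<partial>lborel)"
  proof (intro nn_integral_cong)
    fix t :: real
    have "- (b + 1) * p = - 1" using b by (simp add: p_def field_simps)
    then have "g t powr p = t powr (- 1) * (1 - ln t) powr (- p)" if "t \<in> {0<..<1}"
    proof -
      have "g t powr p = (t powr (- (b + 1))) powr p * ((1 - ln t) powr (- 1)) powr p"
        unfolding g_def by (rule powr_mult)
      also have "\<dots> = t powr (- (b + 1) * p) * (1 - ln t) powr (- 1 * p)" by (simp only: powr_powr)
      finally show ?thesis using \<open>- (b + 1) * p = - 1\<close> by simp
    qed
    then show "ennreal (g t powr p) * indicator {0<..<1} t = ennreal (t powr (- 1) * (1 - ln t) powr (- p)) * indicator {0<..<1} t"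
      by (cases "t \<in> {0<..<1}") simp_all
  qed
  also have "\<dots> \<le> ennreal (1 / (p - 1))" by (rule log_weight_integral_bounded[OF p])
  finally have "Lp_integral p f < \<infinity>" by (rule le_less_trans) simp
  then have "Lp_norm (ereal p) f < \<infinity>" by (auto simp: Lp_norm_def Let_def)
  then have AE: "AE z in dA. integrable dA (\<lambda>w. K z w * f w)"
    using bd f unfolding maps_boundedly_def p_def by blast
  have not_int: "\<not> integrable dA (\<lambda>w. K z w * f w)" if z: "z \<in> space dA" for z
  proof
    assume "integrable dA (\<lambda>w. K z w * f w)"
    then have fin: "(\<integral>\<^sub>D w. ennreal (norm (K z w * f w))) < \<infinity>" by (simp add: integrable_iff_bounded)
    have "ennreal (2 powr (- c)) * (\<integral>\<^sub>D w. (\<lambda>t. ennreal (t powr (- 1) * (1 - ln t) powr (- 1))) (rho w)) =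
      (\<integral>\<^sub>D w. ennreal (2 powr (- c)) * (\<lambda>t. ennreal (t powr (- 1) * (1 - ln t) powr (- 1))) (rho w))"
      by (rule nn_integral_cmult[symmetric]) measurable
    also have "\<dots> \<le> (\<integral>\<^sub>D w. ennreal (norm (K z w * f w)))"
    proof (intro nn_integral_mono)
      fix w assume w: "w \<in> space dA"
      have rw: "rho w > 0" using rho_bounds(1) w by auto
      have "2 powr (- c) \<le> abs_kernel c z w"
        using one_minus_mult_cnj_bounds(2,3)[of z w] z w c by (intro powr_mono2') auto
      then have "2 powr (- c) * (rho w powr b * g (rho w)) \<le> abs_kernel c z w * (rho w powr b * g (rho w))"
        by (intro mult_right_mono) (auto simp: g_def)
      also have "\<dots> = norm (K z w * f w)" by (simp add: norm_mult K_norm nf)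
      also have "rho w powr b * g (rho w) = rho w powr (- 1) * (1 - ln (rho w)) powr (- 1)"
        by (simp add: g_def mult.assoc[symmetric] flip: powr_add)
      finally show "ennreal (2 powr (- c)) * ennreal (rho w powr (- 1) * (1 - ln (rho w)) powr (- 1)) \<le> ennreal (norm (K z w * f w))"
        by (subst ennreal_mult'[symmetric]) (auto intro: ennreal_leI)
    qed
    also note fin
    also have "(\<integral>\<^sub>D w. (\<lambda>t. ennreal (t powr (- 1) * (1 - ln t) powr (- 1))) (rho w)) = \<infinity>"
      by (subst nn_integral_dA_rho) (measurable, rule log_weight_integral_infinite)
    finally show False by (simp add: ennreal_mult_top)
  qed
  have "AE z in dA. False" using AE AE_space by eventually_elim (use not_int in blast)
  then show False by (simp add: dA.AE_False)
qed

lemma Lp_weak_bounded_imp: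
  assumes p: "p \<ge> 1" and bd: "maps_boundedly a K (Lp_norm (ereal p)) (Lweak_norm (ereal q))"
  obtains C where "C \<ge> 0" "\<And>f t A. f \<in> borel_measurable dA \<Longrightarrow> t > 0 \<Longrightarrow> A \<ge> 0 \<Longrightarrow>
    (Lp_integral p f) \<le> ennreal A \<Longrightarrow>
    t * dist_fun (weighted_op a K f) t powr (1 / q) \<le> C * A powr (1 / p)"
proof -
  obtain C where C: "\<And>f. f \<in> borel_measurable dA \<Longrightarrow> Lp_norm (ereal p) f < \<infinity> \<Longrightarrow>
    Lweak_norm (ereal q) (weighted_op a K f) \<le> ennreal C * Lp_norm (ereal p) f"
    using bd unfolding maps_boundedly_def by blast
  show ?thesis
  proof (rule that[of "max 0 C"])
    fix f :: "complex \<Rightarrow> complex" and t A :: real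
    assume f: "f \<in> borel_measurable dA" and t: "t > 0" and A: "A \<ge> 0"
      and fA: "Lp_integral p f \<le> ennreal A"
    have "enn2real (Lp_integral p f) \<le> A" using fA A by (intro enn2real_leI) auto
    then have le: "enn2real (Lp_integral p f) powr (1 / p) \<le> A powr (1 / p)"
      using p by (intro powr_mono2) auto
    have "Lp_integral p f \<noteq> top" using fA by (auto simp: top_unique)
    then have L: "Lp_norm (ereal p) f \<le> ennreal (A powr (1 / p))" using le
      by (auto simp: Lp_norm_def Let_def intro!: ennreal_leI)
    have "ennreal (t * dist_fun (weighted_op a K f) t powr (1 / q)) \<le> Lweak_norm (ereal q) (weighted_op a K f)"
      unfolding Lweak_norm_def using t by (auto intro!: SUP_upper2[of t])
    also have "\<dots> \<le> ennreal C * Lp_norm (ereal p) f"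
      using L by (intro C f) (auto intro: le_less_trans)
    also have "\<dots> \<le> ennreal (max 0 C) * ennreal (A powr (1 / p))"
      by (intro mult_mono L ennreal_leI) auto
    also have "\<dots> = ennreal (max 0 C * A powr (1 / p))" by (rule ennreal_mult[symmetric]) auto
    finally show "t * dist_fun (weighted_op a K f) t powr (1 / q) \<le> max 0 C * A powr (1 / p)"
      by (subst (asm) ennreal_le_iff) auto
  qed auto
qed

lemma emeasure_rho_le:
  assumes "0 \<le> x" "x < 1"
  shows "emeasure dA {z \<in> space dA. rho z \<le> x} = ennreal x"
proof -
  have "{z \<in> space dA. rho z \<le> x} \<in> sets dA" by measurable
  then have "emeasure dA {z \<in> space dA. rho z \<le> x} = (\<integral>\<^sub>D z. indicator {..x} (rho z))"
    by (subst nn_integral_indicator[symmetric]) (simp, rule nn_integral_cong, simp add: indicator_def)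
  also have "\<dots> = (\<integral>\<^sup>+t. indicator {..x} t * indicator {0<..<1} t \<partial>lborel)"
    by (rule nn_integral_dA_rho) simp
  also have "\<dots> = (\<integral>\<^sup>+t. indicator {0<..x} t \<partial>lborel)"
    using assms by (intro nn_integral_cong) (auto simp: indicator_def)
  also have "\<dots> = ennreal x" using assms by simp
  finally show ?thesis .
qed

lemma powr_growth_contradiction:
  fixes u v k C :: real
  assumes "u < v" "k > 0" and le: "\<And>n. n \<ge> 1 \<Longrightarrow> k * real n powr v \<le> C * real n powr u"
  shows False
proof -
  have "filterlim (\<lambda>n. real n powr (v - u)) at_top sequentially"
    using assms(1) by real_asymp
  then have "\<forall>\<^sub>F n in sequentially. C / k < real n powr (v - u)" by (simp add: filterlim_at_top_dense)
  then have "\<forall>\<^sub>F n in sequentially. False"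
    using eventually_ge_at_top[of 1]
  proof eventually_elim
    case (elim n)
    have "C * real n powr u < k * real n powr (v - u) * real n powr u"
      using elim assms(2) by (intro mult_strict_right_mono) (auto simp: field_simps)
    also have "\<dots> = k * real n powr v" by (simp add: mult.assoc flip: powr_add)
    finally show ?case using le[of n] elim by simp
  qed
  then show False by simp
qed

text \<open>Truncating \<open>rho powr (- d)\<close> at \<open>rho = e\<close> gives an input with
  p-th power integral at most L = ln (1 / e). The output is at least a multiple of
  \<open>e powr a * L\<close> on a ring of area \<open>e\<close>, so boundedness would make L at
  most a multiple of L^d for all L.\<close>

lemma S_not_bounded_endpoint:
  assumes c: "c > 1" and d: "0 < 2 - c + b" "2 - c + b < 1" and a: "- a > 2 - c + b"
  shows "\<not> S_bounded a b c (Lp_norm (ereal (1 / (2 - c + b)))) (Lweak_norm (ereal (- 1 / a)))"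
proof
  define d where "d = 2 - c + b"
  define p where "p = 1 / d"
  define q where "q = - 1 / a"
  note dd = d[folded d_def] a[folded d_def]
  have a0: "a < 0" using dd by linarith
  have p1: "p \<ge> 1" "1 / p = d" using dd by (auto simp: p_def field_simps)
  have q: "1 / q = - a" using a0 by (simp add: q_def)
  assume "S_bounded a b c (Lp_norm (ereal (1 / (2 - c + b)))) (Lweak_norm (ereal (- 1 / a)))"
  then have "maps_boundedly a (S_kernel b c) (Lp_norm (ereal p)) (Lweak_norm (ereal q))"
    by (simp add: S_bounded_def p_def q_def d_def)
  then obtain C where C: "C \<ge> 0" and Cb: "\<And>f t A. f \<in> borel_measurable dA \<Longrightarrow> t > 0 \<Longrightarrow> A \<ge> 0 \<Longrightarrow>
    (Lp_integral p f) \<le> ennreal A \<Longrightarrow>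
    t * dist_fun (weighted_op a (S_kernel b c) f) t powr (1 / q) \<le> C * A powr (1 / p)"
    using Lp_weak_bounded_imp[OF p1(1)] by blast
  obtain m M where kb: "kernel_bounds c m M" using kernel_bounds_exist[OF c] by blast
  then interpret kernel_bounds c m M .
  note m = m_pos
  \<comment> \<open>For \<open>rho z <= e <= t\<close> one has \<open>t + rho z <= 2 * t\<close>,
    which costs the factor \<open>2 powr (1 - c)\<close> in the lower kernel bound.\<close>
  define k where "k = m * 2 powr (1 - c)"
  have k: "k > 0" using m by (simp add: k_def)
  have main: "k / 2 * L \<le> C * L powr d" if L: "L > 0" for L
  proof -
    define e where "e = exp (- L)"
    have e: "0 < e" "e < 1" and lne: "ln (1 / e) = L" using L by (auto simp: e_def ln_div)
    define g where "g = (\<lambda>t. t powr (- d) * indicator {e..1} t)"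
    define f where "f = (\<lambda>w. complex_of_real (g (rho w)))"
    have [measurable]: "g \<in> borel_measurable borel" unfolding g_def by measurable
    have f [measurable]: "f \<in> borel_measurable dA" unfolding f_def by measurable
    have g0: "g t \<ge> 0" for t by (simp add: g_def)
    have nf: "norm (f w) = g (rho w)" for w using g0 by (simp add: f_def)
    have fA: "Lp_integral p f \<le> ennreal L"
    proof -
      have "Lp_integral p f = (\<integral>\<^sub>D w. (\<lambda>t. ennreal (g t powr p)) (rho w))" by (simp add: nf)
      also have "\<dots> = (\<integral>\<^sup>+t. ennreal (g t powr p) * indicator {0<..<1} t \<partial>lborel)"
        by (rule nn_integral_dA_rho) measurable
      also have "\<dots> \<le> (\<integral>\<^sup>+t. ennreal (t powr (- 1)) * indicator {e..1} t \<partial>lborel)"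
        using e dd by (intro nn_integral_mono) (auto simp: g_def indicator_def powr_powr p_def)
      also have "\<dots> = ennreal L" using nn_integral_inverse_Icc[of e] e lne by simp
      finally show ?thesis .
    qed
    have lower: "e powr a * (k * L) \<le> norm (weighted_op a (S_kernel b c) f z)" if z: "z \<in> space dA" and rz: "rho z \<le> e" for z
    proof -
      have rz0: "rho z > 0" using rho_bounds(1) z by auto
      let ?G = "\<lambda>w. rho w powr b * abs_kernel c z w * g (rho w)"
      have "ennreal (k * L) = ennreal m * (ennreal (2 powr (1 - c)) * (\<integral>\<^sup>+t. ennreal (t powr (- 1)) * indicator {e..1} t \<partial>lborel))"
        using nn_integral_inverse_Icc[of e] e lne m L by (simp add: k_def mult.assoc flip: ennreal_mult)
      also have "ennreal (2 powr (1 - c)) * (\<integral>\<^sup>+t. ennreal (t powr (- 1)) * indicator {e..1} t \<partial>lborel) =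
        (\<integral>\<^sup>+t. ennreal (2 powr (1 - c)) * (ennreal (t powr (- 1)) * indicator {e..1} t) \<partial>lborel)"
        by (rule nn_integral_cmult[symmetric]) measurable
      also have "\<dots> \<le> (\<integral>\<^sup>+t. (\<lambda>t. ennreal (t powr b * g t)) t * ennreal ((t + rho z) powr (1 - c)) * indicator {0<..<1} t \<partial>lborel)"
      proof (rule nn_integral_mono_AE)
        have "AE t in lborel. t \<noteq> (1::real)" by (rule AE_lborel_singleton)
        then show "AE t in lborel. ennreal (2 powr (1 - c)) * (ennreal (t powr (- 1)) * indicator {e..1} t) \<le> (\<lambda>t. ennreal (t powr b * g t)) t * ennreal ((t + rho z) powr (1 - c)) * indicator {0<..<1} t"
        proof eventually_elim
          fix t :: real assume t1: "t \<noteq> 1"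
          show "ennreal (2 powr (1 - c)) * (ennreal (t powr (- 1)) * indicator {e..1} t) \<le> (\<lambda>t. ennreal (t powr b * g t)) t * ennreal ((t + rho z) powr (1 - c)) * indicator {0<..<1} t"
          proof (cases "t \<in> {e..1}")
            case True
            then have t: "0 < t" "t < 1" "e \<le> t" using e t1 by auto
            have "2 powr (1 - c) * t powr (- 1) = t powr b * t powr (- d) * (2 * t) powr (1 - c)"
            proof -
              have "t powr b * t powr (- d) * (2 * t) powr (1 - c) = 2 powr (1 - c) * (t powr b * t powr (- d) * t powr (1 - c))"
                using t by (simp add: powr_mult)
              also have "t powr b * t powr (- d) * t powr (1 - c) = t powr (- 1)" by (simp add: d_def flip: powr_add)
              finally show ?thesis ..
            qed
            also have "\<dots> \<le> t powr b * t powr (- d) * (t + rho z) powr (1 - c)"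
              using t rz rz0 c by (intro mult_left_mono powr_mono2') auto
            finally have "ennreal (2 powr (1 - c) * t powr (- 1)) \<le> ennreal (t powr b * g t * (t + rho z) powr (1 - c))"
              using True by (intro ennreal_leI) (simp add: g_def)
            then show ?thesis using True t g0 by (simp flip: ennreal_mult)
          qed simp
        qed
      qed
      also have "ennreal m * \<dots> \<le> (\<integral>\<^sub>D w. (\<lambda>t. ennreal (t powr b * g t)) (rho w) * ennreal (abs_kernel c z w))"
        using lower[of z "\<lambda>t. ennreal (t powr b * g t)"] z by simp
      also have "\<dots> = (\<integral>\<^sub>D w. ennreal (?G w))"
        using g0 by (intro nn_integral_cong) (simp add: mult_ac flip: ennreal_mult)
      finally have le: "ennreal (k * L) \<le> (\<integral>\<^sub>D w. ennreal (?G w))" by (simp add: mult_left_mono)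
      have int: "integrable dA ?G"
      proof (rule dA.integrable_const_bound[where B = "(1 + e powr b) * (1 - norm z) powr (- c) * e powr (- d)"], rule AE_I2)
        fix w assume w: "w \<in> space dA"
        have k1: "abs_kernel c z w \<le> (1 - norm z) powr (- c)"
          using z w c one_minus_mult_cnj_bounds(1)[of z w] by (intro powr_mono2') auto
        show "norm (?G w) \<le> (1 + e powr b) * (1 - norm z) powr (- c) * e powr (- d)"
        proof (cases "e \<le> rho w")
          case True
          have rw: "rho w \<le> 1" by (rule rho_bounds)
          have k2: "rho w powr b \<le> 1 + e powr b"
          proof (cases "b \<ge> 0")
            case True
            then have "rho w powr b \<le> 1" using rw \<open>e \<le> rho w\<close> e by (intro powr_le1) auto
            then show ?thesis by (simp add: add_increasing2)
          next
            case False
            then have "rho w powr b \<le> e powr b" using \<open>e \<le> rho w\<close> e by (intro powr_mono2') auto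
            then show ?thesis by simp
          qed
          have k3: "g (rho w) \<le> e powr (- d)"
            unfolding g_def using True rw e dd by (auto intro!: powr_mono2')
          have "?G w \<le> (1 + e powr b) * (1 - norm z) powr (- c) * e powr (- d)"
            by (intro mult_mono k1 k2 k3 mult_nonneg_nonneg g0) auto
          then show ?thesis using g0 by (simp add: abs_mult)
        qed (simp add: g_def)
      qed measurable
      have "ennreal (k * L) \<le> ennreal (integral\<^sup>L dA ?G)"
        using le by (subst (asm) nn_integral_eq_integral[OF int]) (auto simp: g0)
      then have "k * L \<le> integral\<^sup>L dA ?G"
        by (subst (asm) ennreal_le_iff) (auto intro!: integral_nonneg_AE simp: g0)
      moreover have "(LINT w|dA. S_kernel b c z w * f w) = complex_of_real (integral\<^sup>L dA ?G)"
        by (subst integral_complex_of_real[symmetric])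
           (auto intro!: Bochner_Integration.integral_cong simp: S_kernel_def f_def rho_def powr_minus_divide)
      moreover have "e powr a \<le> rho z powr a" using rz rz0 a0 by (intro powr_mono2') auto
      moreover have "0 \<le> k * L" using k L by simp
      ultimately show ?thesis
        unfolding weighted_op_def rho_def[of z, symmetric] by (auto simp: norm_mult intro!: mult_mono)
    qed
    \<comment> \<open>Half of the lower bound, because the level sets in \<open>dist_fun\<close> are
      defined by a strict inequality.\<close>
    define t where "t = e powr a * (k * L) / 2"
    have t: "t > 0" using e k L by (simp add: t_def)
    have "t < e powr a * (k * L)" using e k L by (simp add: t_def)
    have mdist: "e \<le> dist_fun (weighted_op a (S_kernel b c) f) t"
    proof -
      have "e = measure dA {z \<in> space dA. rho z \<le> e}"
        using emeasure_rho_le[of e] e by (simp add: measure_def)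
      also have "\<dots> \<le> dist_fun (weighted_op a (S_kernel b c) f) t"
        unfolding dist_fun_def
      proof (rule dA.finite_measure_mono)
        show "{z \<in> space dA. rho z \<le> e} \<subseteq> {z \<in> space dA. t < norm (weighted_op a (S_kernel b c) f z)}"
          using lower \<open>t < _\<close> by force
        have "weighted_op a (S_kernel b c) f \<in> borel_measurable dA"
          by (rule weighted_op_measurable[OF f S_kernel_measurable])
        then show "{z \<in> space dA. t < norm (weighted_op a (S_kernel b c) f z)} \<in> sets dA" by measurable
      qed
      finally show ?thesis .
    qed
    have "k / 2 * L = t * e powr (- a)" using e by (simp add: t_def powr_minus field_simps)
    also have "\<dots> \<le> t * dist_fun (weighted_op a (S_kernel b c) f) t powr (1 / q)"
      unfolding q using mdist e t a0 by (intro mult_left_mono powr_mono2) auto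
    also have "\<dots> \<le> C * L powr (1 / p)" by (rule Cb[OF f t _ fA]) (use L in simp)
    finally show ?thesis by (simp add: p1)
  qed
  show False
    by (rule powr_growth_contradiction[of d 1 "k / 2" C]) (use main dd k in auto)
qed

section \<open>Lacunary polynomials and the failure of the endpoint for \<open>T\<close>\<close>

lemma one_minus_inverse_power_ge:
  fixes t :: real
  assumes "1 \<le> k" "0 \<le> t" "t \<le> 1 / 2 ^ k"
  shows "1 / 4 \<le> (1 - t) ^ (2 ^ k)"
proof -
  obtain j where k: "k = Suc j" using assms(1) by (cases k) auto
  have t1: "t \<le> 1" using assms(3) by (rule order_trans) simp
  have "real (2 ^ j) * t \<le> real (2 ^ j) * (1 / 2 ^ k)" using assms(3) by (intro mult_left_mono) auto
  also have "\<dots> = 1 / 2" by (simp add: k)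
  finally have "1 / 2 \<le> 1 + real (2 ^ j) * (- t)" by simp
  \<comment> \<open>With the full exponent Bernoulli's inequality would only give 0 at
    \<open>t = 1 / 2 ^ k\<close>. Half the exponent gives 1 / 2, and squaring yields 1 / 4.\<close>
  also have "\<dots> \<le> (1 + - t) ^ (2 ^ j)" using t1 by (intro Bernoulli_inequality) auto
  finally have "(1 / 2)\<^sup>2 \<le> ((1 - t) ^ (2 ^ j))\<^sup>2" by (intro power_mono) auto
  also have "\<dots> = (1 - t) ^ (2 ^ k)" by (simp add: k mult.commute flip: power_mult)
  finally show ?thesis by (simp add: power2_eq_square)
qed

text \<open>For \<open>k <= l\<close> the sum lies above \<open>2 ^ l\<close> and not above
  \<open>2 ^ Suc l\<close>, which determines \<open>l\<close>, and then \<open>k\<close>.\<close>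

lemma inj_on_sum_two_powers:
  "inj_on (\<lambda>(l, k). (2::nat) ^ k + 2 ^ l) (SIGMA l:UNIV. {..l})"
proof (rule inj_onI, clarsimp)
  fix l k l' k' :: nat
  assume kl: "k \<le> l" "k' \<le> l'" and eq: "(2::nat) ^ k + 2 ^ l = 2 ^ k' + 2 ^ l'"
  have *: "\<not> l < l'" if "k \<le> l" "k' \<le> l'" "(2::nat) ^ k + 2 ^ l = 2 ^ k' + 2 ^ l'" for l k l' k' :: nat
  proof
    assume "l < l'"
    have "(2::nat) ^ l' < 2 ^ k' + 2 ^ l'" by simp
    also have "\<dots> = 2 ^ k + 2 ^ l" using that by simp
    also have "\<dots> \<le> 2 ^ l + 2 ^ l" using that(1) by (intro add_mono power_increasing) auto
    also have "\<dots> = 2 ^ Suc l" by simp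
    also have "(2::nat) ^ Suc l \<le> 2 ^ l'" using \<open>l < l'\<close> by (intro power_increasing) auto
    finally show False by simp
  qed
  have "l = l'" using *[OF kl eq] *[OF kl(2,1) eq[symmetric]] by simp
  then show "l = l' \<and> k = k'" using eq by simp
qed

text \<open>Restricting to \<open>k <= l\<close> merges equal cross terms, so that after the
  substitution of lacunary monomials every exponent occurs once.\<close>

lemma square_sum_triangle:
  fixes x :: "nat \<Rightarrow> complex"
  shows "(\<Sum>l<N. x l)\<^sup>2 = (\<Sum>(l, k)\<in>(SIGMA l:{..<N}. {..l}). (if k < l then 2 else 1) * (x k * x l))"
proof -
  have "(\<Sum>l<N. x l)\<^sup>2 = (\<Sum>l<N. \<Sum>k\<le>l. (if k < l then 2 else 1) * (x k * x l))"
  proof (induction N)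
    case (Suc N)
    have "(\<Sum>k\<le>N. (if k < N then 2 else 1) * (x k * x N)) = (\<Sum>k<N. (if k < N then 2 else 1) * (x k * x N)) + x N * x N"
      by (simp add: lessThan_Suc_atMost[symmetric])
    also have "(\<Sum>k<N. (if k < N then 2 else 1) * (x k * x N)) = (\<Sum>k<N. 2 * x N * x k)"
      by (intro sum.cong) auto
    also have "\<dots> = 2 * x N * (\<Sum>k<N. x k)" by (simp add: sum_distrib_left)
    finally have S: "(\<Sum>k\<le>N. (if k < N then 2 else 1) * (x k * x N)) = 2 * x N * (\<Sum>k<N. x k) + x N * x N" .
    have "(\<Sum>l<Suc N. x l)\<^sup>2 = (\<Sum>l<N. x l)\<^sup>2 + (2 * x N * (\<Sum>k<N. x k) + x N * x N)"
      by (simp add: power2_eq_square algebra_simps)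
    then show ?case unfolding Suc.IH S[symmetric] by simp
  qed simp
  then show ?thesis by (simp add: sum.Sigma)
qed

text \<open>
  The fourth moment is controlled by squaring the sum: the exponents \<open>2 ^ k + 2 ^ l\<close>
  with \<open>k \<le> l\<close> are distinct, so Parseval applies to the square as well.
\<close>

lemma lacunary_moments:
  fixes \<phi> :: "real \<Rightarrow> real" and \<beta> :: "nat \<Rightarrow> real"
  assumes [measurable]: "\<phi> \<in> borel_measurable borel" and int: "integrable dA (\<lambda>w. \<phi> (rho w))" and \<phi>: "\<And>t. 0 \<le> \<phi> t"
  shows "(LINT z|dA. \<phi> (rho z) * (norm (\<Sum>k<N. of_real (\<beta> k) * z ^ (2 ^ k)))\<^sup>2) =
      (\<Sum>k<N. (\<beta> k)\<^sup>2 * (LINT z|dA. \<phi> (rho z) * norm z ^ (2 * 2 ^ k)))"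
    and "(LINT z|dA. \<phi> (rho z) * (norm (\<Sum>k<N. of_real (\<beta> k) * z ^ (2 ^ k))) ^ 4) \<le>
      4 * (\<Sum>k<N. (\<beta> k)\<^sup>2)\<^sup>2 * (LINT z|dA. \<phi> (rho z))"
proof -
  have "inj_on (\<lambda>k. (2::nat) ^ k) {..<N}" by (auto simp: inj_on_def)
  from parseval_finite[OF assms(1) int _ this, of "\<lambda>k. of_real (\<beta> k)"]
  show "(LINT z|dA. \<phi> (rho z) * (norm (\<Sum>k<N. of_real (\<beta> k) * z ^ (2 ^ k)))\<^sup>2) =
      (\<Sum>k<N. (\<beta> k)\<^sup>2 * (LINT z|dA. \<phi> (rho z) * norm z ^ (2 * 2 ^ k)))" by simp
  define I where "I = (SIGMA l:{..<N}. {..l})"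
  define e where "e = (\<lambda>(l, k). (2::nat) ^ k + 2 ^ l)"
  define g where "g = (\<lambda>(l::nat, k::nat). complex_of_real ((if k < l then 2 else 1) * (\<beta> k * \<beta> l)))"
  have I: "finite I" "I \<subseteq> (SIGMA l:UNIV. {..l})" "I \<subseteq> {..<N} \<times> {..<N}" by (auto simp: I_def)
  have sq: "(\<Sum>k<N. of_real (\<beta> k) * z ^ (2 ^ k))\<^sup>2 = (\<Sum>i\<in>I. g i * z ^ e i)" for z
    unfolding square_sum_triangle I_def[symmetric]
    by (intro sum.cong refl) (auto simp: g_def e_def power_add)
  have F4: "(norm (\<Sum>k<N. of_real (\<beta> k) * z ^ (2 ^ k))) ^ 4 = (norm (\<Sum>i\<in>I. g i * z ^ e i))\<^sup>2" for z
    unfolding sq[symmetric] by (simp add: norm_power flip: power_mult)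
  have im: "integrable dA (\<lambda>z. \<phi> (rho z) * norm z ^ n)" for n
    by (rule Bochner_Integration.integrable_bound[OF int]) (auto simp: abs_mult power_le_one \<phi> mult_left_le)
  have "(LINT z|dA. \<phi> (rho z) * (norm (\<Sum>i\<in>I. g i * z ^ e i))\<^sup>2) =
      (\<Sum>i\<in>I. (norm (g i))\<^sup>2 * (LINT z|dA. \<phi> (rho z) * norm z ^ (2 * e i)))"
    by (rule parseval_finite[OF assms(1) int I(1)])
       (use inj_on_subset[OF inj_on_sum_two_powers I(2)] in \<open>simp add: e_def\<close>)
  also have "\<dots> \<le> (\<Sum>i\<in>I. (norm (g i))\<^sup>2 * (LINT z|dA. \<phi> (rho z)))"
    by (intro sum_mono mult_left_mono integral_mono im int) (auto simp: power_le_one \<phi> mult_left_le)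
  also have "\<dots> = (\<Sum>i\<in>I. (norm (g i))\<^sup>2) * (LINT z|dA. \<phi> (rho z))" by (simp add: sum_distrib_right)
  also have "\<dots> \<le> (4 * (\<Sum>k<N. (\<beta> k)\<^sup>2)\<^sup>2) * (LINT z|dA. \<phi> (rho z))"
  proof (rule mult_right_mono)
    have "(\<Sum>i\<in>I. (norm (g i))\<^sup>2) \<le> (\<Sum>i\<in>I. 4 * (case i of (l, k) \<Rightarrow> (\<beta> l)\<^sup>2 * (\<beta> k)\<^sup>2))"
    proof (intro sum_mono)
      fix i assume "i \<in> I"
      obtain l k where i: "i = (l, k)" by force
      have "norm (g i) \<le> 2 * \<bar>\<beta> k * \<beta> l\<bar>" by (simp add: g_def i norm_mult abs_mult)
      then have "(norm (g i))\<^sup>2 \<le> (2 * \<bar>\<beta> k * \<beta> l\<bar>)\<^sup>2" by (intro power_mono) auto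
      then show "(norm (g i))\<^sup>2 \<le> 4 * (case i of (l, k) \<Rightarrow> (\<beta> l)\<^sup>2 * (\<beta> k)\<^sup>2)"
        by (simp add: i power_mult_distrib mult_ac)
    qed
    also have "\<dots> \<le> (\<Sum>i\<in>{..<N} \<times> {..<N}. 4 * (case i of (l, k) \<Rightarrow> (\<beta> l)\<^sup>2 * (\<beta> k)\<^sup>2))"
      using I by (intro sum_mono2) auto
    also have "\<dots> = 4 * (\<Sum>l<N. \<Sum>k<N. (\<beta> l)\<^sup>2 * (\<beta> k)\<^sup>2)"
      by (simp only: sum.cartesian_product sum_distrib_left)
    also have "\<dots> = 4 * (\<Sum>k<N. (\<beta> k)\<^sup>2)\<^sup>2"
      by (simp only: power2_eq_square[of "\<Sum>k<N. (\<beta> k)\<^sup>2"] sum_product)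
    finally show "(\<Sum>i\<in>I. (norm (g i))\<^sup>2) \<le> 4 * (\<Sum>k<N. (\<beta> k)\<^sup>2)\<^sup>2" .
    show "0 \<le> (LINT z|dA. \<phi> (rho z))" by (intro integral_nonneg_AE) (simp add: \<phi>)
  qed
  finally show "(LINT z|dA. \<phi> (rho z) * (norm (\<Sum>k<N. of_real (\<beta> k) * z ^ (2 ^ k))) ^ 4) \<le>
      4 * (\<Sum>k<N. (\<beta> k)\<^sup>2)\<^sup>2 * (LINT z|dA. \<phi> (rho z))" by (simp only: F4)
qed

text \<open>A radial function times \<open>w ^ n\<close> is orthogonal to every monomial except the
  n-th, so the power series of the output has a single term.\<close>

lemma T_integral_monomial:
  fixes \<phi> :: "real \<Rightarrow> real"
  assumes c: "c > 0" and z: "z \<in> ball 0 1" and [measurable]: "\<phi> \<in> borel_measurable borel"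
    and int: "integrable dA (\<lambda>w. rho w powr b * \<phi> (rho w))"
  shows "integrable dA (\<lambda>w. T_kernel b c z w * (of_real (\<phi> (rho w)) * w ^ n))"
    "(LINT w|dA. T_kernel b c z w * (of_real (\<phi> (rho w)) * w ^ n)) =
      of_real (bcoeff c n * (LINT w|dA. rho w powr b * \<phi> (rho w) * norm w ^ (2 * n))) * z ^ n"
proof -
  let ?f = "\<lambda>w. of_real (\<phi> (rho w)) * w ^ n :: complex"
  have f: "?f \<in> borel_measurable dA" by measurable
  have if': "integrable dA (\<lambda>w. of_real (rho w powr b) * ?f w)"
  proof (rule Bochner_Integration.integrable_bound[OF int])
    show "AE w in dA. norm (of_real (rho w powr b) * ?f w) \<le> norm (rho w powr b * \<phi> (rho w))"
      by (rule AE_I2) (auto simp: norm_mult norm_power abs_mult power_le_one mult_left_le mult.assoc[symmetric])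
  qed measurable
  show "integrable dA (\<lambda>w. T_kernel b c z w * ?f w)"
    by (rule weight_integrable_imp_kernel_integrable[OF T_kernel_measurable norm_kernels(2) _ z f if']) (use c in simp)
  have coeff: "(LINT w|dA. of_real (rho w powr b) * cnj w ^ m * ?f w) =
      (if m = n then of_real (LINT w|dA. rho w powr b * \<phi> (rho w) * norm w ^ (2 * n)) else 0)" for m
  proof -
    have eq: "of_real (rho w powr b) * cnj w ^ m * ?f w = of_real ((\<lambda>t. t powr b * \<phi> t) (rho w)) * (w ^ n * cnj w ^ m)" for w
      by (simp add: mult_ac)
    show ?thesis
    proof (cases "m = n")
      case True
      have "of_real (rho w powr b) * cnj w ^ m * ?f w = complex_of_real (rho w powr b * \<phi> (rho w) * norm w ^ (2 * n))" for w
      proof -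
        have "w ^ n * cnj w ^ n = of_real (norm w ^ (2 * n))"
          by (simp add: power_mult complex_norm_square flip: power_mult_distrib del: of_real_power)
             (simp add: complex_norm_square[symmetric])
        then show ?thesis unfolding eq True by (simp add: mult.commute[of "cnj w ^ n"])
      qed
      then show ?thesis using True by (simp only: integral_complex_of_real if_True simp_thms)
    next
      case False
      then show ?thesis unfolding eq
        using integral_dA_monomials_orthogonal[of "\<lambda>t. t powr b * \<phi> t" n m] by simp
    qed
  qed
  have "(\<lambda>m. if m = n then of_real (bcoeff c n * (LINT w|dA. rho w powr b * \<phi> (rho w) * norm w ^ (2 * n))) * z ^ n else 0) sums
      (LINT w|dA. T_kernel b c z w * ?f w)"
    using T_integral_power_series[OF c z f if'] unfolding coeff
    by (rule arg_cong[where f = "\<lambda>s. s sums _", THEN iffD1, rotated]) auto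
  moreover have "(\<lambda>m. if m = n then of_real (bcoeff c n * (LINT w|dA. rho w powr b * \<phi> (rho w) * norm w ^ (2 * n))) * z ^ n else 0) sums
      (of_real (bcoeff c n * (LINT w|dA. rho w powr b * \<phi> (rho w) * norm w ^ (2 * n))) * z ^ n)"
    by (rule sums_single)
  ultimately show "(LINT w|dA. T_kernel b c z w * ?f w) =
      of_real (bcoeff c n * (LINT w|dA. rho w powr b * \<phi> (rho w) * norm w ^ (2 * n))) * z ^ n"
    by (rule sums_unique2)
qed

text \<open>
  Paley--Zygmund: a lower bound for the second moment and an upper bound for the fourth one force
  \<open>|F|\<close> to be large on a fixed proportion of the ring.
\<close>

lemma lacunary_large_on_ring:
  fixes \<beta> :: "nat \<Rightarrow> real" and N :: nat
  defines "F \<equiv> \<lambda>z. \<Sum>k<N. complex_of_real (\<beta> k) * z ^ (2 ^ k)"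
    and "S \<equiv> \<Sum>k<N. (\<beta> k)\<^sup>2"
  assumes N: "N \<ge> 1" and S: "S > 0"
  shows "1 / 2 ^ N / 256 \<le> measure dA {z \<in> space dA. rho z \<le> 1 / 2 ^ N \<and> S / 8 < (norm (F z))\<^sup>2}"
proof -
  define r :: real where "r = 1 / 2 ^ N"
  have r: "0 < r" "r < 1" using N by (auto simp: r_def)
  define \<phi> where "\<phi> = (indicator {..r} :: real \<Rightarrow> real)"
  have \<phi>0: "0 \<le> \<phi> t" for t by (simp add: \<phi>_def)
  have [measurable]: "\<phi> \<in> borel_measurable borel" by (simp add: \<phi>_def)
  have int: "integrable dA (\<lambda>w. \<phi> (rho w))"
    by (rule dA.integrable_const_bound[where B = 1]) (auto simp: \<phi>_def indicator_def)
  have bdd: "integrable dA (\<lambda>z. \<phi> (rho z) * h z)" if [measurable]: "h \<in> borel_measurable dA" and "\<And>z. z \<in> space dA \<Longrightarrow> \<bar>h z\<bar> \<le> B" for h B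
  proof (rule Bochner_Integration.integrable_bound[OF integrable_mult_left[OF int, of B]])
    show "AE z in dA. norm (\<phi> (rho z) * h z) \<le> norm (\<phi> (rho z) * B)"
      by (rule AE_I2) (use that(2) in \<open>force simp: \<phi>_def indicator_def\<close>)
  qed measurable
  have I0: "(LINT z|dA. \<phi> (rho z)) = r"
  proof -
    have A: "{z \<in> space dA. rho z \<le> r} \<in> sets dA" by measurable
    have "(LINT z|dA. \<phi> (rho z)) = (LINT z|dA. indicator {z \<in> space dA. rho z \<le> r} z)"
      by (rule Bochner_Integration.integral_cong) (auto simp: \<phi>_def indicator_def)
    also have "\<dots> = measure dA {z \<in> space dA. rho z \<le> r}"
      using sets.sets_into_space[OF A] by (simp add: Int_absorb2)
    finally have "(LINT z|dA. \<phi> (rho z)) = measure dA {z \<in> space dA. rho z \<le> r}" .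
    then show ?thesis using emeasure_rho_le[of r] r by (simp add: measure_def)
  qed
  define B where "B = (\<Sum>k<N. \<bar>\<beta> k\<bar>)"
  have FB: "norm (F z) \<le> B" if "z \<in> space dA" for z
    unfolding F_def B_def using that by (intro sum_norm_le) (auto simp: norm_mult norm_power power_le_one intro!: mult_left_le)
  have B0: "B \<ge> 0" by (auto simp: B_def intro: sum_nonneg)
  have Fm [measurable]: "F \<in> borel_measurable dA" unfolding F_def by measurable
  have i2: "integrable dA (\<lambda>z. \<phi> (rho z) * (norm (F z))\<^sup>2)"
    by (rule bdd[where B = "B\<^sup>2"]) (use FB in \<open>auto intro!: power_mono\<close>)
  have i4: "integrable dA (\<lambda>z. \<phi> (rho z) * (norm (F z)) ^ 4)"
    by (rule bdd[where B = "B ^ 4"]) (use FB in \<open>auto intro!: power_mono\<close>)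
  have m2: "S * r / 4 \<le> (LINT z|dA. \<phi> (rho z) * (norm (F z))\<^sup>2)"
  proof -
    have "S * r / 4 = (\<Sum>k<N. (\<beta> k)\<^sup>2 * (1 / 4 * r))" by (simp add: S_def sum_distrib_right)
    also have "\<dots> \<le> (\<Sum>k<N. (\<beta> k)\<^sup>2 * (LINT z|dA. \<phi> (rho z) * norm z ^ (2 * 2 ^ k)))"
    proof (intro sum_mono mult_left_mono)
      fix k assume k: "k \<in> {..<N}"
      have "1 / 4 * r = (LINT z|dA. \<phi> (rho z) * (1 / 4))" by (simp add: I0)
      also have "\<dots> \<le> (LINT z|dA. \<phi> (rho z) * norm z ^ (2 * 2 ^ k))"
      proof (rule integral_mono)
        show "integrable dA (\<lambda>z. \<phi> (rho z) * norm z ^ (2 * 2 ^ k))"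
          by (rule bdd[where B = 1]) (auto simp: power_le_one)
        fix z assume z: "z \<in> space dA"
        show "\<phi> (rho z) * (1 / 4) \<le> \<phi> (rho z) * norm z ^ (2 * 2 ^ k)"
        proof (cases "rho z \<le> r")
          case True
          have rz: "0 < rho z" "rho z \<le> 1" using rho_bounds z by auto
          \<comment> \<open>The ring is thin enough for the exponent \<open>2 ^ N\<close>, hence for
            all smaller ones: no monomial of the sum has decayed there.\<close>
          have "1 / 4 \<le> (1 - rho z) ^ (2 ^ N)"
            using True rz N by (intro one_minus_inverse_power_ge) (auto simp: r_def)
          also have "\<dots> \<le> (1 - rho z) ^ (2 ^ k)" using k rz by (intro power_decreasing[of "2 ^ k" "2 ^ N"] power_increasing) auto
          also have "\<dots> = norm z ^ (2 * 2 ^ k)" by (simp add: rho_def power_mult)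
          finally show ?thesis by (intro mult_left_mono \<phi>0)
        qed (simp add: \<phi>_def)
      qed (use int in simp)
      finally show "1 / 4 * r \<le> (LINT z|dA. \<phi> (rho z) * norm z ^ (2 * 2 ^ k))" .
    qed auto
    also have "\<dots> = (LINT z|dA. \<phi> (rho z) * (norm (F z))\<^sup>2)"
      unfolding F_def by (rule lacunary_moments(1)[OF _ int \<phi>0, symmetric]) measurable
    finally show ?thesis .
  qed
  have m4: "(LINT z|dA. \<phi> (rho z) * (norm (F z)) ^ 4) \<le> 4 * S\<^sup>2 * r"
    using lacunary_moments(2)[OF _ int \<phi>0, where N = N and \<beta> = \<beta>] unfolding F_def S_def I0 by simp
  define E where "E = {z \<in> space dA. rho z \<le> r \<and> S / 8 < (norm (F z))\<^sup>2}"
  have [measurable]: "E \<in> sets dA" unfolding E_def by measurable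
  have iE: "integrable dA (indicator E :: complex \<Rightarrow> real)"
    by (rule integrable_real_indicator) (auto simp: dA.emeasure_eq_measure)
  have "S * r / 4 \<le> (LINT z|dA. \<phi> (rho z) * (norm (F z))\<^sup>2)" by (rule m2)
  \<comment> \<open>Off \<open>E\<close> the square of \<open>F\<close> is at most S / 8 on the
    ring; on \<open>E\<close> the arithmetic-geometric mean inequality bounds it by
    \<open>|F|^4 / (64 S) + 16 S\<close>. From the second moment S r / 4 this removes S r / 8 and,
    by the fourth moment, S r / 16. The remaining S r / 16 is at most 16 S |E|, whence the constant
    256.\<close>
  also have "\<dots> \<le> (LINT z|dA. S / 8 * \<phi> (rho z) + (1 / (64 * S) * (\<phi> (rho z) * (norm (F z)) ^ 4) + 16 * S * indicator E z))"
  proof (rule integral_mono)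
    fix z assume z: "z \<in> space dA"
    show "\<phi> (rho z) * (norm (F z))\<^sup>2 \<le> S / 8 * \<phi> (rho z) + (1 / (64 * S) * (\<phi> (rho z) * (norm (F z)) ^ 4) + 16 * S * indicator E z)"
    proof (cases "z \<in> E")
      case True
      define x where "x = (norm (F z))\<^sup>2"
      have "0 \<le> (x - 32 * S)\<^sup>2 / (64 * S)" using S by simp
      also have "\<dots> = 1 / (64 * S) * x\<^sup>2 + 16 * S - x" using S by (simp add: power2_eq_square field_simps)
      finally have "x \<le> 1 / (64 * S) * x\<^sup>2 + 16 * S" by simp
      moreover have "(norm (F z)) ^ 4 = x\<^sup>2" by (simp add: x_def flip: power_mult)
      moreover have "\<phi> (rho z) = 1" "indicator E z = (1::real)" using True by (simp_all add: E_def \<phi>_def)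
      ultimately show ?thesis using S by (simp add: x_def[symmetric])
    next
      case False
      then have E0: "indicator E z = (0::real)" by simp
      have "\<phi> (rho z) = 0 \<or> (norm (F z))\<^sup>2 \<le> S / 8" using False z by (auto simp: E_def \<phi>_def indicator_def)
      then have "\<phi> (rho z) * (norm (F z))\<^sup>2 \<le> S / 8 * \<phi> (rho z)"
        using mult_left_mono[of "(norm (F z))\<^sup>2" "S / 8" "\<phi> (rho z)"] \<phi>0[of "rho z"] by (auto simp: mult.commute)
      moreover have "0 \<le> 1 / (64 * S) * (\<phi> (rho z) * (norm (F z)) ^ 4)" using S \<phi>0 by simp
      ultimately show ?thesis unfolding E0 by linarith
    qed
  qed (use i2 i4 int iE in auto)
  also have "\<dots> = S / 8 * r + (1 / (64 * S) * (LINT z|dA. \<phi> (rho z) * (norm (F z)) ^ 4) + 16 * S * measure dA E)"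
  proof -
    have "E \<inter> ball 0 1 = E" by (auto simp: E_def)
    then show ?thesis using i4 int iE by (simp add: I0)
  qed
  also have "\<dots> \<le> S / 8 * r + (1 / (64 * S) * (4 * S\<^sup>2 * r) + 16 * S * measure dA E)"
    using S by (intro add_mono mult_left_mono m4) auto
  also have "1 / (64 * S) * (4 * S\<^sup>2 * r) = S * r / 16" using S by (simp add: power2_eq_square)
  finally have "S * (r / 256) \<le> S * measure dA E" by simp
  then have "r / 256 \<le> measure dA E" using S by simp
  then show ?thesis by (simp add: E_def r_def)
qed

text \<open>The frequency \<open>2 ^ k\<close> matches the width of the k-th shell, so
  \<open>|w| ^ 2 ^ k\<close> is bounded below there for \<open>k >= 1\<close>. The input pieces have
  disjoint supports, whereas all output monomials survive on one ring closer to the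
  boundary.\<close>

lemma T_not_bounded_endpoint:
  assumes c: "1 < c" "c < 2" and d: "0 < 2 - c + b" "2 - c + b < 1 / 2" and a: "- a > 2 - c + b"
  shows "\<not> T_bounded a b c (Lp_norm (ereal (1 / (2 - c + b)))) (Lweak_norm (ereal (- 1 / a)))"
proof
  define d where "d = 2 - c + b"
  define p where "p = 1 / d"
  define q where "q = - 1 / a"
  note dd = d[folded d_def] a[folded d_def]
  have a0: "a < 0" using dd by linarith
  have p1: "p \<ge> 1" "1 / p = d" "d * p = 1" using dd by (auto simp: p_def field_simps)
  have q: "1 / q = - a" using a0 by (simp add: q_def)
  assume "T_bounded a b c (Lp_norm (ereal (1 / (2 - c + b)))) (Lweak_norm (ereal (- 1 / a)))"
  then have "maps_boundedly a (T_kernel b c) (Lp_norm (ereal p)) (Lweak_norm (ereal q))"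
    by (simp add: T_bounded_def p_def q_def d_def)
  then obtain C where C: "C \<ge> 0" and Cb: "\<And>f t A. f \<in> borel_measurable dA \<Longrightarrow> t > 0 \<Longrightarrow> A \<ge> 0 \<Longrightarrow>
    (Lp_integral p f) \<le> ennreal A \<Longrightarrow>
    t * dist_fun (weighted_op a (T_kernel b c) f) t powr (1 / q) \<le> C * A powr (1 / p)"
    using Lp_weak_bounded_imp[OF p1(1)] by blast
  obtain m M where m: "0 < m" "\<And>n. m * real (Suc n) powr (c - 1) \<le> bcoeff c n"
    using bcoeff_bounds[of c] c by (metis less_trans zero_less_one)
  \<comment> \<open>The product with \<open>rho powr b\<close> is \<open>rho powr (c - 2)\<close> on
    the shell, with integral of order 2^(-k (c - 1)); this cancels the growth of
    \<open>bcoeff c (2 ^ k)\<close>.\<close>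
  define \<phi> where "\<phi> = (\<lambda>k::nat. \<lambda>t::real. t powr (- d) * indicator {1 / 2 ^ Suc k<..1 / 2 ^ k} t)"
  have [measurable]: "\<phi> k \<in> borel_measurable borel" for k unfolding \<phi>_def by measurable
  have \<phi>0: "0 \<le> \<phi> k t" for k t by (simp add: \<phi>_def)
  have bd: "d - b = 2 - c" by (simp add: d_def)
  have bphi: "t powr b * \<phi> k t = t powr (c - 2) * indicator {1 / 2 ^ Suc k<..1 / 2 ^ k} t" for k t
    by (simp add: \<phi>_def d_def mult.assoc[symmetric] powr_add[symmetric])
  have int: "integrable dA (\<lambda>w. rho w powr b * \<phi> k (rho w))" for k
  proof (rule dA.integrable_const_bound[where B = "(1 / 2 ^ Suc k) powr (c - 2)"], rule AE_I2)
    fix w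
    show "norm (rho w powr b * \<phi> k (rho w)) \<le> (1 / 2 ^ Suc k) powr (c - 2)"
      unfolding bphi using c by (cases "rho w \<in> {1 / 2 ^ Suc k<..1 / 2 ^ k}") (auto intro!: powr_mono2' simp del: power_Suc)
  qed measurable
  define \<beta> where "\<beta> = (\<lambda>k. bcoeff c (2 ^ k) * (LINT w|dA. rho w powr b * \<phi> k (rho w) * norm w ^ (2 * 2 ^ k)))"
  \<comment> \<open>For \<open>k = 0\<close> the lower bound 1 / 4 on \<open>(1 - t) ^ 2 ^ k\<close>
    fails near \<open>t = 1\<close>. The 8 combines this 1 / 4 with the relative width 1 / 2 of the
    shell.\<close>
  have \<beta>_ge: "m / 8 \<le> \<beta> k" if k: "k \<ge> 1" for k
  proof -
    let ?x = "1 / 2 ^ k :: real"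
    have x: "0 < ?x" "?x \<le> 1 / 2" using power_increasing[OF k, of "2::real"] by (auto simp: field_simps)
    have "ennreal (1 / 4 * ?x powr (c - 2)) * ennreal (?x / 2) = (\<integral>\<^sup>+t. ennreal (1 / 4 * ?x powr (c - 2)) * indicator {?x / 2<..?x} t \<partial>lborel)"
    proof -
      have "emeasure lborel {?x / 2<..?x} = ennreal (?x - ?x / 2)"
      proof (rule emeasure_lborel_Ioc)
        have "y / 2 \<le> y" if "0 < y" for y :: real using that by simp
        then show "?x / 2 \<le> ?x" using x(1) .
      qed
      also have "?x - ?x / 2 = ?x / 2" by simp
      finally show ?thesis by (subst nn_integral_cmult_indicator) (simp_all only: sets_lborel atLeastAtMost_borel greaterThanAtMost_borel)
    qed
    also have "\<dots> \<le> (\<integral>\<^sup>+t. (\<lambda>t. ennreal (t powr b * \<phi> k t * (1 - t) ^ (2 ^ k))) t * indicator {0<..<1} t \<partial>lborel)"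
    proof (intro nn_integral_mono)
      fix t :: real
      show "ennreal (1 / 4 * ?x powr (c - 2)) * indicator {?x / 2<..?x} t \<le> (\<lambda>t. ennreal (t powr b * \<phi> k t * (1 - t) ^ (2 ^ k))) t * indicator {0<..<1} t"
      proof (cases "t \<in> {?x / 2<..?x}")
        case True
        have tx: "t \<le> ?x" using True by simp
        have "t \<le> 1 / 2" by (rule order_trans[OF tx x(2)])
        moreover have "0 < t" by (rule less_trans[of 0 "?x / 2"]) (use True x(1) in auto)
        ultimately have t: "0 < t" "t < 1" "t \<le> ?x" using tx by simp_all
        have "1 / 4 \<le> (1 - t) ^ (2 ^ k)" using t k by (intro one_minus_inverse_power_ge) auto
        moreover have "?x powr (c - 2) \<le> t powr (c - 2)" using t c by (intro powr_mono2') auto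
        ultimately have "1 / 4 * ?x powr (c - 2) \<le> (1 - t) ^ (2 ^ k) * t powr (c - 2)"
          by (intro mult_mono) auto
        also have "\<dots> = t powr b * \<phi> k t * (1 - t) ^ (2 ^ k)" unfolding bphi using True by (simp add: mult.commute)
        finally show ?thesis using True t by (simp add: ennreal_leI)
      qed simp
    qed
    also have "\<dots> = (\<integral>\<^sub>D w. (\<lambda>t. ennreal (t powr b * \<phi> k t * (1 - t) ^ (2 ^ k))) (rho w))"
      by (rule nn_integral_dA_rho[symmetric]) measurable
    also have "\<dots> = (\<integral>\<^sub>D w. ennreal (rho w powr b * \<phi> k (rho w) * norm w ^ (2 * 2 ^ k)))"
      by (intro nn_integral_cong) (simp add: rho_def power_mult)
    also have "\<dots> = ennreal (LINT w|dA. rho w powr b * \<phi> k (rho w) * norm w ^ (2 * 2 ^ k))"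
    proof (rule nn_integral_eq_integral)
      show "integrable dA (\<lambda>w. rho w powr b * \<phi> k (rho w) * norm w ^ (2 * 2 ^ k))"
      proof (rule Bochner_Integration.integrable_bound[OF int[of k]])
        show "AE w in dA. norm (rho w powr b * \<phi> k (rho w) * norm w ^ (2 * 2 ^ k)) \<le> norm (rho w powr b * \<phi> k (rho w))"
          by (rule AE_I2) (auto simp: abs_mult power_le_one \<phi>0 intro!: mult_left_le)
      qed measurable
    qed (simp add: \<phi>0)
    finally have "ennreal (1 / 4 * ?x powr (c - 2) * (?x / 2)) \<le> ennreal (LINT w|dA. rho w powr b * \<phi> k (rho w) * norm w ^ (2 * 2 ^ k))"
      by (subst ennreal_mult) simp_all
    then have L: "1 / 4 * ?x powr (c - 2) * (?x / 2) \<le> (LINT w|dA. rho w powr b * \<phi> k (rho w) * norm w ^ (2 * 2 ^ k))"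
      by (subst (asm) ennreal_le_iff) (auto intro!: integral_nonneg_AE simp: \<phi>0)
    have "m * (2 ^ k) powr (c - 1) \<le> m * real (Suc (2 ^ k)) powr (c - 1)"
      using m c by (intro mult_left_mono powr_mono2) auto
    also have "\<dots> \<le> bcoeff c (2 ^ k)" by (rule m)
    finally have Bc: "m * (2 ^ k) powr (c - 1) \<le> bcoeff c (2 ^ k)" .
    have e1: "?x powr (c - 2) * ?x = ?x powr (c - 1)" using x by (simp add: powr_diff powr_numeral power2_eq_square)
    have e2: "(2 ^ k) powr (c - 1) * ?x powr (c - 1) = 1" by (simp flip: powr_mult)
    have "(m * u) * (1 / 4 * v * (y / 2)) = m / 8 * (u * (v * y))" for u v y by simp
    then have "(m * (2 ^ k) powr (c - 1)) * (1 / 4 * ?x powr (c - 2) * (?x / 2)) = m / 8 * ((2 ^ k) powr (c - 1) * (?x powr (c - 2) * ?x))" .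
    also have "\<dots> = m / 8" unfolding e1 e2 by simp
    finally have "m / 8 = (m * (2 ^ k) powr (c - 1)) * (1 / 4 * ?x powr (c - 2) * (?x / 2))" ..
    also have "\<dots> \<le> \<beta> k" unfolding \<beta>_def
      using L Bc m bcoeff_pos[of c "2 ^ k"] c by (intro mult_mono) auto
    finally show ?thesis .
  qed
  have main: "sqrt ((m / 8)\<^sup>2 / 8) * 256 powr a * real n powr (1 / 2) \<le> C * 4 powr d * real n powr d" if n: "n \<ge> 1" for n
  proof -
    \<comment> \<open>The term \<open>k = 0\<close> has no lower bound, so \<open>n + 1\<close>
      terms leave \<open>n\<close> useful ones.\<close>
    define N where "N = Suc n"
    define f where "f = (\<lambda>w. \<Sum>k<N. complex_of_real (\<phi> k (rho w)) * w ^ (2 ^ k))"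
    define F where "F = (\<lambda>z. \<Sum>k<N. complex_of_real (\<beta> k) * z ^ (2 ^ k))"
    define S where "S = (\<Sum>k<N. (\<beta> k)\<^sup>2)"
    have f [measurable]: "f \<in> borel_measurable dA" unfolding f_def by measurable
    have S_ge: "(m / 8)\<^sup>2 * real n \<le> S"
    proof -
      have "(m / 8)\<^sup>2 * real n = (\<Sum>k\<in>{1..<N}. (m / 8)\<^sup>2)" by (simp add: N_def)
      also have "\<dots> \<le> (\<Sum>k\<in>{1..<N}. (\<beta> k)\<^sup>2)" using m by (intro sum_mono power_mono \<beta>_ge) auto
      also have "\<dots> \<le> S" unfolding S_def by (intro sum_mono2) auto
      finally show ?thesis .
    qed
    have S0: "S > 0"
    proof -
      have "0 < (m / 8)\<^sup>2 * real n" using m n by simp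
      then show ?thesis using S_ge by linarith
    qed
    have Tf: "(T_integral b c f z) = F z" if z: "z \<in> ball 0 1" for z
    proof -
      have "(T_integral b c f z) = (LINT w|dA. (\<Sum>k<N. T_kernel b c z w * (complex_of_real (\<phi> k (rho w)) * w ^ (2 ^ k))))"
        by (simp add: f_def sum_distrib_left)
      also have "\<dots> = (\<Sum>k<N. (LINT w|dA. T_kernel b c z w * (complex_of_real (\<phi> k (rho w)) * w ^ (2 ^ k))))"
        using c by (intro Bochner_Integration.integral_sum T_integral_monomial(1) z int) auto
      also have "\<dots> = F z" unfolding F_def \<beta>_def
        using c by (intro sum.cong refl T_integral_monomial(2) z int) auto
      finally show ?thesis .
    qed
    have fA: "Lp_integral p f \<le> ennreal (4 * real n)"
    proof -
      define e :: real where "e = 1 / 2 ^ N"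
      have e: "0 < e" "e \<le> 1" by (auto simp: e_def)
      have "Lp_integral p f \<le> (\<integral>\<^sub>D w. (\<lambda>t. ennreal (t powr (- 1)) * indicator {e..1} t) (rho w))"
      proof (intro nn_integral_mono)
        fix w assume w: "w \<in> space dA"
        have rw: "0 < rho w" "rho w \<le> 1" using rho_bounds w by auto
        show "ennreal (norm (f w) powr p) \<le> (\<lambda>t. ennreal (t powr (- 1)) * indicator {e..1} t) (rho w)"
        \<comment> \<open>At most one summand is nonzero because the shells are disjoint; hence
          \<open>|f| <= rho powr (- d)\<close>.\<close>
        proof (cases "\<exists>k<N. rho w \<in> {1 / 2 ^ Suc k<..1 / 2 ^ k}")
          case True
          then obtain k where k: "k < N" "rho w \<in> {1 / 2 ^ Suc k<..1 / 2 ^ k}" by blast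
          have uniq: "j = k" if "rho w \<in> {1 / 2 ^ Suc j<..1 / 2 ^ j}" for j
          proof (rule ccontr)
            have *: "\<not> i < l" if "rho w \<in> {1 / 2 ^ Suc i<..1 / 2 ^ i}" "rho w \<in> {1 / 2 ^ Suc l<..1 / 2 ^ l}" for i l
            proof
              assume "i < l"
              then have "(2::real) ^ Suc i \<le> 2 ^ l" by (intro power_increasing) auto
              then have "1 / 2 ^ l \<le> (1 / 2 ^ Suc i :: real)" by (intro divide_left_mono) auto
              then show False using that by auto
            qed
            assume "j \<noteq> k"
            then show False using *[OF that k(2)] *[OF k(2) that] by linarith
          qed
          have "f w = (\<Sum>j<N. if j = k then complex_of_real (\<phi> k (rho w)) * w ^ (2 ^ k) else 0)"
          proof -
            have "\<phi> j (rho w) = 0" if "j \<noteq> k" for j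
              using uniq[of j] that by (auto simp: \<phi>_def indicator_def simp del: power_Suc)
            then show ?thesis unfolding f_def by (intro sum.cong refl) auto
          qed
          also have "\<dots> = complex_of_real (\<phi> k (rho w)) * w ^ (2 ^ k)" using k by simp
          finally have "norm (f w) = \<phi> k (rho w) * norm w ^ (2 ^ k)" by (simp add: norm_mult norm_power \<phi>0)
          also have "\<dots> \<le> \<phi> k (rho w)" using w by (intro mult_left_le \<phi>0) (auto simp: power_le_one)
          also have "\<phi> k (rho w) = rho w powr (- d)" using k by (simp add: \<phi>_def)
          finally have "norm (f w) powr p \<le> (rho w powr (- d)) powr p" using p1 by (intro powr_mono2) auto
          also have "\<dots> = rho w powr (- 1)" using p1 by (simp add: powr_powr)
          finally have "norm (f w) powr p \<le> rho w powr (- 1)" .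
          moreover have "e \<le> rho w"
          proof -
            have "(2::real) ^ Suc k \<le> 2 ^ N" using k by (intro power_increasing) auto
            then have "e \<le> 1 / 2 ^ Suc k" unfolding e_def by (intro divide_left_mono) auto
            then show ?thesis using k by auto
          qed
          ultimately show ?thesis using rw by (simp add: ennreal_leI)
        next
          case False
          then have "f w = 0" unfolding f_def by (intro sum.neutral) (auto simp: \<phi>_def simp del: power_Suc)
          then show ?thesis using p1 by simp
        qed
      qed
      also have "\<dots> = (\<integral>\<^sup>+t. ennreal (t powr (- 1)) * indicator {e..1} t * indicator {0<..<1} t \<partial>lborel)"
        by (rule nn_integral_dA_rho) measurable
      also have "\<dots> \<le> (\<integral>\<^sup>+t. ennreal (t powr (- 1)) * indicator {e..1} t \<partial>lborel)"
        by (intro nn_integral_mono) (auto simp: indicator_def)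
      also have "\<dots> = ennreal (ln (1 / e))" by (rule nn_integral_inverse_Icc[OF e])
      also have "ln (1 / e) = real N * ln 2" by (simp add: e_def ln_realpow)
      also have "\<dots> \<le> 4 * real n"
      proof -
        have "real N * ln 2 \<le> real N * 1" using ln_2_less_1 by (intro mult_left_mono) auto
        also have "\<dots> \<le> 4 * real n" using n by (simp add: N_def)
        finally show ?thesis .
      qed
      finally show ?thesis by (simp add: ennreal_leI)
    qed
    define r :: real where "r = 1 / 2 ^ N"
    have r: "r > 0" by (simp add: r_def)
    \<comment> \<open>On the ring \<open>rho z <= r\<close> the factor \<open>rho z powr a\<close>
      is at least \<open>r powr a\<close>. This power cancels against that of the measure r / 256,
      since 1 / q = - a.\<close>
    define t where "t = r powr a * sqrt (S / 8)"
    have t: "t > 0" using r S0 by (simp add: t_def)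
    have "r / 256 \<le> measure dA {z \<in> space dA. rho z \<le> r \<and> S / 8 < (norm (F z))\<^sup>2}"
      unfolding r_def F_def S_def by (rule lacunary_large_on_ring) (use S0 in \<open>auto simp: N_def S_def\<close>)
    also have "\<dots> \<le> dist_fun (weighted_op a (T_kernel b c) f) t"
      unfolding dist_fun_def
    proof (rule dA.finite_measure_mono)
      show "{z \<in> space dA. rho z \<le> r \<and> S / 8 < (norm (F z))\<^sup>2} \<subseteq> {z \<in> space dA. t < norm (weighted_op a (T_kernel b c) f z)}"
      proof safe
        fix z assume z: "z \<in> space dA" and rz: "rho z \<le> r" and Fz: "S / 8 < (norm (F z))\<^sup>2"
        have rz0: "rho z > 0" using rho_bounds(1) z by auto
        have "sqrt (S / 8) < norm (F z)" using Fz by (intro real_less_lsqrt) auto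
        moreover have "r powr a \<le> rho z powr a" using rz rz0 a0 by (intro powr_mono2') auto
        ultimately have "r powr a * sqrt (S / 8) < rho z powr a * norm (F z)"
          using r S0 by (intro mult_le_less_imp_less) auto
        then show "t < norm (weighted_op a (T_kernel b c) f z)"
          using z by (simp add: t_def weighted_op_def norm_mult Tf rho_def)
      qed
      have "weighted_op a (T_kernel b c) f \<in> borel_measurable dA"
        by (rule weighted_op_measurable[OF f T_kernel_measurable])
      then show "{z \<in> space dA. t < norm (weighted_op a (T_kernel b c) f z)} \<in> sets dA" by measurable
    qed
    finally have mdist: "r / 256 \<le> dist_fun (weighted_op a (T_kernel b c) f) t" .
    have "sqrt ((m / 8)\<^sup>2 / 8) * 256 powr a * real n powr (1 / 2) = sqrt ((m / 8)\<^sup>2 * real n / 8) * 256 powr a"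
      by (simp add: powr_half_sqrt real_sqrt_mult real_sqrt_divide)
    also have "\<dots> \<le> sqrt (S / 8) * 256 powr a"
      using S_ge by (intro mult_right_mono real_sqrt_le_mono divide_right_mono) auto
    also have "\<dots> = t * (r / 256) powr (- a)"
      using r by (simp add: t_def powr_divide powr_minus field_simps)
    also have "\<dots> \<le> t * dist_fun (weighted_op a (T_kernel b c) f) t powr (1 / q)"
      unfolding q using mdist r t a0 by (intro mult_left_mono powr_mono2) auto
    also have "\<dots> \<le> C * (4 * real n) powr (1 / p)" by (rule Cb[OF f t _ fA]) simp
    also have "\<dots> = C * 4 powr d * real n powr d" by (simp add: p1 powr_mult)
    finally show ?thesis .
  qed
  show False
    by (rule powr_growth_contradiction[of d "1 / 2" "sqrt ((m / 8)\<^sup>2 / 8) * 256 powr a" "C * 4 powr d"])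
       (use main dd m in auto)
qed

section \<open>Extended exponents and assembly of the cases\<close>

lemma one_div_ereal_cases:
  fixes p :: ereal
  assumes "1 \<le> p"
  obtains "p = \<infinity>" "1 / p = 0" | r where "p = ereal r" "1 \<le> r" "1 / p = ereal (1 / r)"
proof (cases p)
  case (real r)
  then show ?thesis using assms that(2)[of r] by (simp add: one_ereal_def)
next
  case PInf
  then show ?thesis using that(1) by simp
next
  case MInf
  then show ?thesis using assms by simp
qed

lemma Lp_weak_bounded:
  fixes a b c :: real and p q :: ereal
  assumes "a > -1" and "0 < c - a - b - 2" and "1 < c" and "c < a + 2" "c < b + 2"
    and p: "1 \<le> p" and q: "1 \<le> q" and
    pq: "1 / q = 1 / p + ereal (c - a - b - 2) \<and> 1 / p < ereal (b + 1) \<and> 1 / q > ereal (- a)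
            \<or> 0 \<le> 1 / p \<and> 1 / p < ereal (2 - c + b) \<and> q = ereal (- 1 / a)"
  shows "T_bounded a b c (Lp_norm p) (Lweak_norm q) \<and> S_bounded a b c (Lp_norm p) (Lweak_norm q)"
proof -
  have d: "0 < 2 - c + b" "2 - c + b < 1" "- a > 2 - c + b" "b < 0" using assms(1-5) by auto
  show ?thesis
  proof (cases rule: one_div_ereal_cases[OF p])
    case 1
    have "q = ereal (- 1 / a)"
    proof -
      \<comment> \<open>With 1 / p = 0 the first alternative would give 1 / q = s, which is less
        than \<open>d + s = - a\<close>.\<close>
      have "1 / q = ereal (c - a - b - 2) \<Longrightarrow> 1 / q > ereal (- a) \<Longrightarrow> False" using d by simp
      then show ?thesis using pq 1 by auto
    qed
    then show ?thesis using Linf_bounded[of c b a] 1 d assms by simp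
  next
    case (2 r)
    show ?thesis
    proof (cases rule: one_div_ereal_cases[OF q])
      case 1
      have "1 / q \<noteq> 1 / p + ereal (c - a - b - 2)"
      proof
        assume "1 / q = 1 / p + ereal (c - a - b - 2)"
        then have "0 = 1 / r + (c - a - b - 2)" using 1 2 by (simp add: zero_ereal_def)
        moreover have "1 / r > 0" using 2 by simp
        ultimately show False using assms by linarith
      qed
      then show ?thesis using pq 1 by auto
    next
      case (2 s)
      note r = \<open>p = ereal r\<close> \<open>1 \<le> r\<close> \<open>1 / p = ereal (1 / r)\<close>
      from pq show ?thesis
      proof
        assume *: "1 / q = 1 / p + ereal (c - a - b - 2) \<and> 1 / p < ereal (b + 1) \<and> 1 / q > ereal (- a)"
        then have "1 / s = 1 / r + (c - a - b - 2)" "1 / r < b + 1" "- a < 1 / s" using r 2 by auto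
        then show ?thesis unfolding r(1) 2(1)
          using d assms r by (intro Lp_bounded_small_exponent) auto
      next
        assume *: "0 \<le> 1 / p \<and> 1 / p < ereal (2 - c + b) \<and> q = ereal (- 1 / a)"
        then have "1 / r < 2 - c + b" using r by simp
        then have "(2 - c + b) * r > 1" using r by (simp add: field_simps)
        then show ?thesis using * unfolding r(1)
          using d assms Lp_bounded_large_exponent[of c b a r] by simp
      qed
    qed
  qed
qed

lemma Lorentz_weak_bounded:
  fixes a b c p :: real and q :: ereal
  assumes "a > -1" "b > -1" and "0 < c - a - b - 2" and "1 < c" and "c < a + 2" "c < b + 2"
    and q: "1 \<le> q" and
    pq: "p = 1 / (2 - c + b) \<and> q = ereal (- 1 / a)
            \<or> p = 1 / (b + 1) \<and> ereal (c - 1 - a) \<le> 1 / q \<and> 1 / q \<le> 1"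
  shows "T_bounded a b c (Lp1_norm p) (Lweak_norm q) \<and> S_bounded a b c (Lp1_norm p) (Lweak_norm q)"
  using pq
proof
  assume *: "p = 1 / (2 - c + b) \<and> q = ereal (- 1 / a)"
  then show ?thesis using Lorentz_bounded_kernel_endpoint[of c b a] assms(1-6) by simp
next
  assume *: "p = 1 / (b + 1) \<and> ereal (c - 1 - a) \<le> 1 / q \<and> 1 / q \<le> 1"
  show ?thesis
  proof (cases rule: one_div_ereal_cases[OF q])
    case 1
    \<comment> \<open>An infinite \<open>q\<close> is impossible here, since
      \<open>c - 1 - a > b + 1 > 0\<close>.\<close>
    then show ?thesis using * assms(1-6) by (simp add: zero_ereal_def)
  next
    case (2 s)
    then have "c - 1 - a \<le> 1 / s" using * by simp
    then show ?thesis using * 2 Lorentz_bounded_integrability_endpoint[of c a b s] assms(1-6) by simp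
  qed
qed

lemma not_bounded_integrability_endpoint:
  assumes "b > -1" "b < 0" "1 < c"
  shows "\<not> T_bounded a b c (Lp_norm (ereal (1 / (b + 1)))) NY \<and> \<not> S_bounded a b c (Lp_norm (ereal (1 / (b + 1)))) NY"
  unfolding T_bounded_def S_bounded_def
  using not_bounded_at_integrability_endpoint[OF norm_kernels(1), where b = b and c = c and a = a and NY = NY]
    not_bounded_at_integrability_endpoint[OF norm_kernels(2), where b = b and c = c and a = a and NY = NY] assms by simp

theorem theorem10p5:
  fixes a b c :: real
  assumes "a > -1" and "b > -1"
    and "0 < c - a - b - 2" and "c - a - b - 2 < 1"
    and "1 < c" and "c < min (a + 2) (b + 2)"
  shows
    "(0 < 2 - c + b \<and> 2 - c + b < 1 / 2 \<longrightarrow>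
        (\<forall>p q :: ereal. 1 \<le> p \<and> 1 \<le> q \<and>
           (1 / q = 1 / p + ereal (c - a - b - 2) \<and> 1 / p < ereal (b + 1) \<and> 1 / q > ereal (- a)
            \<or> 0 \<le> 1 / p \<and> 1 / p < ereal (2 - c + b) \<and> q = ereal (- 1 / a)) \<longrightarrow>
           T_bounded a b c (Lp_norm p) (Lweak_norm q) \<and>
           S_bounded a b c (Lp_norm p) (Lweak_norm q)) \<and>
        (\<forall>p q :: ereal. 1 \<le> p \<and> 1 \<le> q \<and>
           (p = ereal (1 / (2 - c + b)) \<and> q = ereal (- 1 / a)
            \<or> p = ereal (1 / (b + 1)) \<and> ereal (c - 1 - a) \<le> 1 / q \<and> 1 / q \<le> 1) \<longrightarrow>
           \<not> T_bounded a b c (Lp_norm p) (Lweak_norm q) \<and>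
           \<not> S_bounded a b c (Lp_norm p) (Lweak_norm q)) \<and>
        (\<forall>(p::real) (q::ereal). 1 \<le> p \<and> 1 \<le> q \<and>
           (p = 1 / (2 - c + b) \<and> q = ereal (- 1 / a)
            \<or> p = 1 / (b + 1) \<and> ereal (c - 1 - a) \<le> 1 / q \<and> 1 / q \<le> 1) \<longrightarrow>
           T_bounded a b c (Lp1_norm p) (Lweak_norm q) \<and>
           S_bounded a b c (Lp1_norm p) (Lweak_norm q))) \<and>
     (1 / 2 \<le> 2 - c + b \<and> 2 - c + b < 1 \<longrightarrow>
        (\<forall>p q :: ereal. 1 \<le> p \<and> 1 \<le> q \<and>
           (1 / q = 1 / p + ereal (c - a - b - 2) \<and> 1 / p < ereal (b + 1) \<and> 1 / q > ereal (- a)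
            \<or> 0 \<le> 1 / p \<and> 1 / p < ereal (2 - c + b) \<and> q = ereal (- 1 / a)) \<longrightarrow>
           T_bounded a b c (Lp_norm p) (Lweak_norm q) \<and>
           S_bounded a b c (Lp_norm p) (Lweak_norm q)) \<and>
        (\<forall>p q :: ereal. 1 \<le> p \<and> 1 \<le> q \<and>
           p = ereal (1 / (b + 1)) \<and> ereal (c - 1 - a) \<le> 1 / q \<and> 1 / q \<le> 1 \<longrightarrow>
           \<not> T_bounded a b c (Lp_norm p) (Lweak_norm q) \<and>
           \<not> S_bounded a b c (Lp_norm p) (Lweak_norm q)) \<and>
        (T_bounded a b c (Lp_norm (ereal (1 / (2 - c + b)))) (Lweak_norm (ereal (- 1 / a))) \<and>
         \<not> S_bounded a b c (Lp_norm (ereal (1 / (2 - c + b)))) (Lweak_norm (ereal (- 1 / a)))) \<and>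
        (\<forall>(p::real) (q::ereal). 1 \<le> p \<and> 1 \<le> q \<and>
           (p = 1 / (2 - c + b) \<and> q = ereal (- 1 / a)
            \<or> p = 1 / (b + 1) \<and> ereal (c - 1 - a) \<le> 1 / q \<and> 1 / q \<le> 1) \<longrightarrow>
           T_bounded a b c (Lp1_norm p) (Lweak_norm q) \<and>
           S_bounded a b c (Lp1_norm p) (Lweak_norm q)))"
proof -
  have d: "- a > 2 - c + b" "b < 0" "c < a + 2" "c < b + 2" "c < 2" using assms by auto
  have strong: "T_bounded a b c (Lp_norm p) (Lweak_norm q) \<and> S_bounded a b c (Lp_norm p) (Lweak_norm q)"
    if "1 \<le> p \<and> 1 \<le> q \<and>
           (1 / q = 1 / p + ereal (c - a - b - 2) \<and> 1 / p < ereal (b + 1) \<and> 1 / q > ereal (- a)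
            \<or> 0 \<le> 1 / p \<and> 1 / p < ereal (2 - c + b) \<and> q = ereal (- 1 / a))" for p q :: ereal
    using that assms d by (intro Lp_weak_bounded) auto
  have Lorentz: "T_bounded a b c (Lp1_norm p) (Lweak_norm q) \<and> S_bounded a b c (Lp1_norm p) (Lweak_norm q)"
    if "1 \<le> p \<and> 1 \<le> q \<and>
           (p = 1 / (2 - c + b) \<and> q = ereal (- 1 / a)
            \<or> p = 1 / (b + 1) \<and> ereal (c - 1 - a) \<le> 1 / q \<and> 1 / q \<le> 1)" for p :: real and q :: ereal
    using that assms d by (intro Lorentz_weak_bounded) auto
  have right: "\<not> T_bounded a b c (Lp_norm p) NY \<and> \<not> S_bounded a b c (Lp_norm p) NY"
    if "p = ereal (1 / (b + 1))" for p :: ereal and NY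
    unfolding that using assms d by (intro not_bounded_integrability_endpoint)
  have S_end: "\<not> S_bounded a b c (Lp_norm (ereal (1 / (2 - c + b)))) (Lweak_norm (ereal (- 1 / a)))"
    if "2 - c + b < 1"
    using that assms d by (intro S_not_bounded_endpoint) auto
  have T_end: "\<not> T_bounded a b c (Lp_norm (ereal (1 / (2 - c + b)))) (Lweak_norm (ereal (- 1 / a)))"
    if "0 < 2 - c + b \<and> 2 - c + b < 1 / 2"
    using that assms d by (intro T_not_bounded_endpoint) auto
  have T_end': "T_bounded a b c (Lp_norm (ereal (1 / (2 - c + b)))) (Lweak_norm (ereal (- 1 / a)))"
    if "1 / 2 \<le> 2 - c + b \<and> 2 - c + b < 1"
    using that assms d by (intro T_bounded_endpoint) auto
  have endpoint: "\<not> T_bounded a b c (Lp_norm p) (Lweak_norm q) \<and> \<not> S_bounded a b c (Lp_norm p) (Lweak_norm q)"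
    if "0 < 2 - c + b \<and> 2 - c + b < 1 / 2" and "p = ereal (1 / (2 - c + b)) \<and> q = ereal (- 1 / a)" for p q
    using that S_end T_end by simp
  show ?thesis
    by (rule conjI; rule impI; intro conjI allI)
      (use strong in blast, use endpoint right in blast, use Lorentz in blast,
       use strong in blast, use right in blast, use T_end' in blast, use S_end in blast, use Lorentz in blast)
qed

end
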